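(* Let $\kappa$ be an infinite cardinal (viewed as an initial ordinal), let $n\geq 1$, and let $q_1,\dots,q_n$ be ordinals. Suppose that an ordering $\leq$ on a set $X$ of cardinality $\kappa$ is the intersection of $n$ orderings $\leq_1,\dots,\leq_n$ on $X$ such that each $(X,\leq_i)$ is a WPO of length at most $\kappa\cdot q_i$. Then the length of $(X,\leq)$ is at most $\kappa\cdot\bigotimes_{1\leq i\leq n}q_i$. Moreover, when the $q_i$ are non-zero and of cardinality at most $\kappa$, this bound is attained for a family of $n$ linear orderings of types $\kappa\cdot q_1,\dots,\kappa\cdot q_n$: there are well orderings $\leq_1,\dots,\leq_n$ of respective types $\kappa\cdot q_1,\dots,\kappa\cdot q_n$ on a set of cardinality $\kappa$ whose intersection has length exactly $\kappa\cdot\bigotimes_{1\leq i\leq n}q_i$.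
   Context: Orderings are partial orders, seen as sets of ordered pairs; the intersection of orderings on the same set is their set-theoretic intersection. A poset is well partially ordered (WPO) if it is well founded and has no infinite antichain; equivalently all its linear extensions are well orders. The length $\ell(\mathbf p)$ of a WPO $\mathbf p$ is the largest ordinal type of a linear extension of $\mathbf p$ (the maximum exists by de Jongh–Parikh). $\otimes$ denotes the Hessenberg (natural) product of ordinals; $\kappa\cdot q$ is the usual ordinal product, the type of $q$ successive copies of $\kappa$. *)

theory Defs
  imports Main
begin

unbundle cardinal_syntax

text \<open>
  As in the theories of well-orders in \<open>Main\<close>, an ordinal is given by a relation \<open>r\<close> with
  \<^prop>\<open>Well_order r\<close>, up to \<open>=o\<close>, and ordinals are compared by \<open>\<le>o\<close>.  The field of \<open>r\<close>
  need not be the whole type, and the two sides of \<open>\<le>o\<close> and \<open>=o\<close> may have different types.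
\<close>

subsection \<open>Well partial orderings and their length\<close>

definition antichain_in :: "'a rel \<Rightarrow> 'a set \<Rightarrow> bool" where
  "antichain_in r A \<longleftrightarrow> (\<forall>x\<in>A. \<forall>y\<in>A. x \<noteq> y \<longrightarrow> (x, y) \<notin> r)"

definition wpo_on :: "'a set \<Rightarrow> 'a rel \<Rightarrow> bool" where
  "wpo_on X r \<longleftrightarrow> partial_order_on X r \<and> wf (r - Id) \<and>
     (\<forall>A. A \<subseteq> X \<and> antichain_in r A \<longrightarrow> finite A)"

definition linear_extension_on :: "'a set \<Rightarrow> 'a rel \<Rightarrow> 'a rel \<Rightarrow> bool" where
  "linear_extension_on X r l \<longleftrightarrow> linear_order_on X l \<and> r \<subseteq> l"

text \<open>
  The largest order type of a linear extension, represented by some linear extension of that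
  type.  It exists for every WPO by the theorem of de Jongh and Parikh; the value is
  meaningful only if \<^term>\<open>wpo_on X r\<close>.
\<close>

definition wpo_length :: "'a set \<Rightarrow> 'a rel \<Rightarrow> 'a rel" where
  "wpo_length X r =
     (SOME l. linear_extension_on X r l \<and> (\<forall>l'. linear_extension_on X r l' \<longrightarrow> l' \<le>o l))"

subsection \<open>Ordinal product\<close>

text \<open>
  The ordinary product of \<open>k\<close> and \<open>q\<close>, i.e. \<open>q\<close> successive copies of \<open>k\<close>.  In a pair, the
  first component is the index of the copy (the more significant one).
\<close>

definition ord_mult :: "'a rel \<Rightarrow> 'b rel \<Rightarrow> ('b \<times> 'a) rel" where
  "ord_mult k q = Restr ((q - Id) <*lex*> k) (Field q \<times> Field k)"

subsection \<open>Cantor normal forms and the Hessenberg product\<close>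

definition ord_below :: "'a rel \<Rightarrow> 'a \<Rightarrow> 'a rel" where
  "ord_below r x = Restr r (underS r x)"

text \<open>
  Let \<open>U\<close> be a well-order, each element \<open>x\<close> of its field standing for the ordinal
  \<^term>\<open>ord_below U x\<close>.  A function \<open>f\<close> with finite support contained in the field of \<open>U\<close>
  stands for the Cantor normal form that is the sum of the terms \<open>\<omega>\<^sup>x \<cdot> f x\<close>, taken in
  decreasing order of \<open>x\<close>.  Comparing these at the largest exponent where they differ
  yields a well-order of type \<open>\<omega>\<^sup>U\<close>, in which the elements below \<open>f\<close> have as their order type
  exactly the ordinal with normal form \<open>f\<close>.
\<close>

definition omega_power :: "'e rel \<Rightarrow> ('e \<Rightarrow> nat) rel" where
  "omega_power U = {(f, g).
     finite {x. f x \<noteq> 0} \<and> {x. f x \<noteq> 0} \<subseteq> Field U \<and>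
     finite {x. g x \<noteq> 0} \<and> {x. g x \<noteq> 0} \<subseteq> Field U \<and>
     (f = g \<or> (\<exists>x\<in>Field U. f x < g x \<and> (\<forall>y. (x, y) \<in> U \<and> y \<noteq> x \<longrightarrow> f y = g y)))}"

definition cnf :: "'e rel \<Rightarrow> 'a rel \<Rightarrow> 'e \<Rightarrow> nat" where
  "cnf U a = (THE f. f \<in> Field (omega_power U) \<and> ord_below (omega_power U) f =o a)"

text \<open>
  The Hessenberg sum adds the coefficients of equal powers of \<open>\<omega>\<close>.  It is needed here for
  exponents only: \<^term>\<open>exponent_sum U x y\<close> is the element of \<open>U\<close> standing for the Hessenberg
  sum of \<open>x\<close> and \<open>y\<close>.
\<close>

definition exponent_sum :: "'e rel \<Rightarrow> 'e \<Rightarrow> 'e \<Rightarrow> 'e" where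
  "exponent_sum U x y = (THE z. z \<in> Field U \<and>
     cnf U (ord_below U z) = (\<lambda>e. cnf U (ord_below U x) e + cnf U (ord_below U y) e))"

text \<open>
  The Hessenberg product multiplies normal forms like polynomials, where the product of
  \<open>\<omega>\<^sup>x\<close> and \<open>\<omega>\<^sup>y\<close> is \<open>\<omega>\<close> to the Hessenberg sum of \<open>x\<close> and \<open>y\<close>.
\<close>

definition cnf_mult :: "'e rel \<Rightarrow> ('e \<Rightarrow> nat) \<Rightarrow> ('e \<Rightarrow> nat) \<Rightarrow> ('e \<Rightarrow> nat)" where
  "cnf_mult U f g = (\<lambda>z. \<Sum>(x, y) \<in> {(x, y). f x \<noteq> 0 \<and> g y \<noteq> 0 \<and> exponent_sum U x y = z}. f x * g y)"

primrec cnf_prod :: "'e rel \<Rightarrow> (nat \<Rightarrow> 'q rel) \<Rightarrow> nat \<Rightarrow> 'e \<Rightarrow> nat" where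
  "cnf_prod U q 0 = cnf U cone"
| "cnf_prod U q (Suc n) = cnf_mult U (cnf_prod U q n) (cnf U (q (Suc n)))"

text \<open>
  The Hessenberg product of \<open>q 1, \<dots>, q n\<close>.  The exponents range over the successor cardinal
  \<open>U\<close> of the cardinality of the type \<open>'q\<close>.  Every well-order on a subset of \<open>'q\<close> is below \<open>U\<close>,
  hence has a normal form over \<open>U\<close>.  If \<open>'q\<close> is infinite, then \<open>U\<close> is closed under
  Hessenberg sums; if it is finite, only the exponent 0 occurs.
\<close>

definition hessenberg_prod :: "(nat \<Rightarrow> 'q rel) \<Rightarrow> nat \<Rightarrow> ('q set \<Rightarrow> nat) rel" where
  "hessenberg_prod q n =
     (let U = cardSuc |UNIV :: 'q set| in ord_below (omega_power U) (cnf_prod U q n))"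

end

theory Submission
  imports Defs "HOL-Library.Multiset_Order" "HOL-Library.Ramsey" "HOL-Library.FuncSet"
begin

text \<open>
  Write \<open>p \<oplus> q\<close> for the Hessenberg sum, that is, the union of the multisets of exponents of
  the Cantor normal forms. The length of a union of two parts of a WPO is at most the Hessenberg
  sum of their lengths, and the maximal order type of a WPO is the least ordinal exceeding the
  lengths of all residuals \<open>{y. \<not> x \<le> y}\<close>. A WPO of length at most \<open>\<kappa> \<cdot> (p \<oplus> \<omega>\<^sup>b)\<close> splits into
  parts of lengths at most \<open>\<kappa> \<cdot> p\<close> and \<open>\<kappa> \<cdot> \<omega>\<^sup>b\<close>, so distributivity of the Hessenberg product
  reduces the upper bound to the case where the \<open>i\<close>-th length is at most \<open>\<kappa> \<cdot> \<omega>\<^bsup>b(i)\<^esup>\<close>. There a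
  residual of the intersection is covered by the residuals of the \<open>n\<close> orderings, which have
  smaller lengths, and one argues by induction on the exponents.

  The bound is attained on \<open>\<kappa> \<times> (q\<^sub>1 \<times> \<dots> \<times> q\<^sub>n)\<close>, the \<open>i\<close>-th ordering comparing the coordinate in
  \<open>q\<^sub>i\<close> first, then the coordinate in \<open>\<kappa>\<close>: the product ordering of the \<open>q\<^sub>i\<close> has a linear extension
  of type \<open>q\<^sub>1 \<otimes> \<dots> \<otimes> q\<^sub>n\<close>, and replacing each of its points by a copy of \<open>\<kappa>\<close> extends the intersection.
\<close>


section \<open>Order types\<close>

text \<open>Ordinals are handled as multisets \<open>M\<close> of exponents in the multiset order,
  \<open>below M\<close> being the corresponding relation; Hessenberg sums are then \<open>+\<close>
  and can be cancelled. That residuals get strictly shorter rests on lengths being attained, which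
  is why the theorem of de Jongh and Parikh is developed in full; its difficult case is the one
  where the residual lengths have a limit ordinal as their strict supremum. In the induction on
  exponents, the length of a residual may have terms below \<kappa>. They are rounded up to
  \<kappa>, which keeps all exponents below b(i) as long as b(i) is not 0. For b(i) = 0 this fails,
  and here it matters that \<kappa> is a cardinal: a linear extension of the intersection need not
  extend the i-th ordering, but a residual of length below \<kappa> has fewer than \<kappa>
  elements, so every well-order on it is shorter than \<kappa>. An infinite cardinal is a power of
  \<omega>, so multiplication by \<kappa> only shifts exponents.\<close>

lemma ordLeq_strict_mono:
  assumes r: "Well_order r" and s: "Well_order s"
    and f: "\<And>x y. (x, y) \<in> r \<Longrightarrow> x \<noteq> y \<Longrightarrow> (f x, f y) \<in> s \<and> f x \<noteq> f y"
    and fF: "\<And>x. x \<in> Field r \<Longrightarrow> f x \<in> Field s"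
  shows "r \<le>o s"
proof (rule ccontr)
  assume "\<not> r \<le>o s"
  then have "s <o r" using r s not_ordLeq_iff_ordLess by blast
  then obtain a where a: "a \<in> Field r" and iso: "s =o Restr r (underS r a)"
    using ordLess_iff_ordIso_Restr[OF r s] by blast
  then obtain g where g: "iso s (Restr r (underS r a)) g" unfolding ordIso_def by blast
  interpret r: wo_rel r using r by (simp add: wo_rel_def)
  have Fr: "Field (Restr r (underS r a)) = underS r a"
    by (simp add: r.underS_ofilter Field_Restr_ofilter r)
  have gF: "g ` Field s = underS r a"
    using g Fr unfolding iso_def bij_betw_def by auto
  have ginj: "inj_on g (Field s)" using g unfolding iso_def bij_betw_def by auto
  have gs: "compat s (Restr r (underS r a)) g"
    using g embed_compat unfolding iso_def by blast
  define h where "h = g \<circ> f"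
  have h1: "(h x, h y) \<in> r \<and> h x \<noteq> h y" if "(x, y) \<in> r" "x \<noteq> y" for x y
  proof -
    have "f x \<in> Field s" "f y \<in> Field s" using f[OF that] by (auto simp: Field_def)
    moreover have "(g (f x), g (f y)) \<in> r" using f[OF that] gs unfolding compat_def by blast
    moreover have "g (f x) \<noteq> g (f y)" using calculation f[OF that] ginj by (metis inj_onD)
    ultimately show ?thesis unfolding h_def by simp
  qed
  have h2: "h x \<in> underS r a" if "x \<in> Field r" for x
    using that fF gF unfolding h_def by auto
  have wf: "wf (r - Id)" using r by (simp add: well_order_on_def)
  \<comment> \<open>A strictly increasing self-map of a well-order never moves an element down; at
    \<open>a\<close> this contradicts \<open>h a\<close> lying strictly below
    \<open>a\<close>.\<close>
  have "x \<in> Field r \<longrightarrow> (x, h x) \<in> r" for x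
  proof (induction x rule: wf_induct_rule[OF wf])
    case (1 x)
    note IH = this
    show "x \<in> Field r \<longrightarrow> (x, h x) \<in> r"
    proof
      assume x: "x \<in> Field r"
      have hx: "h x \<in> Field r" using h2[OF x] by (auto simp: underS_def Field_def)
      show "(x, h x) \<in> r"
      proof (rule ccontr)
        assume n: "(x, h x) \<notin> r"
        then have 1: "(h x, x) \<in> r" "h x \<noteq> x"
          using r.TOTALS x hx r.REFL by (auto simp: refl_on_def)
        then have "(h (h x), h x) \<in> r \<and> h (h x) \<noteq> h x" using h1 by blast
        moreover have "(h x, h (h x)) \<in> r" using IH 1 hx by blast
        ultimately show False using r.ANTISYM by (auto simp: antisym_def)
      qed
    qed
  qed
  with a have "(a, h a) \<in> r" by blast
  moreover have "(h a, a) \<in> r" "h a \<noteq> a" using h2[OF a] by (auto simp: underS_def)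
  ultimately show False using r.ANTISYM by (auto simp: antisym_def)
qed

lemma ordLeq_iff_strict_mono:
  assumes r: "Well_order r" and s: "Well_order s"
  shows "r \<le>o s \<longleftrightarrow> (\<exists>f. (\<forall>x\<in>Field r. f x \<in> Field s) \<and>
           (\<forall>x y. (x, y) \<in> r \<and> x \<noteq> y \<longrightarrow> (f x, f y) \<in> s \<and> f x \<noteq> f y))"
    (is "?L \<longleftrightarrow> ?R")
proof
  assume ?L
  then obtain f where f: "embed r s f" unfolding ordLeq_def by blast
  interpret r: wo_rel r using r by (simp add: wo_rel_def)
  have "inj_on f (Field r)" using embed_inj_on[OF r f] .
  moreover have "compat r s f" using embed_compat[OF f] .
  moreover have "f ` Field r \<subseteq> Field s" using embed_Field[OF f] .
  moreover have "x \<in> Field r \<and> y \<in> Field r" if "(x, y) \<in> r" for x y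
    using that by (auto simp: Field_def)
  ultimately show ?R unfolding compat_def inj_on_def
    by (intro exI[of _ f]) blast
next
  assume ?R then show ?L using ordLeq_strict_mono[OF r s] by blast
qed

text \<open>Turns an element of a well-ordered type into the ordinal it stands for. For a multiset
  of exponents this is the ordinal whose Cantor normal form has exactly these exponents, since the
  multiset order compares at the largest exponent of different multiplicity.\<close>

definition below :: "'o::wellorder \<Rightarrow> 'o rel" where
  "below p = {(x, y). x \<le> y \<and> y < p}"

lemma below_iff: "(x, y) \<in> below p \<longleftrightarrow> x \<le> y \<and> y < p"
  by (simp add: below_def)

lemma Field_below [simp]: "Field (below p) = {..<p}"
proof -
  have "q \<in> Field (below p)" if "q < p" for q
    using that FieldI1[of q q] by (simp add: below_def)
  moreover have "q < p" if "q \<in> Field (below p)" for q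
    using that by (auto simp: Field_def below_def)
  ultimately show ?thesis by blast
qed

lemma Well_order_below [simp]: "Well_order (below (p :: 'o::wellorder))"
proof -
  have "wf (below p - Id)"
    by (rule wf_subset[OF wf]) (auto simp: below_def)
  moreover have "Linear_order (below p)"
    unfolding order_on_defs Field_below
    by (auto simp: refl_on_def trans_def antisym_def total_on_def below_def)
  ultimately show ?thesis by (simp add: well_order_on_def)
qed

lemma ordLeq_below_iff:
  fixes p :: "'o::wellorder"
  assumes "Well_order l"
  shows "l \<le>o below p \<longleftrightarrow>
    (\<exists>f. (\<forall>x\<in>Field l. f x < p) \<and> (\<forall>x y. (x, y) \<in> l \<and> x \<noteq> y \<longrightarrow> f x < f y))" (is "_ \<longleftrightarrow> (\<exists>f. ?P f)")
proof -
  have "?P f \<longleftrightarrow> (\<forall>x\<in>Field l. f x \<in> Field (below p)) \<and>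
      (\<forall>x y. (x, y) \<in> l \<and> x \<noteq> y \<longrightarrow> (f x, f y) \<in> below p \<and> f x \<noteq> f y)" for f
    unfolding below_iff Field_below lessThan_iff by (metis FieldI2 less_le)
  then show ?thesis unfolding ordLeq_iff_strict_mono[OF assms Well_order_below] by simp
qed

lemma below_ordLeq_iff:
  fixes p :: "'o::wellorder"
  assumes "Well_order l"
  shows "below p \<le>o l \<longleftrightarrow>
    (\<exists>f. (\<forall>x<p. f x \<in> Field l) \<and> (\<forall>x y. x < y \<and> y < p \<longrightarrow> (f x, f y) \<in> l \<and> f x \<noteq> f y))"
proof -
  have "(x, y) \<in> below p \<and> x \<noteq> y \<longleftrightarrow> x < y \<and> y < p" for x y by (auto simp: below_iff)
  then show ?thesis unfolding ordLeq_iff_strict_mono[OF Well_order_below assms] by (simp add: Ball_def)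
qed

lemma below_mono: "p \<le> q \<Longrightarrow> below p \<le>o below (q :: 'o::wellorder)"
  unfolding below_ordLeq_iff[OF Well_order_below]
  by (rule exI[of _ id]) (auto simp: below_iff intro: less_imp_le less_le_trans)

lemma below_strict_mono:
  assumes "p < q" shows "below p <o below (q :: 'o::wellorder)"
proof -
  have "below p = Restr (below q) (underS (below q) p)"
    using assms by (auto simp: below_def underS_def)
  then have "below p =o Restr (below q) (underS (below q) p)"
    by (metis Well_order_below ordIso_reflexive)
  then show ?thesis
    using ordLess_iff_ordIso_Restr[OF Well_order_below Well_order_below, of p q] assms
    by (metis Field_below lessThan_iff)
qed

lemma below_le_iff [simp]: "below p \<le>o below q \<longleftrightarrow> p \<le> (q :: 'o::wellorder)"
  using below_mono[of p q] below_strict_mono[of q p] not_ordLess_ordLeq[of "below q" "below p"]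
  by (meson not_le)

lemma below_less_iff [simp]: "below p <o below q \<longleftrightarrow> p < (q :: 'o::wellorder)"
  using below_mono[of q p] below_strict_mono[of p q] not_ordLess_ordLeq[of "below p" "below q"]
  by (meson not_le)

lemma below_eq_iff [simp]: "below p =o below q \<longleftrightarrow> p = (q :: 'o::wellorder)"
  by (simp add: ordIso_iff_ordLeq order_class.order_eq_iff)

lemma wellorder_neq_below:
  fixes p :: "'o::wellorder"
  assumes r: "Well_order r" and "\<not> below p \<le>o r"
  shows "\<exists>p'<p. r =o below p'"
proof -
  have "r <o below p" using assms not_ordLeq_iff_ordLess by (metis Well_order_below)
  then obtain a where "a \<in> Field (below p)" "r =o Restr (below p) (underS (below p) a)"
    using ordLess_iff_ordIso_Restr[OF _ r] Well_order_below by blast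
  moreover have "Restr (below p) (underS (below p) a) = below a" if "a < p"
    using that by (auto simp: below_def underS_def)
  ultimately show ?thesis by auto
qed

lemma Well_order_Field_Restr: "Well_order l \<Longrightarrow> Field (Restr l A) = Field l \<inter> A"
  unfolding order_on_defs by (intro Refl_Field_Restr) simp

lemma Restr_ordLeq: "Well_order l \<Longrightarrow> Restr l A \<le>o l"
  by (rule ordLeq_strict_mono[OF Well_order_Restr _, where f = id])
    (simp_all add: Well_order_Field_Restr)

lemma Restr_mono_ordLeq:
  assumes "Well_order l" "A \<subseteq> B" shows "Restr l A \<le>o Restr l B"
proof -
  have "Restr l A = Restr (Restr l B) A" using assms(2) by blast
  then show ?thesis using Restr_ordLeq[OF Well_order_Restr[OF assms(1)], of B A] by simp
qed

lemma Restr_underS_ordLess: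
  assumes "Well_order l" "x \<in> Field l" shows "Restr l (underS l x) <o l"
  unfolding ordLess_iff_ordIso_Restr[OF assms(1) Well_order_Restr[OF assms(1)]]
  using assms(2) ordIso_reflexive[OF Well_order_Restr[OF assms(1)]] by (intro bexI)

text \<open>A well-order longer than \<open>below p\<close> has a proper initial segment of type
  exactly \<open>p\<close>. This is how bounds on residuals become bounds on lengths.\<close>

lemma ordLeq_below_by_segments:
  fixes p :: "'o::wellorder"
  assumes l: "Well_order l"
    and seg: "\<And>x. x \<in> Field l \<Longrightarrow> \<exists>p'<p. Restr l (underS l x) \<le>o below p'"
  shows "l \<le>o below p"
proof (rule ccontr)
  assume "\<not> l \<le>o below p"
  then have "below p <o l" using l not_ordLeq_iff_ordLess by (metis Well_order_below)
  then obtain x where x: "x \<in> Field l" "below p =o Restr l (underS l x)"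
    using ordLess_iff_ordIso_Restr[OF l Well_order_below] by blast
  then obtain p' where "p' < p" "Restr l (underS l x) \<le>o below p'" using seg by blast
  then have "below p \<le>o below p'" using x ordIso_ordLeq_trans by blast
  then show False using \<open>p' < p\<close> by simp
qed

text \<open>Every element is sent to the sum of the types of what precedes it in either part.\<close>

lemma ordLeq_below_Un:
  fixes M N :: "'e::wellorder multiset"
  assumes l: "Well_order l" and F: "Field l \<subseteq> A \<union> B"
    and A: "Restr l A \<le>o below M" and B: "Restr l B \<le>o below N"
  shows "l \<le>o below (M + N)"
proof -
  interpret l: wo_rel l using l by (simp add: wo_rel_def)
  \<comment> \<open>Such a map is only weakly increasing, but strictly so when it leaves an element
    of \<open>A\<close>. Every element lies in \<open>A\<close> or \<open>B\<close>, so the sum of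
    the two maps is strictly increasing.\<close>
  have "\<exists>g :: 'a \<Rightarrow> 'e multiset. (\<forall>x\<in>Field l. g x \<le> M \<and> (x \<in> A \<longrightarrow> g x < M)) \<and>
     (\<forall>x y. (x, y) \<in> l \<and> x \<noteq> y \<longrightarrow> g x \<le> g y \<and> (x \<in> A \<longrightarrow> g x < g y))"
    if AM: "Restr l A \<le>o below M" for A and M :: "'e multiset"
  proof -
    obtain f where "\<forall>x\<in>Field (Restr l A). f x < M" "\<forall>x y. (x, y) \<in> Restr l A \<and> x \<noteq> y \<longrightarrow> f x < f y"
      using AM unfolding ordLeq_below_iff[OF Well_order_Restr[OF l]] by blast
    note f' = this[unfolded Well_order_Field_Restr[OF l]]
    have f: "f x < M" if "x \<in> Field l" "x \<in> A" for x using f'(1) that by blast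
    have f2: "f x < f y" if "(x, y) \<in> l" "x \<in> A" "y \<in> A" "x \<noteq> y" for x y using f'(2) that by blast
    define P where "P x p \<longleftrightarrow> (\<forall>z\<in>A. (z, x) \<in> l \<and> z \<noteq> x \<longrightarrow> f z < p)" for x p
    define g where "g x = (LEAST p. P x p)" for x
    have PM: "P x M" for x unfolding P_def using f by (auto simp: Field_def)
    have Pg: "P x (g x)" for x unfolding g_def using PM LeastI by metis
    have gl: "P x p \<Longrightarrow> g x \<le> p" for x p unfolding g_def by (rule Least_le)
    have Pf: "P x (f x)" if "x \<in> A" for x unfolding P_def using f2 that by auto
    have tr: "(z, y) \<in> l \<and> z \<noteq> y" if "(z, x) \<in> l" "z \<noteq> x" "(x, y) \<in> l" "x \<noteq> y" for x y z
      using that l.TRANS l.ANTISYM unfolding trans_def antisym_def by blast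
    have mono: "g x \<le> g y" if xy: "(x, y) \<in> l" "x \<noteq> y" for x y
    proof (rule gl, unfold P_def, intro ballI impI)
      fix z assume z: "z \<in> A" "(z, x) \<in> l \<and> z \<noteq> x"
      then have "(z, y) \<in> l \<and> z \<noteq> y" using tr xy by blast
      then show "f z < g y" using Pg[of y] z unfolding P_def by blast
    qed
    have strict: "g x < g y" if xy: "(x, y) \<in> l" "x \<noteq> y" "x \<in> A" for x y
      using Pg[of y] xy gl[OF Pf[OF xy(3)]] unfolding P_def by (meson le_less_trans)
    show ?thesis
    proof (intro exI[of _ g] conjI ballI allI impI)
      show "g x \<le> M" for x using gl[OF PM] .
      show "g x < M" if "x \<in> Field l" "x \<in> A" for x using gl[OF Pf] f that by (meson le_less_trans)
    qed (use mono strict in blast)+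
  qed
  note key = this
  obtain g where g: "\<forall>x\<in>Field l. g x \<le> M \<and> (x \<in> A \<longrightarrow> g x < M)"
     "\<forall>x y. (x, y) \<in> l \<and> x \<noteq> y \<longrightarrow> g x \<le> g y \<and> (x \<in> A \<longrightarrow> g x < g y)" using key[OF A] by blast
  obtain h where h: "\<forall>x\<in>Field l. h x \<le> N \<and> (x \<in> B \<longrightarrow> h x < N)"
     "\<forall>x y. (x, y) \<in> l \<and> x \<noteq> y \<longrightarrow> h x \<le> h y \<and> (x \<in> B \<longrightarrow> h x < h y)" using key[OF B] by blast
  have lt: "g x + h x < g y + h y" if "(x, y) \<in> l" "x \<noteq> y" for x y
    using that g h F by (metis FieldI1 UnE add_le_less_mono add_less_le_mono subsetD)
  have in_F: "g x + h x < M + N" if "x \<in> Field l" for x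
    using that g h F by (metis UnE add_le_less_mono add_less_le_mono subsetD)
  show ?thesis
    unfolding ordLeq_below_iff[OF l] by (rule exI[of _ "\<lambda>x. g x + h x"]) (use lt in_F in blast)
qed

section \<open>Ordinals as multisets of exponents\<close>

text \<open>When no exponent of \<open>N\<close> exceeds one of \<open>M\<close>, the Hessenberg sum
  \<open>M + N\<close> is the ordinary sum, \<open>M\<close> followed by \<open>N\<close> without
  absorption, so an ordinal in the gap is \<open>M\<close> plus a remainder below
  \<open>N\<close>.\<close>

lemma mset_split_interval:
  fixes M N P :: "'e::linorder multiset"
  assumes MP: "M \<le> P" and PN: "P < M + N" and d: "\<And>d e. d \<in># N \<Longrightarrow> e \<in># M \<Longrightarrow> d \<le> e"
  shows "\<exists>P'. P = M + P' \<and> P' < N"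
proof -
  have "count M e \<le> count P e" for e
  proof (rule ccontr)
    assume c: "\<not> count M e \<le> count P e"
    then have eM: "e \<in># M" by (metis not_in_iff zero_le)
    \<comment> \<open>Take the largest exponent above \<open>e\<close> at which \<open>P\<close>
      exceeds \<open>M\<close>. Above \<open>e\<close> there is nothing in \<open>N\<close>, so
      \<open>P < M + N\<close> yields a still larger exponent where \<open>P\<close> falls short of
      \<open>M\<close>, and then \<open>M \<le> P\<close> a larger one where it exceeds
      \<open>M\<close> again.\<close>
    define S where "S = {x. e < x \<and> count M x < count P x}"
    have "S \<subseteq> set_mset P" unfolding S_def
      by (auto simp flip: count_greater_zero_iff)
    then have fin: "finite S" using finite_subset by blast
    have "S \<noteq> {}" using MP c unfolding less_eq_multiset\<^sub>H\<^sub>O S_def by force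
    define x where "x = Max S"
    have x: "x \<in> S" "\<And>y. y \<in> S \<Longrightarrow> y \<le> x" unfolding x_def using fin \<open>S \<noteq> {}\<close> by auto
    have ex: "e < x" using x S_def by simp
    have N0: "count N y = 0" if "e < y" for y using d[OF _ eM] that
      by (meson leD not_in_iff)
    have "count (M + N) x < count P x" using x(1) N0[OF ex] unfolding S_def by simp
    then obtain y where y: "x < y" "count P y < count (M + N) y"
      using PN unfolding less_multiset\<^sub>H\<^sub>O by blast
    then have "count P y < count M y" using N0[of y] ex by simp
    then obtain z where "y < z" "count M z < count P z" using MP unfolding less_eq_multiset\<^sub>H\<^sub>O by blast
    then have "z \<in> S" "x < z" using y ex unfolding S_def by auto
    then show False using x(2) by force
  qed
  then have "M \<subseteq># P" by (simp add: mset_subset_eqI)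
  then obtain P' where "P = M + P'" by (metis subset_mset.add_diff_inverse)
  with PN show ?thesis by (intro exI[of _ P']) simp
qed

text \<open>The exponent 0, so that \<open>{#bot_exp#}\<close> is the ordinal 1 and adding it is
  taking the successor.\<close>

definition bot_exp :: "'e::wellorder" where
  "bot_exp = (LEAST e. True)"

lemma bot_exp_le: "bot_exp \<le> e"
  unfolding bot_exp_def by (simp add: Least_le)

lemma less_single_bot_iff: "P < {#bot_exp#} \<longleftrightarrow> P = {#}"
proof
  assume P: "P < {#bot_exp#}"
  then show "P = {#}" using bot_exp_le by (metis mset_lt_single_right_iff multiset_nonemptyE not_less)
qed simp

lemma mset_Suc_le:
  fixes M N :: "'e::wellorder multiset"
  assumes "M < N" shows "M + {#bot_exp#} \<le> N"
proof (rule ccontr)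
  assume "\<not> M + {#bot_exp#} \<le> N"
  then have lt: "N < M + {#bot_exp#}" by simp
  have "M \<le> N" using assms by simp
  from mset_split_interval[OF this lt] obtain P' where P: "N = M + P'" and "P' < {#bot_exp#}"
    using bot_exp_le by auto
  then have "P' = {#}" by (simp only: less_single_bot_iff)
  then show False using P assms by simp
qed

text \<open>Detaches the last term \<omega>^b of a normal form. Lengths are split from this end,
  where the Hessenberg sum is an ordinary one.\<close>

lemma mset_split_min:
  fixes M :: "'e::linorder multiset"
  assumes "M \<noteq> {#}"
  obtains M' b where "M = add_mset b M'" "\<And>e. e \<in># M' \<Longrightarrow> b \<le> e"
proof -
  have "Min (set_mset M) \<in># M" using assms by (intro Min_in) auto
  then have "M = add_mset (Min (set_mset M)) (M - {#Min (set_mset M)#})" by simp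
  moreover have "Min (set_mset M) \<le> e" if "e \<in># M - {#Min (set_mset M)#}" for e
    using in_diffD[OF that] by simp
  ultimately show ?thesis using that by blast
qed

text \<open>Powers of \<omega> are closed under Hessenberg sums: \<open>P < {#s#}\<close> says just
  that all exponents of \<open>P\<close> are below \<open>s\<close>.\<close>

lemma sum_mset_less_single:
  fixes f :: "'i \<Rightarrow> 'e::linorder multiset"
  assumes "\<And>i. i \<in># I \<Longrightarrow> f i < {#s#}"
  shows "(\<Sum>i\<in>#I. f i) < {#s#}"
  using assms by (induction I) auto

section \<open>Linear extensions\<close>

lemma szpilrajn:
  assumes p: "partial_order_on Y p"
  obtains l where "linear_order_on Y l" "p \<subseteq> l"
proof -
  define A where "A = {q. partial_order_on Y q \<and> p \<subseteq> q}"
  have "\<exists>m\<in>A. \<forall>q\<in>A. m \<subseteq> q \<longrightarrow> q = m"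
  proof (rule subset_Zorn_nonempty)
    show "A \<noteq> {}" using p unfolding A_def by blast
    fix C assume C: "C \<noteq> {}" "subset.chain A C"
    have C1: "\<And>q. q \<in> C \<Longrightarrow> q \<subseteq> Y \<times> Y \<and> refl_on Y q \<and> trans q \<and> antisym q \<and> p \<subseteq> q"
      using C(2) unfolding subset.chain_def A_def order_on_defs by blast
    have C2: "\<And>q q'. q \<in> C \<Longrightarrow> q' \<in> C \<Longrightarrow> q \<subseteq> q' \<or> q' \<subseteq> q"
      using C(2) unfolding subset.chain_def by blast
    have common: "\<exists>q\<in>C. u \<in> q \<and> v \<in> q" if "u \<in> \<Union>C" "v \<in> \<Union>C" for u v
      using that C2 by (meson UnionE subsetD)
    have "trans (\<Union>C)"
    proof (rule transI)
      fix x y z assume "(x, y) \<in> \<Union>C" "(y, z) \<in> \<Union>C"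
      then obtain q where "q \<in> C" "(x, y) \<in> q" "(y, z) \<in> q" using common by blast
      then show "(x, z) \<in> \<Union>C" using C1 by (meson UnionI transD)
    qed
    moreover have "antisym (\<Union>C)"
    proof (rule antisymI)
      fix x y assume "(x, y) \<in> \<Union>C" "(y, x) \<in> \<Union>C"
      then obtain q where "q \<in> C" "(x, y) \<in> q" "(y, x) \<in> q" using common by blast
      then show "x = y" using C1 by (meson antisymD)
    qed
    moreover have "\<Union>C \<subseteq> Y \<times> Y" using C1 by blast
    moreover have "refl_on Y (\<Union>C)" using C C1 unfolding refl_on_def by blast
    moreover have "p \<subseteq> \<Union>C" using C C1 by blast
    ultimately show "\<Union>C \<in> A" unfolding A_def order_on_defs by blast
  qed
  then obtain m where mA: "m \<in> A" "\<forall>q\<in>A. m \<subseteq> q \<longrightarrow> q = m" by blast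
  have m: "partial_order_on Y m" "p \<subseteq> m" using mA(1) unfolding A_def by simp_all
  have max: "q = m" if "partial_order_on Y q" "p \<subseteq> q" "m \<subseteq> q" for q
    using mA(2) that unfolding A_def by simp
  have m1: "m \<subseteq> Y \<times> Y" "refl_on Y m" "trans m" "antisym m"
    using m(1) by (auto simp: order_on_defs)
  have "(x, y) \<in> m \<or> (y, x) \<in> m" if xy: "x \<in> Y" "y \<in> Y" for x y
  proof (rule ccontr)
    assume n: "\<not> ?thesis"
    \<comment> \<open>The least transitive extension of \<open>m\<close> by the pair
      \<open>(x, y)\<close>; it stays antisymmetric because \<open>(y, x)\<close> is not in
      \<open>m\<close>.\<close>
    define q where "q = m \<union> {(a, b). (a, x) \<in> m \<and> (y, b) \<in> m}"
    have "trans q"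
    proof (rule transI)
      fix a b c assume "(a, b) \<in> q" "(b, c) \<in> q"
      then show "(a, c) \<in> q" using transD[OF m1(3)] n unfolding q_def by blast
    qed
    moreover have "antisym q"
    proof (rule antisymI)
      fix a b assume "(a, b) \<in> q" "(b, a) \<in> q"
      then show "a = b" using transD[OF m1(3)] antisymD[OF m1(4)] n unfolding q_def by blast
    qed
    moreover have "refl_on Y q" using m1(2) unfolding q_def refl_on_def by blast
    moreover have "q \<subseteq> Y \<times> Y" using m1(1) unfolding q_def by blast
    ultimately have "q = m" using m(2) by (intro max) (auto simp: order_on_defs q_def)
    moreover have "(x, y) \<in> q" using m1(2) xy unfolding q_def refl_on_def by blast
    ultimately show False using n by blast
  qed
  then have "linear_order_on Y m" using m(1) by (auto simp: linear_order_on_def total_on_def)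
  then show ?thesis using that m(2) by blast
qed

abbreviation lin_ext :: "'a rel \<Rightarrow> 'a set \<Rightarrow> 'a rel \<Rightarrow> bool" where
  "lin_ext r Y l \<equiv> linear_extension_on Y (Restr r Y) l"

lemma lin_ext_iff:
  "lin_ext r Y l \<longleftrightarrow> linear_order_on Y l \<and> (\<forall>x\<in>Y. \<forall>y\<in>Y. (x, y) \<in> r \<longrightarrow> (x, y) \<in> l)"
  unfolding linear_extension_on_def by blast

lemma partial_order_on_Restr:
  "partial_order_on X r \<Longrightarrow> Y \<subseteq> X \<Longrightarrow> partial_order_on Y (Restr r Y)"
  unfolding order_on_defs refl_on_def by (auto intro: trans_Restr antisym_Restr)

lemma linear_order_on_Restr':
  "linear_order_on X l \<Longrightarrow> Y \<subseteq> X \<Longrightarrow> linear_order_on Y (Restr l Y)"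
  using partial_order_on_Restr[of X l Y] unfolding linear_order_on_def total_on_def by blast

lemma linear_order_on_subset_eq:
  assumes l: "linear_order_on X l" and m: "linear_order_on X m" and lm: "l \<subseteq> m"
  shows "l = m"
proof -
  have l1: "refl_on X l" "total_on X l" and m1: "m \<subseteq> X \<times> X" "antisym m"
    using l m unfolding order_on_defs by blast+
  have "(x, y) \<in> l" if xy: "(x, y) \<in> m" for x y
  proof (cases "x = y")
    case True
    then show ?thesis using xy l1(1) m1(1) by (auto simp: refl_on_def)
  next
    case False
    have "x \<in> X" "y \<in> X" using xy m1(1) by blast+
    then have "(x, y) \<in> l \<or> (y, x) \<in> l" using l1(2) False unfolding total_on_def by blast
    then show ?thesis using antisymD[OF m1(2) xy] False lm by blast
  qed
  then show ?thesis using lm by auto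
qed

lemma lin_ext_subset:
  "lin_ext r Y l \<Longrightarrow> Z \<subseteq> Y \<Longrightarrow> lin_ext r Z (Restr l Z)"
  unfolding lin_ext_iff using linear_order_on_Restr' by blast

lemma lin_ext_exists:
  assumes "partial_order_on X r" "Y \<subseteq> X"
  obtains l where "lin_ext r Y l"
  using szpilrajn[OF partial_order_on_Restr[OF assms]] unfolding linear_extension_on_def by blast

text \<open>Common pattern of the constructions of linear extensions: an element gets a position
  \<open>T x\<close> in a chain of sets, and the relation \<open>K (T x)\<close> that orders the
  elements at one position may vary with the position.\<close>

definition rel_lex :: "'a set \<Rightarrow> ('a \<Rightarrow> 'b set) \<Rightarrow> ('b set \<Rightarrow> 'a rel) \<Rightarrow> 'a rel" where
  "rel_lex Q T K = {(x, y) \<in> Q \<times> Q. T x \<subset> T y \<or> T x = T y \<and> (x, y) \<in> K (T x)}"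

lemma lin_ext_lex:
  assumes comp: "\<And>x y. x \<in> Q \<Longrightarrow> y \<in> Q \<Longrightarrow> T x \<subseteq> T y \<or> T y \<subseteq> T x"
    and mono: "\<And>x y. x \<in> Q \<Longrightarrow> y \<in> Q \<Longrightarrow> (x, y) \<in> r \<Longrightarrow> T x \<subseteq> T y"
    and K: "\<And>x. x \<in> Q \<Longrightarrow> lin_ext r (F (T x)) (K (T x))" and F: "\<And>x. x \<in> Q \<Longrightarrow> x \<in> F (T x)"
  shows "lin_ext r Q (rel_lex Q T K)"
proof -
  let ?m = "rel_lex Q T K"
  have K': "trans (K (T x))" "antisym (K (T x))" "total_on (F (T x)) (K (T x))" "refl_on (F (T x)) (K (T x))"
    "\<And>u v. u \<in> F (T x) \<Longrightarrow> v \<in> F (T x) \<Longrightarrow> (u, v) \<in> r \<Longrightarrow> (u, v) \<in> K (T x)" if "x \<in> Q" for x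
    using K[OF that] unfolding lin_ext_iff order_on_defs by blast+
  have m: "(x, y) \<in> ?m \<longleftrightarrow> x \<in> Q \<and> y \<in> Q \<and> (T x \<subset> T y \<or> T x = T y \<and> (x, y) \<in> K (T x))" for x y
    unfolding rel_lex_def by blast
  have "?m \<subseteq> Q \<times> Q" unfolding rel_lex_def by blast
  moreover have "refl_on Q ?m" unfolding refl_on_def m using F K'(4) by (auto simp: refl_on_def)
  moreover have "trans ?m"
  proof (rule transI)
    fix x y z assume xyz: "(x, y) \<in> ?m" "(y, z) \<in> ?m"
    show "(x, z) \<in> ?m"
    proof (cases "T x = T y \<and> T y = T z")
      case True
      then show ?thesis using xyz transD[OF K'(1)[of x], of x y z] unfolding m by auto
    next
      case False
      then show ?thesis using xyz unfolding m by blast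
    qed
  qed
  moreover have "antisym ?m"
  proof (rule antisymI)
    fix x y assume xy: "(x, y) \<in> ?m" "(y, x) \<in> ?m"
    then have "x \<in> Q" "T x = T y" unfolding m by blast+
    then have "(x, y) \<in> K (T x)" "(y, x) \<in> K (T x)" using xy unfolding m by simp_all
    then show "x = y" using antisymD[OF K'(2)[OF \<open>x \<in> Q\<close>]] by blast
  qed
  moreover have mono': "(x, y) \<in> ?m"
    if xy: "x \<in> Q" "y \<in> Q" "T x \<subseteq> T y" "T x = T y \<Longrightarrow> (x, y) \<in> K (T x)" for x y
    using xy unfolding m by blast
  have "total_on Q ?m" unfolding total_on_def
  proof (intro ballI impI)
    fix x y assume xy: "x \<in> Q" "y \<in> Q" "x \<noteq> y"
    show "(x, y) \<in> ?m \<or> (y, x) \<in> ?m"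
    proof (cases "T x = T y")
      case True
      then have "(x, y) \<in> K (T x) \<or> (y, x) \<in> K (T x)"
        using K'(3)[OF xy(1)] F[OF xy(1)] F[OF xy(2)] xy(3) unfolding total_on_def by metis
      then show ?thesis using True xy unfolding m by auto
    next
      case False
      then show ?thesis using comp[OF xy(1,2)] xy unfolding m by blast
    qed
  qed
  ultimately have "linear_order_on Q ?m" unfolding order_on_defs by blast
  moreover have "(x, y) \<in> ?m" if "x \<in> Q" "y \<in> Q" "(x, y) \<in> r" for x y
  proof (rule mono'[OF that(1,2) mono[OF that]])
    assume "T x = T y"
    then show "(x, y) \<in> K (T x)" using K'(5)[OF that(1)] F[OF that(1)] F[OF that(2)] that(3) by simp
  qed
  ultimately show ?thesis unfolding lin_ext_iff by blast
qed

text \<open>Elements of \<open>Y\<close> are compared by what they dominate in \<open>Z\<close>, then by any linear extension.\<close>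

lemma lin_ext_extend:
  assumes r: "partial_order_on X r" and YX: "Y \<subseteq> X" and ZY: "Z \<subseteq> Y" and l: "lin_ext r Z l"
  obtains l' where "lin_ext r Y l'" "Restr l' Z = l"
proof -
  have r1: "refl_on X r" "trans r" using r unfolding order_on_defs by blast+
  have l1: "l \<subseteq> Z \<times> Z" "refl_on Z l" "trans l" "antisym l" "total_on Z l" "linear_order_on Z l"
    and rl: "\<And>x y. x \<in> Z \<Longrightarrow> y \<in> Z \<Longrightarrow> (x, y) \<in> r \<Longrightarrow> (x, y) \<in> l"
    using l unfolding lin_ext_iff order_on_defs by blast+
  note tl = transD[OF l1(3)]
  obtain l0 where l0: "lin_ext r Y l0" using lin_ext_exists[OF r YX] by blast
  define T where "T y = {z. \<exists>z'. (z, z') \<in> l \<and> (z', y) \<in> r}" for y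
  let ?m = "rel_lex Y T (\<lambda>_. l0)"
  have ext: "lin_ext r Y ?m"
  proof (rule lin_ext_lex[where F = "\<lambda>_. Y"])
    fix x y
    show "T x \<subseteq> T y \<or> T y \<subseteq> T x"
    proof (rule ccontr)
      assume "\<not> ?thesis"
      then obtain u v where uv: "u \<in> T x" "u \<notin> T y" "v \<in> T y" "v \<notin> T x" by blast
      then have "u \<in> Z" "v \<in> Z" using l1(1) unfolding T_def by blast+
      then have "(u, v) \<in> l \<or> (v, u) \<in> l" using l1(2,5) unfolding total_on_def refl_on_def by metis
      then show False using uv tl unfolding T_def by blast
    qed
    show "T x \<subseteq> T y" if "(x, y) \<in> r" using transD[OF r1(2) _ that] unfolding T_def by blast
  qed (use l0 in auto)
  have TZ: "z \<in> T w \<longleftrightarrow> (z, w) \<in> l" if "w \<in> Z" for z w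
  proof
    have "(w, w) \<in> r" using that ZY YX r1(1) by (auto simp: refl_on_def)
    then show "(z, w) \<in> l \<Longrightarrow> z \<in> T w" unfolding T_def by blast
    assume "z \<in> T w"
    then obtain z' where "(z, z') \<in> l" "(z', w) \<in> r" unfolding T_def by blast
    then show "(z, w) \<in> l" using rl[of z' w] l1(1) that tl by blast
  qed
  have "l \<subseteq> Restr ?m Z"
  proof
    fix p assume p: "p \<in> l"
    obtain z w where zw: "p = (z, w)" by fastforce
    have Z: "z \<in> Z" "w \<in> Z" using p zw l1(1) by blast+
    have "T z \<subseteq> T w" using TZ[OF Z(1)] TZ[OF Z(2)] tl p zw by blast
    moreover have "z = w" if "T z = T w"
      using TZ[OF Z(1), of w] TZ[OF Z(2), of w] that l1(2) Z antisymD[OF l1(4), of z w] p zw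
      by (auto simp: refl_on_def)
    moreover have "(z, z) \<in> l0" using l0 Z ZY unfolding lin_ext_iff order_on_defs refl_on_def by blast
    ultimately show "p \<in> Restr ?m Z" using Z ZY unfolding zw rel_lex_def by blast
  qed
  moreover have "linear_order_on Z (Restr ?m Z)" using lin_ext_subset[OF ext ZY] unfolding lin_ext_iff by blast
  ultimately have "Restr ?m Z = l" using linear_order_on_subset_eq[OF l1(6)] by blast
  then show ?thesis using that ext by blast
qed

definition rel_concat :: "'a set \<Rightarrow> 'a rel \<Rightarrow> 'a set \<Rightarrow> 'a rel \<Rightarrow> 'a rel" where
  "rel_concat A l B m = l \<union> m \<union> A \<times> B"

definition down_set :: "'a rel \<Rightarrow> 'a set \<Rightarrow> 'a set \<Rightarrow> bool" where
  "down_set r Y D \<longleftrightarrow> D \<subseteq> Y \<and> (\<forall>x y. (x, y) \<in> r \<and> x \<in> Y \<and> y \<in> D \<longrightarrow> x \<in> D)"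

lemma lin_ext_concat:
  assumes D: "down_set r Y D" and l: "lin_ext r D l" and m: "lin_ext r (Y - D) m"
  shows "lin_ext r Y (rel_concat D l (Y - D) m)"
proof -
  \<comment> \<open>Two positions, the empty and the full set over \<open>unit\<close>, make the
    concatenation an instance of \<open>rel_lex\<close>.\<close>
  define T where "T x = (if x \<in> D then {} else UNIV :: unit set)" for x
  define K where "K S = (if S = {} then l else m)" for S :: "unit set"
  have T: "T x \<subset> T y \<longleftrightarrow> x \<in> D \<and> y \<notin> D" "T x = T y \<longleftrightarrow> (x \<in> D \<longleftrightarrow> y \<in> D)" "T x = {} \<longleftrightarrow> x \<in> D" for x y
    unfolding T_def by auto
  have "l \<subseteq> D \<times> D" "m \<subseteq> (Y - D) \<times> (Y - D)" "D \<subseteq> Y"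
    using l m D unfolding lin_ext_iff order_on_defs down_set_def by blast+
  then have "rel_concat D l (Y - D) m = rel_lex Y T K"
    unfolding rel_concat_def rel_lex_def K_def T by (auto split: if_splits)
  moreover have "lin_ext r Y (rel_lex Y T K)"
  proof (rule lin_ext_lex[where F = "\<lambda>S. if S = {} then D else Y - D"])
    show "T x \<subseteq> T y" if "x \<in> Y" "y \<in> Y" "(x, y) \<in> r" for x y
      using that D unfolding down_set_def T_def by auto
  qed (use l m in \<open>auto simp: K_def T_def\<close>)
  ultimately show ?thesis by simp
qed

lemma Field_linear_order_on: "linear_order_on Y l \<Longrightarrow> Field l = Y"
  unfolding order_on_defs refl_on_def Field_def by auto

lemma lin_ext_Field: "lin_ext r Y l \<Longrightarrow> Field l = Y"
  unfolding lin_ext_iff by (simp add: Field_linear_order_on)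

section \<open>Well partial orders\<close>

text \<open>Ramsey's theorem for pairs of indices, coloured by whether \<open>f\<close> goes up,
  goes down or is incomparable. A homogeneous set of the second colour is a descending chain and one
  of the third an infinite antichain, so only the first remains.\<close>

lemma wpo_mono_subsequence:
  fixes f :: "nat \<Rightarrow> 'a"
  assumes X: "wpo_on X r" and f: "range f \<subseteq> X"
  obtains g :: "nat \<Rightarrow> nat" where "strict_mono g" "\<And>i j. i < j \<Longrightarrow> (f (g i), f (g j)) \<in> r"
proof -
  have r: "refl_on X r" "wf (r - Id)" "\<And>A. A \<subseteq> X \<Longrightarrow> antichain_in r A \<Longrightarrow> finite A"
    using X by (auto simp: wpo_on_def order_on_defs)
  define c where "c S = (if (f (Min S), f (Max S)) \<in> r then 0
      else if (f (Max S), f (Min S)) \<in> r then 1 else 2 :: nat)" for S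
  have "\<exists>Y t. Y \<subseteq> UNIV \<and> infinite Y \<and> t < 3 \<and> (\<forall>x\<in>Y. \<forall>y\<in>Y. x \<noteq> y \<longrightarrow> c {x, y} = t)"
    by (rule Ramsey2) (auto simp: c_def)
  then obtain Y t where Y: "infinite Y" "t < 3" "\<And>x y. x \<in> Y \<Longrightarrow> y \<in> Y \<Longrightarrow> x \<noteq> y \<Longrightarrow> c {x, y} = t"
    by blast
  define g where "g = enumerate Y"
  have g: "strict_mono g" "range g = Y"
    using Y(1) strict_mono_enumerate range_enumerate unfolding g_def by auto
  have c: "(if (f (g i), f (g j)) \<in> r then 0 else if (f (g j), f (g i)) \<in> r then 1 else 2) = t"
    if "i < j" for i j
  proof -
    have "g i < g j" using g(1) that by (simp add: strict_mono_def)
    then have M: "Min {g i, g j} = g i" "Max {g i, g j} = g j" by auto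
    have "c {g i, g j} = t" using Y(3) g(2) \<open>g i < g j\<close> by (metis less_irrefl rangeI)
    then show ?thesis unfolding c_def M .
  qed
  have c0: "t = 0 \<longleftrightarrow> (f (g i), f (g j)) \<in> r"
    and c1: "t = 1 \<Longrightarrow> (f (g j), f (g i)) \<in> r"
    and c2: "t = 2 \<Longrightarrow> (f (g j), f (g i)) \<notin> r" if "i < j" for i j
    using c[OF that] by (cases "(f (g i), f (g j)) \<in> r"; cases "(f (g j), f (g i)) \<in> r"; simp)+
  have fX: "f i \<in> X" for i using f by auto
  have neq: "f (g i) \<noteq> f (g j)" if "i < j" "t \<noteq> 0" for i j
  proof
    assume "f (g i) = f (g j)"
    then have "(f (g i), f (g j)) \<in> r" using r(1) fX[of "g i"] by (simp add: refl_on_def)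
    then show False using c0 that by blast
  qed
  have "t = 0"
  proof (rule ccontr)
    assume t0: "t \<noteq> 0"
    then consider "t = 1" | "t = 2" using Y(2) by linarith
    then show False
    proof cases
      case 1
      have "(f (g (Suc i)), f (g i)) \<in> r - Id" for i
        using c1[OF lessI 1, of i] neq[OF lessI t0, of i] by simp
      then have "\<exists>h. \<forall>i. (h (Suc i), h i) \<in> r - Id" by (intro exI[of _ "\<lambda>i. f (g i)"] allI)
      then show False using r(2) unfolding wf_iff_no_infinite_down_chain by blast
    next
      case 2
      have inc: "(f (g i), f (g j)) \<notin> r \<and> (f (g j), f (g i)) \<notin> r" if "i < j" for i j
        using c0[OF that] t0 c2[OF that 2] by blast
      have "antichain_in r (range (f \<circ> g))"
        unfolding antichain_in_def
      proof (intro ballI impI, elim imageE, hypsubst)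
        fix i j assume "(f \<circ> g) i \<noteq> (f \<circ> g) j"
        then have "i < j \<or> j < i" by (metis nat_neq_iff)
        then show "((f \<circ> g) i, (f \<circ> g) j) \<notin> r" using inc by force
      qed
      moreover have "range (f \<circ> g) \<subseteq> X" using fX by auto
      ultimately have "finite (range (f \<circ> g))" using r(3) by blast
      moreover have "inj (f \<circ> g)" using neq[OF _ t0] by (intro linorder_injI) auto
      ultimately show False using finite_imageD by blast
    qed
  qed
  then have "(f (g i), f (g j)) \<in> r" if "i < j" for i j using c0[OF that] by blast
  then show ?thesis using that g(1) by blast
qed

lemma wpo_good:
  fixes f :: "nat \<Rightarrow> 'a"
  assumes "wpo_on X r" "range f \<subseteq> X"
  obtains i j where "i < j" "(f i, f j) \<in> r"
  using wpo_mono_subsequence[OF assms] by (metis lessI strict_mono_def)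

text \<open>A strictly descending sequence has no pair \<open>i < j\<close> with
  \<open>(f i, f j) \<in> r\<close>, and neither has an injective enumeration of part of an
  antichain.\<close>

lemma wpoI:
  assumes po: "partial_order_on X r"
    and good: "\<And>f :: nat \<Rightarrow> 'a. range f \<subseteq> X \<Longrightarrow> \<exists>i j. i < j \<and> (f i, f j) \<in> r"
  shows "wpo_on X r"
proof -
  have r: "r \<subseteq> X \<times> X" "refl_on X r" "trans r" "antisym r" using po by (auto simp: order_on_defs)
  have "wf (r - Id)"
  proof (unfold wf_iff_no_infinite_down_chain, rule notI, erule exE)
    fix f :: "nat \<Rightarrow> 'a" assume f: "\<forall>i. (f (Suc i), f i) \<in> r - Id"
    have tr: "trans (r - Id)" using r by (simp add: trans_diff_Id)
    have desc: "(f j, f i) \<in> r - Id" if "i < j" for i j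
      using that
    proof (induction j)
      case (Suc j)
      then show ?case using f transD[OF tr] by (metis less_Suc_eq)
    qed simp
    have "range f \<subseteq> X" using f r(1) by blast
    then obtain i j where "i < j" "(f i, f j) \<in> r" using good by blast
    with desc[of i j] r(4) show False by (auto simp: antisym_def)
  qed
  moreover have "finite A" if "A \<subseteq> X" "antichain_in r A" for A
  proof (rule ccontr)
    assume "infinite A"
    then obtain f :: "nat \<Rightarrow> 'a" where f: "inj f" "range f \<subseteq> A"
      using infinite_countable_subset by blast
    have "range f \<subseteq> X" using f(2) that(1) by (rule subset_trans)
    then obtain i j where "i < j" "(f i, f j) \<in> r" using good[of f] by blast
    moreover have "f i \<noteq> f j" using f(1) \<open>i < j\<close> by (auto simp: inj_def)
    ultimately show False using that(2) f(2) unfolding antichain_in_def by blast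
  qed
  ultimately show ?thesis using po by (auto simp: wpo_on_def)
qed

text \<open>Passing to subsequences one ordering at a time makes a sequence increase in all of the
  finitely many orderings, hence in their intersection.\<close>

lemma wpo_INT:
  fixes X :: "'a set"
  assumes I: "finite I" "I \<noteq> {}" and wpo: "\<And>i. i \<in> I \<Longrightarrow> wpo_on X (le i)"
  shows "wpo_on X (\<Inter>i\<in>I. le i)"
proof (rule wpoI)
  show "partial_order_on X (\<Inter>i\<in>I. le i)"
  proof -
    have "\<And>i. i \<in> I \<Longrightarrow> le i \<subseteq> X \<times> X \<and> refl_on X (le i) \<and> trans (le i) \<and> antisym (le i)"
      using wpo by (auto simp: wpo_on_def order_on_defs)
    note le = this
    have "(\<Inter>i\<in>I. le i) \<subseteq> X \<times> X" using I(2) le by blast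
    moreover have "refl_on X (\<Inter>i\<in>I. le i)" using le unfolding refl_on_def by blast
    moreover have "trans (\<Inter>i\<in>I. le i)" by (intro trans_INTER) (use le in blast)
    moreover have "antisym (\<Inter>i\<in>I. le i)"
    proof (rule antisymI)
      fix x y assume xy: "(x, y) \<in> (\<Inter>i\<in>I. le i)" "(y, x) \<in> (\<Inter>i\<in>I. le i)"
      obtain i where "i \<in> I" using I(2) by blast
      then show "x = y" using xy le[of i] antisymD[of "le i" x y] by blast
    qed
    ultimately show ?thesis unfolding order_on_defs by blast
  qed
  fix f :: "nat \<Rightarrow> 'a" assume f: "range f \<subseteq> X"
  have "\<exists>g :: nat \<Rightarrow> nat. strict_mono g \<and> (\<forall>i\<in>I. \<forall>a b. a < b \<longrightarrow> (f (g a), f (g b)) \<in> le i)"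
    using I(1) wpo
  proof (induction I)
    case empty then show ?case by (intro exI[of _ id]) (auto simp: strict_mono_def)
  next
    case (insert i I)
    then obtain g :: "nat \<Rightarrow> nat" where g: "strict_mono g"
      "\<forall>i\<in>I. \<forall>a b. a < b \<longrightarrow> (f (g a), f (g b)) \<in> le i" by auto
    have "range (f \<circ> g) \<subseteq> X" using f by auto
    then obtain h :: "nat \<Rightarrow> nat" where h: "strict_mono h"
      "\<And>a b. a < b \<Longrightarrow> ((f \<circ> g) (h a), (f \<circ> g) (h b)) \<in> le i"
      using wpo_mono_subsequence[of X "le i" "f \<circ> g"] insert.prems by blast
    have "strict_mono (g \<circ> h)" using g(1) h(1) by (auto simp: strict_mono_def)
    moreover have "(f ((g \<circ> h) a), f ((g \<circ> h) b)) \<in> le j" if "j \<in> insert i I" "a < b" for j a b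
    proof (cases "j = i")
      case True then show ?thesis using h(2)[OF that(2)] by simp
    next
      case False
      have "h a < h b" using h(1) that(2) by (simp add: strict_mono_def)
      then show ?thesis using g(2) False that(1) by simp
    qed
    ultimately show ?case by blast
  qed
  then obtain g :: "nat \<Rightarrow> nat" where g: "strict_mono g"
    "\<forall>i\<in>I. \<forall>a b. a < b \<longrightarrow> (f (g a), f (g b)) \<in> le i" by blast
  then have "g 0 < g 1" "(f (g 0), f (g 1)) \<in> (\<Inter>i\<in>I. le i)" by (auto simp: strict_mono_def)
  then show "\<exists>i j. i < j \<and> (f i, f j) \<in> (\<Inter>i\<in>I. le i)" by blast
qed

text \<open>A pair \<open>i < j\<close> on which a sequence increases in \<open>r\<close> persists
  in the extension \<open>l\<close>.\<close>

lemma lin_ext_Well_order: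
  assumes X: "wpo_on X r" and Y: "Y \<subseteq> X" and l: "lin_ext r Y l"
  shows "Well_order l"
proof -
  have lin: "linear_order_on Y l" using l by (simp add: lin_ext_iff)
  then have l1: "trans l" "antisym l" "l \<subseteq> Y \<times> Y" "partial_order_on Y l"
    unfolding order_on_defs by blast+
  have "wpo_on Y l"
  proof (rule wpoI[OF l1(4)])
    fix f :: "nat \<Rightarrow> 'a" assume f: "range f \<subseteq> Y"
    then have "range f \<subseteq> X" using Y by blast
    from wpo_good[OF X this] obtain i j where "i < j" "(f i, f j) \<in> r" by blast
    then show "\<exists>i j. i < j \<and> (f i, f j) \<in> l" using f l unfolding lin_ext_iff by blast
  qed
  then show ?thesis using lin Field_linear_order_on[OF lin] by (simp add: wpo_on_def well_order_on_def)
qed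

text \<open>Choose \<open>f i\<close> in \<open>D i\<close> but not in \<open>D (Suc i)\<close>. If
  \<open>f i\<close> were below a later \<open>f j\<close>, it would lie in \<open>D (Suc i)\<close>
  because \<open>f j\<close> does.\<close>

lemma wf_down_sets:
  assumes X: "wpo_on X r" and Y: "Y \<subseteq> X"
  shows "wf {(D, E). D \<subset> E \<and> down_set r Y D \<and> down_set r Y E}" (is "wf ?R")
proof (unfold wf_iff_no_infinite_down_chain, rule notI, erule exE)
  fix D assume D: "\<forall>i :: nat. (D (Suc i), D i) \<in> ?R"
  then have "\<forall>i. \<exists>x. x \<in> D i - D (Suc i)" by blast
  then obtain f where f: "\<And>i. f i \<in> D i - D (Suc i)" by metis
  have "D (Suc i) \<subseteq> D i" for i using D by blast
  then have anti: "D j \<subseteq> D i" if "i \<le> j" for i j using lift_Suc_antimono_le[of D] that by blast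
  have D2: "down_set r Y (D i)" for i using D by blast
  have fY: "f i \<in> Y" for i using f[of i] D2[of i] unfolding down_set_def by blast
  then have "range f \<subseteq> X" using Y by blast
  from wpo_good[OF X this] obtain i j where ij: "i < j" "(f i, f j) \<in> r" by blast
  have "f j \<in> D (Suc i)" using f[of j] anti[OF Suc_leI[OF ij(1)]] by blast
  then have "f i \<in> D (Suc i)" using ij(2) D2[of "Suc i"] fY[of i] unfolding down_set_def by blast
  then show False using f[of i] by blast
qed

lemma minimal_down_set:
  assumes "wpo_on X r" "Y \<subseteq> X" "down_set r Y D" "P D"
  obtains J where "down_set r Y J" "P J" "\<And>J'. down_set r Y J' \<Longrightarrow> J' \<subset> J \<Longrightarrow> \<not> P J'"
proof -
  define Q where "Q = {D. down_set r Y D \<and> P D}"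
  have "D \<in> Q" using assms by (simp add: Q_def)
  from wfE_min[OF wf_down_sets[OF assms(1,2)] this] obtain J where "J \<in> Q"
    "\<And>J'. (J', J) \<in> {(D, E). D \<subset> E \<and> down_set r Y D \<and> down_set r Y E} \<Longrightarrow> J' \<notin> Q" by blast
  then show ?thesis by (intro that[of J]) (auto simp: Q_def)
qed

section \<open>The theorem of de Jongh and Parikh\<close>

lemma ordLeq_below_imp_ordIso:
  fixes p :: "'o::wellorder"
  assumes "l \<le>o below p" shows "\<exists>p'\<le>p. l =o below p'"
proof (cases "below p \<le>o l")
  case True
  then show ?thesis using assms ordIso_iff_ordLeq by blast
next
  case False
  moreover have "Well_order l" using assms unfolding ordLeq_def by blast
  ultimately show ?thesis using wellorder_neq_below by (meson less_imp_le)
qed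

lemma below_bot_ordLeq:
  assumes m: "Well_order m" and x: "x \<in> Field m"
  shows "below {#bot_exp :: 'e::wellorder#} \<le>o m"
  unfolding below_ordLeq_iff[OF m] less_single_bot_iff using x by (intro exI[of _ "\<lambda>_. x"]) auto

text \<open>Counterpart of \<open>ordLeq_below_Un\<close>. With the exponents in this order
  \<open>M + N\<close> is the type of \<open>M\<close> followed by \<open>N\<close>, so embeddings
  of the two parts combine, the second one after subtracting \<open>M\<close>.\<close>

lemma concat_ordLeq:
  fixes M N :: "'e::wellorder multiset"
  assumes W: "Well_order (rel_concat A l B m)" and Fl: "Field l = A" and Fm: "Field m = B"
    and AB: "A \<inter> B = {}" and Ml: "below M \<le>o l" and Nm: "below N \<le>o m"
    and le: "\<And>d e. d \<in># N \<Longrightarrow> e \<in># M \<Longrightarrow> d \<le> e"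
  shows "below (M + N) \<le>o rel_concat A l B m"
proof -
  have "Well_order l" "Well_order m" using Ml Nm unfolding ordLeq_def by blast+
  obtain f where f: "\<forall>x<M. f x \<in> Field l" "\<forall>x y. x < y \<and> y < M \<longrightarrow> (f x, f y) \<in> l \<and> f x \<noteq> f y"
    using Ml unfolding below_ordLeq_iff[OF \<open>Well_order l\<close>] by blast
  obtain g where g: "\<forall>x<N. g x \<in> Field m" "\<forall>x y. x < y \<and> y < N \<longrightarrow> (g x, g y) \<in> m \<and> g x \<noteq> g y"
    using Nm unfolding below_ordLeq_iff[OF \<open>Well_order m\<close>] by blast
  have fA: "f P \<in> A" if "P < M" for P using f(1) that Fl by simp
  have gB: "g P \<in> B" if "P < N" for P using g(1) that Fm by simp
  define h where "h P = (if P < M then f P else g (P - M))" for P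
  have hN: "\<exists>P'. P = M + P' \<and> P' < N \<and> h P = g P'" if P: "P < M + N" "\<not> P < M" for P
  proof -
    have "M \<le> P" using P(2) by simp
    from mset_split_interval[OF this P(1) le] obtain P' where "P = M + P'" "P' < N" by blast
    then show ?thesis using P(2) by (auto simp: h_def)
  qed
  show ?thesis
    unfolding below_ordLeq_iff[OF W]
  proof (intro exI[of _ h] conjI allI impI)
    fix P Q assume PQ: "P < Q \<and> Q < M + N"
    have "(h P, h Q) \<in> rel_concat A l B m \<and> h P \<noteq> h Q"
    proof (cases "Q < M")
      case True
      then have "P < M" using PQ by (meson less_trans)
      then show ?thesis using f(2) PQ True by (auto simp: h_def rel_concat_def)
    next
      case False
      then obtain Q' where Q': "Q = M + Q'" "Q' < N" "h Q = g Q'" using hN PQ by blast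
      show ?thesis
      proof (cases "P < M")
        case True
        then show ?thesis using fA[OF True] gB[OF Q'(2)] Q'(3) AB
          by (auto simp: h_def rel_concat_def)
      next
        case False
        then obtain P' where P': "P = M + P'" "P' < N" "h P = g P'" using hN PQ by (meson less_trans)
        then have "P' < Q'" using PQ Q' by simp
        then show ?thesis using g(2) P'(3) Q'(2,3) by (auto simp: rel_concat_def)
      qed
    qed
    then show "(h P, h Q) \<in> rel_concat A l B m" "h P \<noteq> h Q" by blast+
  next
    fix P assume P: "P < M + N"
    have "h P \<in> A \<union> B"
      using hN[OF P] fA gB by (cases "P < M") (auto simp: h_def)
    moreover have "Field l \<union> Field m \<subseteq> Field (rel_concat A l B m)"
      by (auto simp: rel_concat_def Field_def)
    ultimately show "h P \<in> Field (rel_concat A l B m)" using Fl Fm by blast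
  qed
qed

definition max_type :: "'a rel \<Rightarrow> 'a set \<Rightarrow> 'o::wellorder \<Rightarrow> bool" where
  "max_type r Y p \<longleftrightarrow> (\<exists>l. lin_ext r Y l \<and> l =o below p) \<and> (\<forall>l. lin_ext r Y l \<longrightarrow> l \<le>o below p)"

text \<open>The core of the theorem of de Jongh and Parikh. The candidate \<open>lam\<close> is the
  least ordinal above the maximal types \<open>h x\<close> of the residuals \<open>P x\<close>;
  \<open>p0\<close> ensures that it exists. It bounds every extension, since the predecessors of
  \<open>x\<close> in an extension lie in \<open>P x\<close>. The work is in attaining it when it is
  a limit.\<close>

lemma max_type_step:
  fixes r :: "'a rel" and p0 :: "'e::wellorder multiset"
  assumes X: "wpo_on X r" and YX: "Y \<subseteq> X"
    and p0: "\<And>l :: 'a rel. Well_order l \<Longrightarrow> l <o below p0"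
    and IH: "\<And>D. down_set r Y D \<Longrightarrow> D \<noteq> Y \<Longrightarrow> \<exists>p :: 'e multiset. max_type r D p"
  shows "\<exists>p :: 'e multiset. max_type r Y p"
proof -
  have po: "partial_order_on X r" using X by (simp add: wpo_on_def)
  have r: "r \<subseteq> X \<times> X" "refl_on X r" "trans r" "antisym r" using po unfolding order_on_defs by blast+
  note tr = transD[OF r(3)]
  have rY: "(y, y) \<in> r" if "y \<in> Y" for y using that YX r(2) by (auto simp: refl_on_def)
  define P where "P x = {y \<in> Y. (x, y) \<notin> r}" for x
  have P_down: "down_set r Y (P x)" for x
    unfolding down_set_def P_def using tr by blast
  have P_mono: "P x \<subseteq> P y" if "(x, y) \<in> r" for x y
    unfolding P_def using tr[OF that] by blast
  have PY: "P x \<subseteq> Y" for x unfolding P_def by blast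
  have "\<exists>p :: 'e multiset. max_type r (P x) p" if "x \<in> Y" for x
    by (rule IH[OF P_down]) (use that rY in \<open>auto simp: P_def\<close>)
  then obtain h :: "'a \<Rightarrow> 'e multiset" where h: "\<And>x. x \<in> Y \<Longrightarrow> max_type r (P x) (h x)" by metis
  then have "\<forall>x\<in>Y. \<exists>l. lin_ext r (P x) l \<and> l =o below (h x)" unfolding max_type_def by blast
  then obtain lm where lm: "\<And>x. x \<in> Y \<Longrightarrow> lin_ext r (P x) (lm x)" "\<And>x. x \<in> Y \<Longrightarrow> lm x =o below (h x)"
    by metis
  have hmax: "l \<le>o below (h x)" if "x \<in> Y" "lin_ext r (P x) l" for x l
    using h[OF that(1)] that(2) unfolding max_type_def by blast
  have WO: "Well_order l" if "Z \<subseteq> Y" "lin_ext r Z l" for Z l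
    using lin_ext_Well_order[OF X] that YX by blast
  have h_p0: "h x < p0" if "x \<in> Y" for x
  proof -
    have "below (h x) =o lm x" using lm(2)[OF that] ordIso_symmetric by blast
    moreover have "lm x <o below p0" using p0 WO[OF PY lm(1)[OF that]] by blast
    ultimately show ?thesis using ordIso_ordLess_trans below_less_iff by blast
  qed
  define lam where "lam = (LEAST p. \<forall>x\<in>Y. h x < p)"
  have lam: "h x < lam" if "x \<in> Y" for x
    using LeastI[of "\<lambda>p. \<forall>x\<in>Y. h x < p" p0] h_p0 that unfolding lam_def by blast
  have lam_least: "\<exists>x\<in>Y. p \<le> h x" if "p < lam" for p
    using not_less_Least[of p "\<lambda>p. \<forall>x\<in>Y. h x < p"] that unfolding lam_def by (meson not_less)
  have upper: "l \<le>o below lam" if l: "lin_ext r Y l" for l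
  proof (rule ordLeq_below_by_segments[OF WO[OF subset_refl l]])
    fix x assume "x \<in> Field l"
    then have x: "x \<in> Y" using lin_ext_Field[OF l] by blast
    have lY: "l \<subseteq> Y \<times> Y" "antisym l" using l unfolding lin_ext_iff order_on_defs by blast+
    have "underS l x \<subseteq> P x"
    proof
      fix y assume "y \<in> underS l x"
      then have y: "(y, x) \<in> l" "y \<noteq> x" by (auto simp: underS_def)
      have "(x, y) \<notin> r"
      proof
        assume "(x, y) \<in> r"
        then have "(x, y) \<in> l" using l x y(1) lY(1) unfolding lin_ext_iff by blast
        then show False using antisymD[OF lY(2)] y by blast
      qed
      then show "y \<in> P x" using y(1) lY(1) unfolding P_def by blast
    qed
    then have "Restr l (underS l x) \<le>o Restr l (P x)"
      by (rule Restr_mono_ordLeq[OF WO[OF subset_refl l]])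
    moreover have "Restr l (P x) \<le>o below (h x)" using hmax[OF x lin_ext_subset[OF l PY]] .
    ultimately have "Restr l (underS l x) \<le>o below (h x)" by (rule ordLeq_transitive)
    then show "\<exists>p'<lam. Restr l (underS l x) \<le>o below p'" using lam[OF x] by blast
  qed
  have suff: "\<exists>p :: 'e multiset. max_type r Y p" if "lin_ext r Y l" "below lam \<le>o l" for l
    using that upper unfolding max_type_def ordIso_iff_ordLeq by blast
  show ?thesis
  proof (cases "lam = {#}")
    case True
    obtain l where l: "lin_ext r Y l" using lin_ext_exists[OF po YX] .
    have "below lam \<le>o l" unfolding below_ordLeq_iff[OF WO[OF subset_refl l]] True by simp
    then show ?thesis using suff l by blast
  next
    case False
    \<comment> \<open>Only the last term \<omega>^a of \<open>lam\<close> needs care: some residual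
      already has an extension of type at least \<open>M\<close>, so it suffices to order its
      complement with type at least \<omega>^a.\<close>
    then obtain M a where lamM: "lam = add_mset a M" and aM: "\<And>e. e \<in># M \<Longrightarrow> a \<le> e"
      using mset_split_min by metis
    have split_lam: "\<exists>N. p = M + N \<and> (\<forall>e\<in>#N. e < a)" if "M \<le> p" "p < lam" for p
    proof -
      have "p < M + {#a#}" using that(2) lamM by simp
      from mset_split_interval[OF that(1) this] aM show ?thesis by auto
    qed
    have in_lam: "M + N < lam" if "\<forall>e\<in>#N. e < a" for N
    proof -
      have "N < {#a#}" using that by simp
      then have "M + N < M + {#a#}" by (rule add_strict_left_mono)
      then show ?thesis using lamM by simp
    qed
    have M_lam: "M < lam" using in_lam[of "{#}"] by simp
    have finish: "\<exists>p :: 'e multiset. max_type r Y p"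
      if x0: "x0 \<in> Y" "M \<le> h x0" and m: "lin_ext r (Y - P x0) m" "below {#a#} \<le>o m" for x0 m
    proof -
      let ?l = "rel_concat (P x0) (lm x0) (Y - P x0) m"
      have ext: "lin_ext r Y ?l" by (rule lin_ext_concat[OF P_down lm(1)[OF x0(1)] m(1)])
      have "below M \<le>o below (h x0)" using x0(2) by simp
      then have M: "below M \<le>o lm x0"
        using lm(2)[OF x0(1)] ordIso_symmetric ordLeq_ordIso_trans by blast
      have "below (M + {#a#}) \<le>o ?l"
      proof (rule concat_ordLeq[OF WO[OF subset_refl ext] _ _ _ M m(2)])
        show "Field (lm x0) = P x0" using lin_ext_Field[OF lm(1)[OF x0(1)]] .
        show "Field m = Y - P x0" using lin_ext_Field[OF m(1)] .
      qed (use aM in auto)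
      then have "below lam \<le>o ?l" using lamM by simp
      then show ?thesis using suff[OF ext] by blast
    qed
    show ?thesis
    proof (cases "a = bot_exp")
      case True
      \<comment> \<open>Successor case: the complement of \<open>P x0\<close> contains
        \<open>x0\<close>, so any extension of it contributes 1.\<close>
      obtain x0 where x0: "x0 \<in> Y" "M \<le> h x0" using lam_least[OF M_lam] by blast
      have "Y - P x0 \<subseteq> X" using YX by blast
      then obtain m where m: "lin_ext r (Y - P x0) m" using lin_ext_exists[OF po] by metis
      have "x0 \<in> Field m" using lin_ext_Field[OF m] x0(1) rY[OF x0(1)] by (simp add: P_def)
      then have "below {#a#} \<le>o m" unfolding True by (intro below_bot_ordLeq WO[OF Diff_subset m])
      then show ?thesis using finish[OF x0 m] by blast
    next
      case False
      then have bota: "bot_exp < a" using bot_exp_le[of a] by simp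
      define U where "U S \<longleftrightarrow> (\<forall>p<lam. \<exists>y\<in>S. p \<le> h y)" for S
      have "down_set r Y Y" by (simp add: down_set_def)
      moreover have "U Y" unfolding U_def using lam_least by blast
      \<comment> \<open>\<open>J\<close> is minimal among the down sets on which \<open>h\<close> is
        cofinal in \<open>lam\<close>. Deleting from \<open>J\<close> the elements above some
        \<open>x \<in> J\<close> destroys cofinality; so from a bound \<open>b x\<close> on,
        \<open>h\<close> takes its values on \<open>J\<close> only above \<open>x\<close>.\<close>
      ultimately obtain J where J: "down_set r Y J" "U J"
        "\<And>J'. down_set r Y J' \<Longrightarrow> J' \<subset> J \<Longrightarrow> \<not> U J'"
        using minimal_down_set[OF X YX, of Y U] by blast
      have JY: "J \<subseteq> Y" using J(1) by (simp add: down_set_def)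
      have "\<exists>p<lam. \<forall>y\<in>J. p \<le> h y \<longrightarrow> (x, y) \<in> r" if "x \<in> J" for x
      proof -
        have "down_set r Y (J \<inter> P x)"
          using J(1) P_down[of x] unfolding down_set_def by blast
        moreover have "x \<in> Y" using that JY by blast
        then have "J \<inter> P x \<subset> J" using that rY[of x] unfolding P_def by blast
        ultimately have "\<not> U (J \<inter> P x)" by (rule J(3))
        then obtain p where p: "p < lam" "\<forall>y\<in>J \<inter> P x. \<not> p \<le> h y" unfolding U_def by blast
        have "(x, y) \<in> r" if "y \<in> J" "p \<le> h y" for y
          using p(2) that JY unfolding P_def by blast
        then show ?thesis using p(1) by blast
      qed
      then obtain b where b: "\<And>x. x \<in> J \<Longrightarrow> b x < lam"
        "\<And>x y. x \<in> J \<Longrightarrow> y \<in> J \<Longrightarrow> b x \<le> h y \<Longrightarrow> (x, y) \<in> r" by metis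
      \<comment> \<open>A cofinal part \<open>C\<close> of least cardinality plays the role of a
        cofinality: on fewer than \<open>|C|\<close> elements of \<open>J\<close> the function
        \<open>h\<close> is bounded below \<open>lam\<close>, which yields the common upper bounds
        in \<open>dir\<close>.\<close>
      define CC where "CC = {|C| | C. C \<subseteq> J \<and> U C}"
      have "|J| \<in> CC" using J(2) unfolding CC_def by blast
      from wfE_min[OF wf_ordLess this] obtain R where R: "R \<in> CC" "\<And>R'. R' <o R \<Longrightarrow> R' \<notin> CC" by blast
      then obtain C where C: "C \<subseteq> J" "U C" "R = |C|" unfolding CC_def by blast
      have small: "\<exists>p<lam. \<forall>y\<in>S. h y < p" if "S \<subseteq> J" "|S| <o |C|" for S
      proof -
        have "|S| \<notin> CC" using R(2) that(2) C(3) by blast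
        then have "\<not> U S" using that(1) unfolding CC_def by blast
        then show ?thesis unfolding U_def by (meson not_less)
      qed
      have dir1: "\<exists>y\<in>J. (z, y) \<in> r \<and> p \<le> h y" if z: "z \<in> J" "p < lam" for z p
      proof -
        have "max (b z) p < lam" using b(1)[OF z(1)] z(2) by simp
        then obtain y where "y \<in> J" "max (b z) p \<le> h y" using J(2) unfolding U_def by blast
        then show ?thesis using b(2)[OF z(1)] by auto
      qed
      have dir: "\<exists>z\<in>J. p1 \<le> h z \<and> (\<forall>x\<in>S. (x, z) \<in> r)" if S: "S \<subseteq> J" "|S| <o |C|" and p1: "p1 < lam" for S p1
      proof -
        have "\<forall>x\<in>S. \<exists>w\<in>J. b x \<le> h w" using S(1) b(1) J(2) unfolding U_def by blast
        then obtain w where w: "\<And>x. x \<in> S \<Longrightarrow> w x \<in> J" "\<And>x. x \<in> S \<Longrightarrow> b x \<le> h (w x)" by metis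
        have "|w ` S| \<le>o |S|" by (rule card_of_image)
        then have "|w ` S| <o |C|" using S(2) ordLeq_ordLess_trans by blast
        moreover have "w ` S \<subseteq> J" using w(1) by blast
        ultimately obtain p where p: "p < lam" "\<forall>y\<in>w ` S. h y < p" using small by blast
        have "max p p1 < lam" using p(1) p1 by simp
        then obtain z where z: "z \<in> J" "max p p1 \<le> h z" using J(2) unfolding U_def by blast
        have "(x, z) \<in> r" if "x \<in> S" for x
        proof (rule b(2))
          have "b x \<le> h (w x)" using w(2)[OF that] .
          also have "\<dots> \<le> p" using p(2) that by (simp add: less_imp_le)
          also have "p \<le> h z" using z(2) by simp
          finally show "b x \<le> h z" .
        qed (use that S(1) z in auto)
        then show ?thesis using z by auto
      qed
      obtain x0 where x0: "x0 \<in> J" "M \<le> h x0" using J(2) M_lam unfolding U_def by blast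
      \<comment> \<open>The part of \<open>h \<xi>\<close> inside the last term of
        \<open>lam\<close>: \<open>h \<xi> = M + N \<xi>\<close> once \<open>M\<close> has been
        reached, and 0 by default before.\<close>
      define N where "N \<xi> = (if M \<le> h \<xi> then h \<xi> - M else {#})" for \<xi>
      have Na: "\<forall>e\<in>#N \<xi>. e < a" if "\<xi> \<in> Y" for \<xi>
        using split_lam[OF _ lam[OF that]] unfolding N_def by (cases "M \<le> h \<xi>") force+
      \<comment> \<open>The requirement on an increasing transfinite sequence \<open>f\<close> in
        \<open>J\<close>, indexed by a well-order of \<open>C\<close>: \<open>u\<close> lies above
        \<open>x0\<close> and all earlier choices, and from \<open>u\<close> to
        \<open>f \<xi>\<close> the residual length grows by at least \<open>N \<xi>\<close>.\<close>
      define good where "good f \<xi> z \<longleftrightarrow> (\<xi> \<in> C \<longrightarrow> z \<in> J \<and>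
          (\<exists>u\<in>J. (x0, u) \<in> r \<and> (\<forall>\<eta>. (\<eta>, \<xi>) \<in> |C| - Id \<longrightarrow> (f \<eta>, u) \<in> r) \<and> (u, z) \<in> r \<and> h u + N \<xi> \<le> h z))" for f \<xi> z
      have WC: "Well_order |C|" "Field |C| = C" by (rule card_of_Well_order, rule Field_card_of)
      have "\<exists>f. \<forall>\<xi>. good f \<xi> (f \<xi>)"
      proof (rule dependent_wf_choice[where R = "|C| - Id"])
        show "wf ( |C| - Id)" using WC(1) by (simp add: well_order_on_def)
      next
        fix f g :: "'a \<Rightarrow> 'a" and \<xi> z assume "\<And>\<eta>. (\<eta>, \<xi>) \<in> |C| - Id \<Longrightarrow> f \<eta> = g \<eta>"
        then have "(\<forall>\<eta>. (\<eta>, \<xi>) \<in> |C| - Id \<longrightarrow> (f \<eta>, u) \<in> r) = (\<forall>\<eta>. (\<eta>, \<xi>) \<in> |C| - Id \<longrightarrow> (g \<eta>, u) \<in> r)" for u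
          by metis
        then show "good f \<xi> z = good g \<xi> z" unfolding good_def by simp
      next
        fix \<xi> f assume prev: "\<And>\<eta>. (\<eta>, \<xi>) \<in> |C| - Id \<Longrightarrow> good f \<eta> (f \<eta>)"
        show "\<exists>z. good f \<xi> z"
        proof (cases "\<xi> \<in> C")
          case False then show ?thesis unfolding good_def by blast
        next
          case True
          let ?S = "f ` underS ( |C| ) \<xi>"
          have "|underS ( |C| ) \<xi>| <o |C|"
            using card_of_underS[OF card_of_Card_order, of \<xi> C] True WC(2) by simp
          then have S1: "|?S| <o |C|" using card_of_image ordLeq_ordLess_trans by blast
          have S2: "?S \<subseteq> J"
          proof
            fix y assume "y \<in> ?S"
            then obtain \<eta> where \<eta>: "y = f \<eta>" "(\<eta>, \<xi>) \<in> |C| - Id" by (auto simp: underS_def)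
            then have "\<eta> \<in> C" using WC(2) by (metis DiffD1 FieldI1)
            then show "y \<in> J" using prev[OF \<eta>(2)] \<eta>(1) unfolding good_def by blast
          qed
          have "max (b x0) M < lam" using b(1)[OF x0(1)] M_lam by simp
          then obtain u where u: "u \<in> J" "max (b x0) M \<le> h u" "\<forall>x\<in>?S. (x, u) \<in> r" using dir[OF S2 S1] by blast
          have x0u: "(x0, u) \<in> r" using b(2)[OF x0(1) u(1)] u(2) by simp
          have "h u < lam" using lam u(1) JY by blast
          moreover have "M \<le> h u" using u(2) by simp
          ultimately obtain N' where N': "h u = M + N'" "\<forall>e\<in>#N'. e < a" using split_lam by blast
          have "\<xi> \<in> Y" using True C(1) JY by blast
          then have "h u + N \<xi> < lam" using in_lam[of "N' + N \<xi>"] N' Na[of \<xi>] by (auto simp: add.assoc)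
          then obtain z where "z \<in> J" "(u, z) \<in> r" "h u + N \<xi> \<le> h z" using dir1[OF u(1)] by blast
          then have "good f \<xi> z" unfolding good_def using u x0u by (auto simp: underS_def)
          then show ?thesis by blast
        qed
      qed
      then obtain f where f: "\<And>\<xi>. good f \<xi> (f \<xi>)" by blast
      have fJ: "f \<xi> \<in> J" if "\<xi> \<in> C" for \<xi> using f[of \<xi>] that unfolding good_def by blast
      have f_mono: "P (f \<eta>) \<subseteq> P (f \<xi>)" if "(\<eta>, \<xi>) \<in> |C|" for \<eta> \<xi>
      proof (cases "\<eta> = \<xi>")
        case False
        have "\<xi> \<in> C" using that WC(2) by (metis FieldI2)
        then have "(f \<eta>, f \<xi>) \<in> r" using f[of \<xi>] that False tr unfolding good_def by blast
        then show ?thesis by (rule P_mono)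
      qed simp
      \<comment> \<open>The sets \<open>P (f \<xi>)\<close> increase with \<open>\<xi>\<close>, and
        \<open>T y\<close> is the set of stages before \<open>y\<close> enters them. Elements are
        ordered by this stage.\<close>
      define T where "T y = {\<xi> \<in> C. y \<notin> P (f \<xi>)}" for y
      have T_comp: "T y \<subseteq> T y' \<or> T y' \<subseteq> T y" for y y'
      proof (rule ccontr)
        assume "\<not> ?thesis"
        then obtain \<xi> \<eta> where x: "\<xi> \<in> T y" "\<xi> \<notin> T y'" "\<eta> \<in> T y'" "\<eta> \<notin> T y" by blast
        then have "\<xi> \<in> C" "\<eta> \<in> C" unfolding T_def by blast+
        then have "(\<xi>, \<eta>) \<in> |C| \<or> (\<eta>, \<xi>) \<in> |C|"
          using WC wo_rel.TOTALS[of "|C|"] by (simp add: wo_rel_def)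
        then show False using x f_mono[of \<xi> \<eta>] f_mono[of \<eta> \<xi>] unfolding T_def by blast
      qed
      obtain l0 where l0: "lin_ext r Y l0" using lin_ext_exists[OF po YX] .
      interpret C: wo_rel "|C|" using WC(1) by (simp add: wo_rel_def)
      \<comment> \<open>Elements entering at the same stage are ordered by the maximal extension of
        the residual they enter; those that never enter come last and are ordered by
        \<open>l0\<close>.\<close>
      define K where "K S = (if C \<subseteq> S then l0 else lm (f (C.minim (C - S))))" for S
      define KF where "KF S = (if C \<subseteq> S then Y else P (f (C.minim (C - S))))" for S
      have minT: "C.minim (C - T y) \<in> C - T y" if "\<not> C \<subseteq> T y" for y
        using C.minim_in[of "C - T y"] that WC(2) by auto
      have K: "lin_ext r (KF (T y)) (K (T y))" for y
      proof (cases "C \<subseteq> T y")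
        case True then show ?thesis unfolding K_def KF_def using l0 by simp
      next
        case False
        then have "f (C.minim (C - T y)) \<in> Y" using minT[OF False] fJ JY by blast
        then show ?thesis unfolding K_def KF_def using False lm(1) by simp
      qed
      define Q where "Q = Y - P x0"
      define m where "m = rel_lex Q T K"
      have mext: "lin_ext r Q m" unfolding m_def
      proof (rule lin_ext_lex[where F = KF])
        fix x y assume xy: "x \<in> Q"
        show "T x \<subseteq> T y \<or> T y \<subseteq> T x" by (rule T_comp)
        show "lin_ext r (KF (T x)) (K (T x))" by (rule K)
        show "x \<in> KF (T x)" using minT[of x] xy unfolding KF_def T_def Q_def by auto
        show "T x \<subseteq> T y" if "(x, y) \<in> r"
          using tr[OF _ that] xy unfolding T_def P_def Q_def by blast
      qed
      have Wm: "Well_order m" using WO[OF _ mext] unfolding Q_def by blast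
      have Nm: "below (N \<xi>) \<le>o m" if xi: "\<xi> \<in> C" for \<xi>
      proof -
        obtain u where u: "u \<in> J" "(x0, u) \<in> r" "\<And>\<eta>. (\<eta>, \<xi>) \<in> |C| - Id \<Longrightarrow> (f \<eta>, u) \<in> r"
            "(u, f \<xi>) \<in> r" "h u + N \<xi> \<le> h (f \<xi>)"
          using f[of \<xi>] xi unfolding good_def by blast
        have uY: "u \<in> Y" "f \<xi> \<in> Y" using u(1) fJ[OF xi] JY by blast+
        \<comment> \<open>All of \<open>B\<close> enters exactly at stage \<open>\<xi>\<close>, so
          \<open>m\<close> orders it as \<open>lm (f \<xi>)\<close> does. That order, of type
          \<open>h (f \<xi>)\<close>, is covered by \<open>B\<close> and \<open>P u\<close>, and on
          \<open>P u\<close> its type is at most \<open>h u\<close>; cancelling \<open>h u\<close>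
          leaves at least \<open>N \<xi>\<close> for \<open>B\<close>.\<close>
        define B where "B = P (f \<xi>) - P u"
        have BQ: "B \<subseteq> Q" using P_mono[OF u(2)] PY unfolding B_def Q_def by blast
        have xixi: "(\<xi>, \<xi>) \<in> |C|" using C.REFL WC(2) xi by (auto simp: refl_on_def)
        have TB: "C - T y = {\<eta>. (\<xi>, \<eta>) \<in> |C|}" if yB: "y \<in> B" for y
        proof -
          have "\<eta> \<in> C - T y \<longleftrightarrow> (\<xi>, \<eta>) \<in> |C|" for \<eta>
          proof
            assume eta: "\<eta> \<in> C - T y"
            show "(\<xi>, \<eta>) \<in> |C|"
            proof (rule ccontr)
              assume "(\<xi>, \<eta>) \<notin> |C|"
              then have "(\<eta>, \<xi>) \<in> |C| - Id"
                using C.TOTALS WC(2) xi eta xixi by auto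
              then have "P (f \<eta>) \<subseteq> P u" by (intro P_mono u(3))
              then show False using eta yB unfolding B_def T_def by blast
            qed
          next
            assume "(\<xi>, \<eta>) \<in> |C|"
            then have "\<eta> \<in> C" "P (f \<xi>) \<subseteq> P (f \<eta>)" using f_mono WC(2) by (auto simp: Field_def)
            then show "\<eta> \<in> C - T y" using yB unfolding T_def B_def by blast
          qed
          then show ?thesis by blast
        qed
        have "C.minim {\<eta>. (\<xi>, \<eta>) \<in> |C|} = \<xi>"
          using xixi WC(2) by (intro C.equals_minim[symmetric]) (auto simp: Field_def)
        moreover have "\<xi> \<in> C - T y" if "y \<in> B" for y using TB[OF that] xixi by blast
        ultimately have KB: "K (T y) = lm (f \<xi>)" if "y \<in> B" for y
          using that TB[OF that] unfolding K_def by auto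
        have RB: "Restr m B = Restr (lm (f \<xi>)) B"
        proof -
          have "(x, y) \<in> m \<longleftrightarrow> (x, y) \<in> lm (f \<xi>)" if xy: "x \<in> B" "y \<in> B" for x y
          proof -
            have "T x = T y" using TB[OF xy(1)] TB[OF xy(2)] unfolding T_def by blast
            moreover have "(x, y) \<in> m \<longleftrightarrow> T x \<subset> T y \<or> T x = T y \<and> (x, y) \<in> K (T x)"
              using xy BQ unfolding m_def rel_lex_def by blast
            ultimately show ?thesis using KB[OF xy(2)] by simp
          qed
          then show ?thesis by blast
        qed
        let ?L = "lm (f \<xi>)"
        have WL: "Well_order ?L" "Field ?L = P (f \<xi>)"
          using WO[OF PY lm(1)] lin_ext_Field[OF lm(1)] uY by blast+
        have "Restr ?L B \<le>o ?L" by (rule Restr_ordLeq[OF WL(1)])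
        then have "Restr ?L B \<le>o below (h (f \<xi>))" using lm(2)[OF uY(2)] ordLeq_ordIso_trans by blast
        then obtain p' :: "'e multiset" where p': "Restr ?L B =o below p'" using ordLeq_below_imp_ordIso by blast
        have "Restr ?L (P u) \<le>o below (h u)"
          using hmax[OF uY(1)] lin_ext_subset[OF lm(1)[OF uY(2)] P_mono[OF u(4)]] by blast
        moreover have "Restr ?L B \<le>o below p'" using p' ordIso_imp_ordLeq by blast
        moreover have "Field ?L \<subseteq> P u \<union> B" using WL(2) unfolding B_def by blast
        ultimately have "?L \<le>o below (h u + p')" by (intro ordLeq_below_Un[OF WL(1)])
        moreover have "below (h (f \<xi>)) =o ?L" using lm(2)[OF uY(2)] ordIso_symmetric by blast
        ultimately have "below (h (f \<xi>)) \<le>o below (h u + p')" using ordIso_ordLeq_trans by blast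
        then have "h (f \<xi>) \<le> h u + p'" by simp
        then have "N \<xi> \<le> p'" using u(5) by (meson add_le_cancel_left order_trans)
        then have "below (N \<xi>) \<le>o below p'" by simp
        also have "below p' =o Restr m B" unfolding RB by (rule ordIso_symmetric[OF p'])
        also have "Restr m B \<le>o m" by (rule Restr_ordLeq[OF Wm])
        finally show ?thesis .
      qed
      have "below {#a#} \<le>o m"
      proof (rule ccontr)
        assume "\<not> below {#a#} \<le>o m"
        then obtain p where p: "p < {#a#}" "m =o below p" using wellorder_neq_below[OF Wm] by blast
        \<comment> \<open>Successors stay below \<omega>^a since \<open>a\<close> is not the least
          exponent. As \<open>C\<close> is cofinal, some \<open>N \<xi>\<close> is at least the
          successor of \<open>p\<close>, yet embeds into \<open>m\<close>.\<close>
        have "M + (p + {#bot_exp#}) < lam" by (rule in_lam) (use p(1) bota in auto)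
        then obtain \<xi> where \<xi>: "\<xi> \<in> C" "M + (p + {#bot_exp#}) \<le> h \<xi>" using C(2) unfolding U_def by blast
        have "M \<le> M + (p + {#bot_exp#})" by simp
        then have "M \<le> h \<xi>" using \<xi>(2) by (rule order_trans)
        moreover have "h \<xi> < lam" using lam \<xi>(1) C(1) JY by blast
        ultimately obtain N' where N': "h \<xi> = M + N'" using split_lam by blast
        then have "N \<xi> = N'" unfolding N_def by simp
        then have "p + {#bot_exp#} \<le> N \<xi>" using \<xi>(2) unfolding N' by simp
        moreover have "below (N \<xi>) \<le>o below p" using Nm[OF \<xi>(1)] p(2) ordLeq_ordIso_trans by blast
        then have "N \<xi> \<le> p" by simp
        ultimately have "p + {#bot_exp#} \<le> p" by (rule order_trans)
        then show False by simp
      qed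
      then show ?thesis using finish[of x0 m] x0 JY mext unfolding Q_def by blast
    qed
  qed
qed

section \<open>Successor cardinals as types of exponents\<close>

text \<open>The elements of \<open>'a suc\<close> are the ordinals below the successor cardinal of
  \<open>'a\<close>. With the order of that cardinal the type supplies exponents for normal
  forms.\<close>

instantiation suc :: (type) wellorder
begin

definition less_eq_suc :: "'a suc \<Rightarrow> 'a suc \<Rightarrow> bool" where
  "less_eq_suc x y \<longleftrightarrow> (Rep_suc x, Rep_suc y) \<in> cardSuc |UNIV :: 'a set|"

definition less_suc :: "'a suc \<Rightarrow> 'a suc \<Rightarrow> bool" where
  "less_suc x y \<longleftrightarrow> x \<le> y \<and> x \<noteq> y"

instance
proof -
  let ?R = "cardSuc |UNIV :: 'a set|"
  have W: "Well_order ?R" by (intro cardSuc_Well_order card_of_Card_order)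
  then interpret R: wo_rel ?R by (simp add: wo_rel_def)
  have refl: "x \<le> x" for x :: "'a suc"
    using R.REFL Rep_suc[of x] unfolding less_eq_suc_def refl_on_def by blast
  have trans: "x \<le> z" if "x \<le> y" "y \<le> z" for x y z :: "'a suc"
    using R.TRANS that unfolding less_eq_suc_def by (meson transD)
  have antisym: "x = y" if "x \<le> y" "y \<le> x" for x y :: "'a suc"
    using antisymD[OF R.ANTISYM] that Rep_suc_inject unfolding less_eq_suc_def by blast
  have total: "x \<le> y \<or> y \<le> x" for x y :: "'a suc"
    using R.TOTALS Rep_suc[of x] Rep_suc[of y] unfolding less_eq_suc_def by blast
  have less: "x < y \<longleftrightarrow> x \<le> y \<and> \<not> y \<le> x" for x y :: "'a suc"
    using antisym refl unfolding less_suc_def by blast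
  have wf: "wf (?R - Id)" using W by (simp add: well_order_on_def)
  have "wf (inv_image (?R - Id) Rep_suc)" by (rule wf_inv_image[OF wf])
  moreover have "{(x, y). x < (y :: 'a suc)} = inv_image (?R - Id) Rep_suc"
    unfolding less_suc_def less_eq_suc_def inv_image_def by (auto simp: Rep_suc_inject)
  ultimately have wf': "wf {(x, y). x < (y :: 'a suc)}" by simp
  have induct: "P x" if "\<And>x. (\<And>y. y < x \<Longrightarrow> P y) \<Longrightarrow> P x" for P and x :: "'a suc"
    using wf_induct_rule[OF wf', of P x] that by simp
  show "OFCLASS('a suc, wellorder_class)"
  proof standard
    show "x < y \<longleftrightarrow> x \<le> y \<and> \<not> y \<le> x" for x y :: "'a suc" by (rule less)
    show "x \<le> x" for x :: "'a suc" by (rule refl)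
    show "x \<le> z" if "x \<le> y" "y \<le> z" for x y z :: "'a suc" by (rule trans[OF that])
    show "x = y" if "x \<le> y" "y \<le> x" for x y :: "'a suc" by (rule antisym[OF that])
    show "x \<le> y \<or> y \<le> x" for x y :: "'a suc" by (rule total)
    show "P x" if "\<And>x. (\<And>y. y < x \<Longrightarrow> P y) \<Longrightarrow> P x" for P and x :: "'a suc"
      by (rule induct[of P, OF that])
  qed
qed

end

lemma ordLess_cardSuc:
  fixes A :: "'a set" and l :: "'b rel"
  assumes l: "Well_order l" and F: "|Field l| \<le>o |A|" shows "l <o cardSuc |A|"
proof (rule ccontr)
  have C: "Card_order (cardSuc |A| )" "Well_order (cardSuc |A| )"
    by (intro cardSuc_Card_order cardSuc_Well_order card_of_Card_order)+
  assume "\<not> l <o cardSuc |A|"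
  then have "cardSuc |A| \<le>o l" using l C(2) not_ordLess_iff_ordLeq by blast
  then have "|Field (cardSuc |A| )| \<le>o |Field l|" by (rule card_of_mono2)
  also note F
  finally have "cardSuc |A| \<le>o |A|"
    using card_of_Field_ordIso[OF C(1)] ordIso_symmetric ordIso_ordLeq_trans by blast
  then show False
    using cardSuc_greater[OF card_of_Card_order, of A] not_ordLess_ordLeq by blast
qed

lemma ordIso_strict_mono:
  assumes r: "Well_order r" and s: "Well_order s"
    and f: "\<And>x. x \<in> Field r \<Longrightarrow> f x \<in> Field s"
      "\<And>x y. (x, y) \<in> r \<Longrightarrow> x \<noteq> y \<Longrightarrow> (f x, f y) \<in> s \<and> f x \<noteq> f y"
    and g: "\<And>x. x \<in> Field s \<Longrightarrow> g x \<in> Field r"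
      "\<And>x y. (x, y) \<in> s \<Longrightarrow> x \<noteq> y \<Longrightarrow> (g x, g y) \<in> r \<and> g x \<noteq> g y"
  shows "r =o s"
  unfolding ordIso_iff_ordLeq
  using ordLeq_strict_mono[OF r s f(2,1)] ordLeq_strict_mono[OF s r g(2,1)] by simp

lemma ord_below_suc:
  fixes z :: "'a set"
  assumes z: "z \<in> Field (cardSuc |UNIV :: 'a set| )"
  shows "ord_below (cardSuc |UNIV :: 'a set| ) z =o below (Abs_suc z)"
proof -
  let ?R = "cardSuc |UNIV :: 'a set|"
  have W: "Well_order ?R" by (intro cardSuc_Well_order card_of_Card_order)
  then interpret R: wo_rel ?R by (simp add: wo_rel_def)
  have F: "Field (ord_below ?R z) = R.underS z"
    unfolding ord_below_def Well_order_Field_Restr[OF W] by (auto simp: underS_def Field_def)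
  have less: "x < y \<longleftrightarrow> (Rep_suc x, Rep_suc y) \<in> ?R \<and> Rep_suc x \<noteq> Rep_suc y" for x y :: "'a suc"
    unfolding less_suc_def less_eq_suc_def by (simp add: Rep_suc_inject)
  have AR: "Rep_suc (Abs_suc x) = x" if "x \<in> Field ?R" for x using Abs_suc_inverse that by blast
  have lt: "Abs_suc x < Abs_suc y \<longleftrightarrow> (x, y) \<in> ?R \<and> x \<noteq> y" if "x \<in> Field ?R" "y \<in> Field ?R" for x y
    using that less AR by simp
  show ?thesis
  proof (rule ordIso_strict_mono[where f = Abs_suc and g = Rep_suc])
    show "Well_order (ord_below ?R z)" unfolding ord_below_def by (rule Well_order_Restr[OF W])
    show "Well_order (below (Abs_suc z))" by (rule Well_order_below)
    show "Abs_suc x \<in> Field (below (Abs_suc z))" if "x \<in> Field (ord_below ?R z)" for x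
    proof -
      have "(x, z) \<in> ?R" "x \<noteq> z" using that unfolding F by (auto simp: underS_def)
      then show ?thesis using lt[OF _ z, of x] FieldI1[of x z ?R] by simp
    qed
    show "(Abs_suc x, Abs_suc y) \<in> below (Abs_suc z) \<and> Abs_suc x \<noteq> Abs_suc y"
      if "(x, y) \<in> ord_below ?R z" "x \<noteq> y" for x y
    proof -
      have "x \<in> Field ?R" "y \<in> Field ?R" "(x, y) \<in> ?R" "(y, z) \<in> ?R" "y \<noteq> z"
        using that by (auto simp: ord_below_def underS_def Field_def)
      then have "Abs_suc x < Abs_suc y" "Abs_suc y < Abs_suc z" using lt z that(2) by blast+
      then show ?thesis by (auto simp: below_def)
    qed
    show "Rep_suc x \<in> Field (ord_below ?R z)" if "x \<in> Field (below (Abs_suc z))" for x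
      using that less[of x "Abs_suc z"] unfolding F AR[OF z] by (simp add: underS_def)
    show "(Rep_suc x, Rep_suc y) \<in> ord_below ?R z \<and> Rep_suc x \<noteq> Rep_suc y"
      if "(x, y) \<in> below (Abs_suc z)" "x \<noteq> y" for x y
    proof -
      have "x < y" "y < Abs_suc z" "x < Abs_suc z" using that by (auto simp: below_def)
      then show ?thesis
        unfolding less AR[OF z] by (auto simp: ord_below_def underS_def)
    qed
  qed
qed

lemma ordIso_below_suc:
  fixes l :: "'b rel"
  assumes l: "Well_order l" and F: "|Field l| \<le>o |UNIV :: 'a set|"
  shows "\<exists>e :: 'a suc. l =o below e"
proof -
  have W: "Well_order (cardSuc |UNIV :: 'a set| )" by (intro cardSuc_Well_order card_of_Card_order)
  obtain z where z: "z \<in> Field (cardSuc |UNIV :: 'a set| )"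
      "l =o ord_below (cardSuc |UNIV :: 'a set| ) z"
    using ordLess_cardSuc[OF l F] ordLess_iff_ordIso_Restr[OF W l]
    unfolding ord_below_def by blast
  show ?thesis using ordIso_transitive[OF z(2) ord_below_suc[OF z(1)]] by blast
qed

text \<open>The inequality \<alpha> \<le> \<omega>^\<alpha>. By it every ordinal that is an exponent
  has a normal form with exponents from the same type.\<close>

lemma below_ordLeq_single: "below e \<le>o below {#e :: 'e::wellorder#}"
  unfolding ordLeq_below_iff[OF Well_order_below] below_iff by (rule exI[of _ "\<lambda>x. {#x#}"]) auto

lemma ordLeq_below_imp_mset:
  fixes e :: "'e::wellorder"
  assumes "l \<le>o below e" shows "\<exists>M :: 'e multiset. l =o below M"
  using ordLeq_below_imp_ordIso[OF ordLeq_transitive[OF assms below_ordLeq_single]] by blast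

lemma ordIso_below_mset:
  fixes l :: "'b rel"
  assumes "Well_order l" and "|Field l| \<le>o |UNIV :: 'a set|"
  shows "\<exists>M :: 'a suc multiset. l =o below M"
  using ordIso_below_suc[OF assms] ordLeq_below_imp_mset ordIso_imp_ordLeq by blast

section \<open>Lengths of well partial orders\<close>

theorem de_Jongh_Parikh:
  fixes r :: "'a rel"
  assumes X: "wpo_on X r" and YX: "Y \<subseteq> X"
  shows "\<exists>p :: 'a set suc multiset. max_type r Y p"
proof -
  \<comment> \<open>The bound demanded by \<open>max_type_step\<close>: the successor cardinal of
    \<open>'a\<close> lies above all well-orders on \<open>'a\<close>. Its field consists of subsets
    of \<open>'a\<close>, so it is itself an exponent once exponents are taken over
    \<open>'a set\<close>.\<close>
  obtain e :: "'a set suc" where e: "cardSuc |UNIV :: 'a set| =o below e"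
    using ordIso_below_suc[OF cardSuc_Well_order[OF card_of_Card_order] card_of_mono1[OF subset_UNIV]] by blast
  have p0: "l <o below {#e#}" if "Well_order l" for l :: "'a rel"
    by (rule ordLess_ordLeq_trans[OF ordLess_cardSuc[OF that card_of_mono1[OF subset_UNIV]]])
      (rule ordIso_ordLeq_trans[OF e below_ordLeq_single])
  have step: "\<exists>p :: 'a set suc multiset. max_type r D p" if D: "down_set r Y D" for D
    using D
  proof (induction D rule: wf_induct_rule[OF wf_down_sets[OF X YX]])
    case (1 D)
    then have "D \<subseteq> X" using YX by (auto simp: down_set_def)
    show ?case
    proof (rule max_type_step[OF X \<open>D \<subseteq> X\<close> p0])
      fix E assume E: "down_set r D E" "E \<noteq> D"
      then have "down_set r Y E" "E \<subset> D" using 1(2) unfolding down_set_def by blast+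
      then show "\<exists>p :: 'a set suc multiset. max_type r E p" using 1 by blast
    qed
  qed
  show ?thesis by (rule step) (simp add: down_set_def)
qed

lemma max_lin_ext:
  assumes X: "wpo_on X r" and YX: "Y \<subseteq> X"
  obtains l where "lin_ext r Y l" "\<And>l'. lin_ext r Y l' \<Longrightarrow> l' \<le>o l"
proof -
  obtain p :: "'a set suc multiset" where p: "max_type r Y p" using de_Jongh_Parikh[OF assms] by blast
  then obtain l where l: "lin_ext r Y l" "l =o below p" unfolding max_type_def by blast
  have "l' \<le>o l" if "lin_ext r Y l'" for l'
    using p that l(2) unfolding max_type_def by (meson ordIso_symmetric ordLeq_ordIso_trans)
  then show ?thesis using that l(1) by blast
qed

lemma wpo_length:
  assumes X: "wpo_on X r"
  shows "linear_extension_on X r (wpo_length X r)"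
    and "linear_extension_on X r l \<Longrightarrow> l \<le>o wpo_length X r"
proof -
  have "r \<subseteq> X \<times> X" using X by (auto simp: wpo_on_def order_on_defs)
  then have "Restr r X = r" by blast
  then have "\<exists>l. linear_extension_on X r l \<and> (\<forall>l'. linear_extension_on X r l' \<longrightarrow> l' \<le>o l)"
    using max_lin_ext[OF X subset_refl] by metis
  from someI_ex[OF this]
  show "linear_extension_on X r (wpo_length X r)" "linear_extension_on X r l \<Longrightarrow> l \<le>o wpo_length X r"
    unfolding wpo_length_def by blast+
qed

definition len_le :: "'a rel \<Rightarrow> 'a set \<Rightarrow> 'o::wellorder \<Rightarrow> bool" where
  "len_le r Y p \<longleftrightarrow> (\<forall>l. lin_ext r Y l \<longrightarrow> l \<le>o below p)"

lemma len_le_subset: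
  assumes r: "wpo_on X r" and YX: "Y \<subseteq> X" and ZY: "Z \<subseteq> Y" and Y: "len_le r Y p"
  shows "len_le r Z p"
  unfolding len_le_def
proof (intro allI impI)
  fix l assume l: "lin_ext r Z l"
  have "partial_order_on X r" using r by (simp add: wpo_on_def)
  from lin_ext_extend[OF this YX ZY l] obtain l' where l': "lin_ext r Y l'" "Restr l' Z = l" .
  have "l \<le>o l'" using Restr_ordLeq[OF lin_ext_Well_order[OF r YX l'(1)], of Z] l'(2) by simp
  also have "l' \<le>o below p" using Y l'(1) unfolding len_le_def by blast
  finally show "l \<le>o below p" .
qed

text \<open>An extension of the residual of maximal type \<open>p'\<close>, followed by the
  complement, which contains \<open>x\<close>, has type at least \<open>p' + 1\<close>. The drop is
  strict because the maximum is attained.\<close>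

lemma len_le_residual:
  fixes p :: "'e::wellorder multiset"
  assumes r: "wpo_on X r" and YX: "Y \<subseteq> X" and Y: "len_le r Y p" and x: "x \<in> Y"
  shows "\<exists>p'<p. len_le r {y \<in> Y. (x, y) \<notin> r} p'"
proof -
  let ?D = "{y \<in> Y. (x, y) \<notin> r}"
  have po: "refl_on X r" "trans r" "partial_order_on X r" using r by (auto simp: wpo_on_def order_on_defs)
  have D: "down_set r Y ?D" unfolding down_set_def using transD[OF po(2)] by blast
  have DY: "?D \<subseteq> Y" "?D \<subseteq> X" "Y - ?D \<subseteq> X" using YX by blast+
  obtain l where l: "lin_ext r ?D l" "\<And>l'. lin_ext r ?D l' \<Longrightarrow> l' \<le>o l"
    using max_lin_ext[OF r DY(2)] by blast
  have "l \<le>o below p" using len_le_subset[OF r YX DY(1) Y] l(1) unfolding len_le_def by blast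
  then obtain p' where p': "p' \<le> p" "l =o below p'" using ordLeq_below_imp_ordIso by blast
  have le: "len_le r ?D p'" unfolding len_le_def using l(2) ordLeq_ordIso_trans[OF _ p'(2)] by blast
  obtain m where m: "lin_ext r (Y - ?D) m" using lin_ext_exists[OF po(3) DY(3)] .
  let ?c = "rel_concat ?D l (Y - ?D) m"
  have c: "lin_ext r Y ?c" by (rule lin_ext_concat[OF D l(1) m])
  have "below {#bot_exp#} \<le>o m"
  proof (rule below_bot_ordLeq[OF lin_ext_Well_order[OF r DY(3) m]])
    show "x \<in> Field m" using lin_ext_Field[OF m] x po(1) YX by (auto simp: refl_on_def)
  qed
  then have "below (p' + {#bot_exp#}) \<le>o ?c"
    by (intro concat_ordLeq lin_ext_Well_order[OF r YX c] lin_ext_Field[OF l(1)] lin_ext_Field[OF m])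
      (auto intro: ordIso_imp_ordLeq[OF ordIso_symmetric[OF p'(2)]] bot_exp_le)
  also have "?c \<le>o below p" using Y c unfolding len_le_def by blast
  finally have "p' + {#bot_exp#} \<le> p" by simp
  moreover have "p' < p' + {#bot_exp#}" by simp
  ultimately have "p' < p" by (metis less_le_trans)
  then show ?thesis using le by blast
qed

text \<open>Take for \<open>A\<close> a minimal down set with an extension of type at least
  \<open>M\<close>. An extension of \<open>A\<close> longer than \<open>M\<close> would have an
  initial segment of type \<open>M\<close>, whose field is a smaller such down set. An extension of
  the complement longer than \<omega>^b, put after one of \<open>A\<close> of type at least
  \<open>M\<close>, would exceed the length of \<open>Y\<close>. If no down set qualifies,
  \<open>A = Y\<close> works.\<close>

lemma len_le_split:
  fixes M :: "'e::wellorder multiset"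
  assumes r: "wpo_on X r" and YX: "Y \<subseteq> X" and Y: "len_le r Y (M + {#b#})"
    and b: "\<And>e. e \<in># M \<Longrightarrow> b \<le> e"
  shows "\<exists>A\<subseteq>Y. len_le r A M \<and> len_le r (Y - A) {#b#}"
proof -
  define Q where "Q D \<longleftrightarrow> (\<exists>l. lin_ext r D l \<and> below M \<le>o l)" for D
  have WO: "Well_order l" if "Z \<subseteq> Y" "lin_ext r Z l" for Z l
    using lin_ext_Well_order[OF r] that YX by blast
  show ?thesis
  proof (cases "\<exists>D. down_set r Y D \<and> Q D")
    case False
    have "down_set r Y Y" by (simp add: down_set_def)
    then have nQ: "\<not> Q Y" using False by blast
    have "len_le r Y M" unfolding len_le_def
    proof (intro allI impI)
      fix l assume l: "lin_ext r Y l"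
      then have "\<not> below M \<le>o l" using nQ unfolding Q_def by blast
      then obtain p' where "p' < M" "l =o below p'" using wellorder_neq_below WO[OF subset_refl l] by blast
      then show "l \<le>o below M"
        by (meson below_mono less_imp_le ordIso_ordLeq_trans)
    qed
    moreover have "len_le r (Y - Y) {#b#}" unfolding len_le_def
    proof (intro allI impI)
      fix l assume l: "lin_ext r (Y - Y) l"
      have "l = {}" using l unfolding lin_ext_iff order_on_defs by blast
      then show "l \<le>o below {#b#}" by (simp add: ordLeq_below_iff)
    qed
    ultimately show ?thesis by blast
  next
    case True
    then obtain D where D: "down_set r Y D" "Q D" by blast
    obtain A where A: "down_set r Y A" "Q A" "\<And>A'. down_set r Y A' \<Longrightarrow> A' \<subset> A \<Longrightarrow> \<not> Q A'"
      using minimal_down_set[of X r Y D Q, OF r YX D] by blast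
    have AY: "A \<subseteq> Y" "Y - A \<subseteq> Y" using A(1) by (auto simp: down_set_def)
    have "len_le r A M" unfolding len_le_def
    proof (intro allI impI, rule ccontr)
      fix l assume l: "lin_ext r A l" and n: "\<not> l \<le>o below M"
      have Wl: "Well_order l" using WO[OF AY(1) l] .
      then have "below M <o l" using n not_ordLeq_iff_ordLess Well_order_below by blast
      then obtain x where x: "x \<in> Field l" "below M =o Restr l (underS l x)"
        using ordLess_iff_ordIso_Restr[OF Wl Well_order_below] by blast
      have lA: "l \<subseteq> A \<times> A" "trans l" "antisym l" using l unfolding lin_ext_iff order_on_defs by blast+
      let ?D = "underS l x"
      have DA: "?D \<subset> A" using lA(1) x(1) lin_ext_Field[OF l] by (auto simp: underS_def)
      have "down_set r Y ?D" unfolding down_set_def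
      proof (intro conjI allI impI)
        show "?D \<subseteq> Y" using DA AY by blast
        fix u v assume uv: "(u, v) \<in> r \<and> u \<in> Y \<and> v \<in> ?D"
        have v: "v \<in> A" using uv DA by blast
        then have u: "u \<in> A" using uv A(1) unfolding down_set_def by blast
        have "(u, v) \<in> l" using l uv u v unfolding lin_ext_iff by blast
        then show "u \<in> ?D" using uv transD[OF lA(2)] antisymD[OF lA(3)] unfolding underS_def by blast
      qed
      moreover have "lin_ext r ?D (Restr l ?D)" using lin_ext_subset[OF l] DA by blast
      then have "Q ?D" unfolding Q_def using x(2) ordIso_imp_ordLeq by blast
      ultimately show False using A(3) DA by blast
    qed
    moreover have "len_le r (Y - A) {#b#}" unfolding len_le_def
    proof (intro allI impI, rule ccontr)
      fix m assume m: "lin_ext r (Y - A) m" and n: "\<not> m \<le>o below {#b#}"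
      obtain l where l: "lin_ext r A l" "below M \<le>o l" using A(2) unfolding Q_def by blast
      have Wm: "Well_order m" using WO[OF AY(2) m] .
      have bm: "below ({#b#} + {#bot_exp#}) \<le>o m"
      proof (rule ccontr)
        assume "\<not> ?thesis"
        then obtain p' where p': "p' < {#b#} + {#bot_exp#}" "m =o below p'"
          using wellorder_neq_below[OF Wm] by blast
        then have "p' \<le> {#b#}" using mset_Suc_le[of "{#b#}" p'] by (meson leD leI)
        then have "m \<le>o below {#b#}" using p'(2) by (meson below_mono ordIso_ordLeq_trans)
        then show False using n by blast
      qed
      let ?c = "rel_concat A l (Y - A) m"
      have c: "lin_ext r Y ?c" by (rule lin_ext_concat[OF A(1) l(1) m])
      have "below (M + ({#b#} + {#bot_exp#})) \<le>o ?c"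
        by (intro concat_ordLeq WO[OF subset_refl c] lin_ext_Field[OF l(1)] lin_ext_Field[OF m] l(2) bm)
          (auto intro: b bot_exp_le)
      also have "?c \<le>o below (M + {#b#})" using Y c unfolding len_le_def by blast
      finally show False by simp
    qed
    ultimately show ?thesis using AY by blast
  qed
qed

section \<open>The upper bound\<close>

lemma ordLeq_empty: "{} \<le>o below p"
  by (simp add: ordLeq_below_iff)

lemma len_le_empty: "len_le r {} p"
proof -
  have "l = {}" if "lin_ext r {} l" for l using that unfolding lin_ext_iff order_on_defs by blast
  then show ?thesis unfolding len_le_def using ordLeq_empty by blast
qed

lemma len_le_0_empty:
  assumes r: "wpo_on X r" and "Y \<subseteq> X" and Y: "len_le r Y ({#} :: 'e::wellorder multiset)"
  shows "Y = {}"
proof -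
  have "partial_order_on X r" using r by (simp add: wpo_on_def)
  from lin_ext_exists[OF this \<open>Y \<subseteq> X\<close>] obtain l where l: "lin_ext r Y l" .
  then have "l \<le>o below ({#} :: 'e multiset)" using Y unfolding len_le_def by blast
  then show ?thesis
    unfolding ordLeq_below_iff[OF lin_ext_Well_order[OF r \<open>Y \<subseteq> X\<close> l]] lin_ext_Field[OF l] by auto
qed

lemma ordLeq_below_Union:
  fixes p :: "'i \<Rightarrow> 'e::wellorder multiset"
  assumes l: "Well_order l" and I: "finite I" and p: "\<And>i. i \<in> I \<Longrightarrow> Restr l (Y i) \<le>o below (p i)"
  shows "Restr l (\<Union>i\<in>I. Y i) \<le>o below (\<Sum>i\<in>I. p i)"
  using I p
proof (induction I)
  case empty then show ?case by (simp add: ordLeq_empty)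
next
  case (insert i I)
  let ?U = "\<Union>j\<in>insert i I. Y j"
  have "Restr (Restr l ?U) (Y i) = Restr l (Y i)" by blast
  moreover have "Restr (Restr l ?U) (\<Union>j\<in>I. Y j) = Restr l (\<Union>j\<in>I. Y j)" by blast
  ultimately have "Restr l ?U \<le>o below (p i + (\<Sum>j\<in>I. p j))"
    using insert Well_order_Field_Restr[OF l]
    by (intro ordLeq_below_Un[OF Well_order_Restr[OF l], of _ "Y i" "\<Union>j\<in>I. Y j"]) auto
  then show ?case using insert.hyps by simp
qed

lemma image_mset_ge:
  fixes p :: "'e::linorder multiset"
  assumes "\<And>e. e \<le> g e" shows "p \<le> image_mset g p"
  by (induction p) (simp_all add: add_mset_le_le_le assms)

text \<open>The laws of the Hessenberg sum of exponents on which the upper bound rests.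
  \<open>E\<close> is an initial segment where the sum is meaningful: later it is the whole exponent
  type or, over a finite type, just the least exponent.\<close>

locale exponents =
  fixes E :: "'t::wellorder set" and esum :: "'t \<Rightarrow> 't \<Rightarrow> 't"
  assumes bot_E: "bot_exp \<in> E"
    and down_E: "x < y \<Longrightarrow> y \<in> E \<Longrightarrow> x \<in> E"
    and esum_E: "x \<in> E \<Longrightarrow> y \<in> E \<Longrightarrow> esum x y \<in> E"
    and esum_mono1: "x < x' \<Longrightarrow> x' \<in> E \<Longrightarrow> y \<in> E \<Longrightarrow> esum x y < esum x' y"
    and esum_mono2: "y < y' \<Longrightarrow> x \<in> E \<Longrightarrow> y' \<in> E \<Longrightarrow> esum x y < esum x y'"
begin

definition mmult :: "'t multiset \<Rightarrow> 't multiset \<Rightarrow> 't multiset" where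
  "mmult A B = (\<Sum>x\<in>#A. image_mset (esum x) B)"

primrec mprod :: "(nat \<Rightarrow> 't multiset) \<Rightarrow> nat \<Rightarrow> 't multiset" where
  "mprod Q 0 = {#bot_exp#}"
| "mprod Q (Suc n) = mmult (mprod Q n) (Q (Suc n))"

primrec bsum :: "(nat \<Rightarrow> 't) \<Rightarrow> nat \<Rightarrow> 't" where
  "bsum b 0 = bot_exp"
| "bsum b (Suc n) = esum (bsum b n) (b (Suc n))"

lemma mmult_add: "mmult (A + A') B = mmult A B + mmult A' B" "mmult A (B + B') = mmult A B + mmult A B'"
  unfolding mmult_def by (simp_all add: sum_mset.distrib)

lemma mmult_empty [simp]: "mmult {#} B = {#}" "mmult A {#} = {#}"
  unfolding mmult_def by simp_all

lemma mmult_single [simp]: "mmult {#x#} {#y#} = {#esum x y#}"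
  unfolding mmult_def by simp

lemma mmult_E: "set_mset A \<subseteq> E \<Longrightarrow> set_mset B \<subseteq> E \<Longrightarrow> set_mset (mmult A B) \<subseteq> E"
  unfolding mmult_def using esum_E by auto

lemma mprod_E: "(\<And>i. i \<in> {1..n} \<Longrightarrow> set_mset (Q i) \<subseteq> E) \<Longrightarrow> set_mset (mprod Q n) \<subseteq> E"
proof (induction n)
  case (Suc n)
  then have "set_mset (mprod Q n) \<subseteq> E" "set_mset (Q (Suc n)) \<subseteq> E" by simp_all
  then show ?case using mmult_E by simp
qed (simp add: bot_E)

lemma mprod_cong: "(\<And>i. i \<in> {1..n} \<Longrightarrow> Q i = Q' i) \<Longrightarrow> mprod Q n = mprod Q' n"
  by (induction n) auto

lemma mprod_single: "mprod (\<lambda>i. {#b i#}) n = {#bsum b n#}"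
  by (induction n) auto

lemma mprod_split:
  assumes "i \<in> {1..n}" "Q i = A + B"
  shows "mprod Q n = mprod (Q(i := A)) n + mprod (Q(i := B)) n"
  using assms
proof (induction n)
  case (Suc n)
  show ?case
  proof (cases "i = Suc n")
    case True
    have "mprod (Q(i := A)) n = mprod Q n" "mprod (Q(i := B)) n = mprod Q n"
      using True by (auto intro!: mprod_cong)
    then show ?thesis using Suc True by (simp add: mmult_add fun_upd_def)
  next
    case False
    then have i: "i \<in> {1..n}" using Suc.prems(1) by auto
    have "(Q(i := A)) (Suc n) = Q (Suc n)" "(Q(i := B)) (Suc n) = Q (Suc n)" using False by auto
    then show ?thesis unfolding mprod.simps Suc.IH[OF i Suc.prems(2)] by (simp only: mmult_add)
  qed
qed simp

lemma bsum_E: "(\<And>i. i \<in> {1..n} \<Longrightarrow> b i \<in> E) \<Longrightarrow> bsum b n \<in> E"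
  by (induction n) (auto simp: bot_E esum_E)

lemma bsum_cong: "(\<And>i. i \<in> {1..n} \<Longrightarrow> b i = b' i) \<Longrightarrow> bsum b n = bsum b' n"
  by (induction n) auto

text \<open>Makes \<open>bsum b n\<close> a measure for induction when a single exponent is
  lowered.\<close>

lemma bsum_mono:
  assumes "\<And>j. j \<in> {1..n} \<Longrightarrow> b j \<in> E" "i \<in> {1..n}" "c < b i"
  shows "bsum (b(i := c)) n < bsum b n"
  using assms
proof (induction n)
  case (Suc n)
  have E: "bsum b n \<in> E" by (rule bsum_E) (use Suc.prems in auto)
  show ?case
  proof (cases "i = Suc n")
    case True
    have "bsum (b(i := c)) n = bsum b n" using True by (auto intro!: bsum_cong)
    then show ?thesis using esum_mono2[OF _ E, of c "b (Suc n)"] Suc.prems True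
      by (simp add: fun_upd_def)
  next
    case False
    then have i: "i \<in> {1..n}" using Suc.prems(2) by auto
    have "bsum (b(i := c)) n < bsum b n"
      by (rule Suc.IH[OF _ i Suc.prems(3)]) (use Suc.prems(1) in auto)
    moreover have "(b(i := c)) (Suc n) = b (Suc n)" using False by auto
    moreover have "b (Suc n) \<in> E" using Suc.prems(1) by auto
    ultimately show ?thesis unfolding bsum.simps using esum_mono1[OF _ E] by simp
  qed
qed simp

end

text \<open>
  The map \<open>t\<close> shifts exponents, so that \<open>image_mset t M\<close> is the product of \<open>below {#t bot_exp#}\<close>
  and \<open>M\<close>.
\<close>

locale scaled_exponents = exponents E esum
  for E :: "'t::wellorder set" and esum :: "'t \<Rightarrow> 't \<Rightarrow> 't" +
  fixes t :: "'t \<Rightarrow> 'o::wellorder"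
  assumes t_mono: "x < y \<Longrightarrow> t x < t y"
    and t_convex: "t bot_exp \<le> e \<Longrightarrow> e < t c \<Longrightarrow> e \<in> range t"
    and card: "Card_order (below {#t bot_exp#})"
begin

lemma t_less_iff [simp]: "t x < t y \<longleftrightarrow> x < y"
  using t_mono by (metis linorder_neq_iff order.asym)

lemma t_le_iff [simp]: "t x \<le> t y \<longleftrightarrow> x \<le> y"
  by (simp flip: not_less)

text \<open>\<open>Y\<close> is cut, last term first, into sets whose length for \<open>r\<close> is
  at most a single power \<omega>^(t c), and their contributions to \<open>l\<close> are added up.
  The order \<open>l\<close> need not extend \<open>r\<close>; only the cutting concerns
  \<open>r\<close>.\<close>

lemma bsum_pieces:
  fixes r :: "'a rel" and g :: "'t \<Rightarrow> 'o multiset"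
  assumes r: "wpo_on X r" and l: "Well_order l"
    and piece: "\<And>Z c. Z \<subseteq> Y \<Longrightarrow> c \<in># N \<Longrightarrow> len_le r Z {#t c#} \<Longrightarrow> Restr l Z \<le>o below (g c)"
    and YX: "Y \<subseteq> X" and Y: "len_le r Y (image_mset t N)"
  shows "Restr l Y \<le>o below (\<Sum>c\<in>#N. g c)"
  using piece YX Y
proof (induction "size N" arbitrary: N Y)
  case 0
  then have "N = {#}" by simp
  moreover from this have "Y = {}" using len_le_0_empty[OF r 0(3)] 0(4) by simp
  ultimately show ?case by (simp add: ordLeq_empty)
next
  case (Suc k)
  then have "N \<noteq> {#}" by auto
  then obtain M c where N: "N = add_mset c M" "\<And>e. e \<in># M \<Longrightarrow> c \<le> e" using mset_split_min by metis
  have "len_le r Y (image_mset t M + {#t c#})" using Suc.prems(3) N(1) by simp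
  moreover have "t c \<le> e" if "e \<in># image_mset t M" for e using that N(2) by auto
  ultimately obtain A where A: "A \<subseteq> Y" "len_le r A (image_mset t M)" "len_le r (Y - A) {#t c#}"
    using len_le_split[OF r Suc.prems(2)] by blast
  have "Restr l A \<le>o below (\<Sum>c\<in>#M. g c)"
  proof (rule Suc.hyps(1))
    show "k = size M" using Suc.hyps(2) N(1) by simp
    show "Restr l Z \<le>o below (g d)" if "Z \<subseteq> A" "d \<in># M" "len_le r Z {#t d#}" for Z d
      using Suc.prems(1)[of Z d] that A(1) N(1) by auto
  qed (use A Suc.prems in auto)
  moreover have "Restr l (Y - A) \<le>o below (g c)"
    using Suc.prems(1)[of "Y - A" c] A(3) N(1) by auto
  moreover have "Restr (Restr l Y) A = Restr l A" "Restr (Restr l Y) (Y - A) = Restr l (Y - A)"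
    using A(1) by blast+
  ultimately have "Restr l Y \<le>o below ((\<Sum>c\<in>#M. g c) + g c)"
    using Well_order_Field_Restr[OF l]
    by (intro ordLeq_below_Un[OF Well_order_Restr[OF l], of _ A "Y - A"]) auto
  then show ?case using N(1) by (simp add: add.commute)
qed

lemma len_le_INT_single:
  fixes r :: "nat \<Rightarrow> 'a rel"
  assumes n: "n \<ge> 1" and r: "\<And>i. i \<in> {1..n} \<Longrightarrow> wpo_on X (r i)"
    and YX: "Y \<subseteq> X"
    and b: "\<And>i. i \<in> {1..n} \<Longrightarrow> b i \<in> E" "\<And>i. i \<in> {1..n} \<Longrightarrow> len_le (r i) Y {#t (b i)#}"
  shows "len_le (\<Inter>i\<in>{1..n}. r i) Y {#t (bsum b n)#}"
  using b YX
proof (induction "bsum b n" arbitrary: b Y rule: less_induct)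
  case less
  let ?R = "\<Inter>i\<in>{1..n}. r i"
  let ?s = "bsum b n"
  have wpoR: "wpo_on X ?R" using r n by (intro wpo_INT) auto
  show ?case unfolding len_le_def
  proof (intro allI impI)
    fix l assume l: "lin_ext ?R Y l"
    have Wl: "Well_order l" by (rule lin_ext_Well_order[OF wpoR less.prems(3) l])
    have lY: "l \<subseteq> Y \<times> Y" "antisym l" using l unfolding lin_ext_iff order_on_defs by blast+
    show "l \<le>o below {#t ?s#}"
    proof (rule ordLeq_below_by_segments[OF Wl])
      fix x assume "x \<in> Field l"
      then have x: "x \<in> Y" using lin_ext_Field[OF l] by blast
      define Z where "Z i = {y \<in> Y. (x, y) \<notin> r i}" for i
      have ZY: "Z i \<subseteq> Y" "Z i \<subseteq> X" for i using less.prems(3) unfolding Z_def by blast+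
      have "\<exists>p<{#t ?s#}. Restr l (Z i) \<le>o below p" if i: "i \<in> {1..n}" for i
      proof -
        obtain p' where p': "p' < {#t (b i)#}" "len_le (r i) (Z i) p'"
          using len_le_residual[OF r[OF i] less.prems(3) less.prems(2)[OF i] x] unfolding Z_def by blast
        have WlZ: "Well_order (Restr l (Z i))" by (rule Well_order_Restr[OF Wl])
        have FlZ: "Field (Restr l (Z i)) = Z i"
          using Well_order_Field_Restr[OF Wl] lin_ext_Field[OF l] ZY(1)[of i] by auto
        show ?thesis
        proof (cases "b i = bot_exp")
          \<comment> \<open>Since \<open>l\<close> does not extend \<open>r i\<close>, the length
            for \<open>r i\<close> does not bound its type directly. But it bounds the cardinality
            of \<open>Z i\<close> strictly below the cardinal \<open>below {#t bot_exp#}\<close>,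
            and a well-order on so few elements is shorter than that cardinal.\<close>
          case True
          have "partial_order_on X (r i)" using r[OF i] by (simp add: wpo_on_def)
          from lin_ext_exists[OF this ZY(2)] obtain m where m: "lin_ext (r i) (Z i) m" .
          have "well_order_on (Z i) m"
            using lin_ext_Well_order[OF r[OF i] ZY(2) m] lin_ext_Field[OF m] by simp
          then have "|Z i| \<le>o m" by (rule card_of_least)
          also have "m \<le>o below p'" using p'(2) m unfolding len_le_def by blast
          also have "below p' <o below {#t bot_exp#}" using p'(1) True by simp
          finally have Zs: "|Z i| <o below {#t bot_exp#}" .
          have "\<not> below {#t bot_exp#} \<le>o Restr l (Z i)"
          proof
            assume "below {#t bot_exp#} \<le>o Restr l (Z i)"
            then have "|Field (below {#t bot_exp#})| \<le>o |Z i|" using card_of_mono2 FlZ by metis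
            moreover have "below {#t bot_exp#} =o |Field (below {#t bot_exp#})|"
              using card_of_Field_ordIso[OF card] ordIso_symmetric by blast
            ultimately have "below {#t bot_exp#} \<le>o |Z i|" by (rule ordIso_ordLeq_trans[rotated])
            then show False using Zs not_ordLess_ordLeq by blast
          qed
          then obtain p where p: "p < {#t bot_exp#}" "Restr l (Z i) =o below p"
            using wellorder_neq_below[OF WlZ] by blast
          have "{#t bot_exp#} \<le> {#t ?s#}" by (simp only: mset_le_single_iff t_le_iff bot_exp_le)
          then have "p < {#t ?s#}" using p(1) by (rule less_le_trans[rotated])
          then show ?thesis using p(2) ordIso_imp_ordLeq by blast
        next
          case False
          then have bi: "bot_exp < b i" using bot_exp_le[of "b i"] by simp
          \<comment> \<open>Rounding up to a multiple of the cardinal: exponents below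
            \<open>t bot_exp\<close> are raised to it, the others up to \<open>t (b i)\<close> are
            already values of \<open>t\<close>. Everything stays below \<open>b i\<close> because
            \<open>b i\<close> is not the least exponent.\<close>
          define cv where "cv e = (if e < t bot_exp then bot_exp else inv t e)" for e
          have "cv e < b i \<and> e \<le> t (cv e)" if "e < t (b i)" for e
          proof (cases "e < t bot_exp")
            case True then show ?thesis using bi by (simp add: cv_def)
          next
            case False
            then have "e \<in> range t" using t_convex that by simp
            then have "t (inv t e) = e" by (rule f_inv_into_f)
            then show ?thesis using False that t_less_iff[of "inv t e" "b i"] by (simp add: cv_def)
          qed
          note cv = this
          define N where "N = image_mset cv p'"
          have N: "c < b i" if "c \<in># N" for c using that p'(1) cv unfolding N_def by auto
          have "p' \<le> image_mset t N"
          proof -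
            \<comment> \<open>The identity from \<open>t (b i)\<close> on, so that \<open>g\<close>
              is inflationary everywhere, as \<open>image_mset_ge\<close> demands.\<close>
            define g where "g e = (if e < t (b i) then t (cv e) else e)" for e
            have "image_mset t N = image_mset (t \<circ> cv) p'"
              unfolding N_def by (simp add: image_mset.compositionality)
            also have "\<dots> = image_mset g p'"
              by (rule image_mset_cong) (use p'(1) in \<open>auto simp: g_def\<close>)
            finally have "image_mset t N = image_mset g p'" .
            moreover have "e \<le> g e" for e using cv unfolding g_def by auto
            ultimately show ?thesis using image_mset_ge[of g p'] by simp
          qed
          then have "below p' \<le>o below (image_mset t N)" by simp
          then have leN: "len_le (r i) (Z i) (image_mset t N)"
            using p'(2) ordLeq_transitive unfolding len_le_def by blast
          define g where "g c = {#t (bsum (b(i := c)) n)#}" for c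
          have mono: "bsum (b(i := c)) n < ?s" if "c \<in># N" for c
            using bsum_mono[of n b i c, OF less.prems(1) i N[OF that]] by blast
          have "Restr l (Z i) \<le>o below (\<Sum>c\<in>#N. g c)"
          proof (rule bsum_pieces[OF r[OF i] Wl _ ZY(2) leN])
            fix V c assume V: "V \<subseteq> Z i" "c \<in># N" "len_le (r i) V {#t c#}"
            have VY: "V \<subseteq> Y" "V \<subseteq> X" using V(1) ZY[of i] by blast+
            \<comment> \<open>On the piece \<open>V\<close> the \<open>i\<close>-th exponent drops
              to \<open>c\<close> while the other orderings keep theirs by restriction, so the sum
              of the exponents is smaller.\<close>
            have "len_le ?R V {#t (bsum (b(i := c)) n)#}"
            proof (rule less.hyps[OF mono[OF V(2)] _ _ VY(2)])
              fix j assume j: "j \<in> {1..n}"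
              show "(b(i := c)) j \<in> E"
                using less.prems(1)[OF j] less.prems(1)[OF i] down_E[OF N[OF V(2)]] by auto
              show "len_le (r j) V {#t ((b(i := c)) j)#}"
                using V(3) len_le_subset[OF r[OF j] less.prems(3) VY(1) less.prems(2)[OF j]] by auto
            qed
            moreover have "lin_ext ?R V (Restr l V)" by (rule lin_ext_subset[OF l VY(1)])
            ultimately show "Restr l V \<le>o below (g c)" unfolding g_def len_le_def by blast
          qed
          moreover have "(\<Sum>c\<in>#N. g c) < {#t ?s#}"
            by (rule sum_mset_less_single) (use mono in \<open>simp add: g_def\<close>)
          ultimately show ?thesis by blast
        qed
      qed
      then have "\<forall>i\<in>{1..n}. \<exists>p. p < {#t ?s#} \<and> Restr l (Z i) \<le>o below p" by blast
      from bchoice[OF this] obtain p where p: "\<forall>i\<in>{1..n}. p i < {#t ?s#} \<and> Restr l (Z i) \<le>o below (p i)" by blast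
      have "underS l x \<subseteq> (\<Union>i\<in>{1..n}. Z i)"
      proof
        fix y assume y: "y \<in> underS l x"
        then have yx: "y \<in> Y" "(y, x) \<in> l" "y \<noteq> x" using lY by (auto simp: underS_def)
        then have "(x, y) \<notin> l" using antisymD[OF lY(2)] by blast
        then have "(x, y) \<notin> ?R" using l x yx(1) unfolding lin_ext_iff by blast
        then show "y \<in> (\<Union>i\<in>{1..n}. Z i)" using yx(1) unfolding Z_def by blast
      qed
      then have "Restr l (underS l x) \<le>o Restr l (\<Union>i\<in>{1..n}. Z i)" by (rule Restr_mono_ordLeq[OF Wl])
      also have "Restr l (\<Union>i\<in>{1..n}. Z i) \<le>o below (\<Sum>i\<in>{1..n}. p i)"
        using p by (intro ordLeq_below_Union[OF Wl]) auto
      finally have 1: "Restr l (underS l x) \<le>o below (\<Sum>i\<in>{1..n}. p i)" .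
      have "(\<Sum>i\<in>{1..n}. p i) < {#t ?s#}"
      proof -
        have "(\<Sum>i\<in>I. p i) < {#t ?s#}" if "I \<subseteq> {1..n}" for I
          using finite_subset[OF that finite_atLeastAtMost] that
        proof (induction I)
          case (insert i I)
          then have "p i < {#t ?s#}" "(\<Sum>i\<in>I. p i) < {#t ?s#}" using p by auto
          then show ?case using insert.hyps by auto
        qed simp
        then show ?thesis by blast
      qed
      then show "\<exists>p'<{#t ?s#}. Restr l (underS l x) \<le>o below p'" using 1 by blast
    qed
  qed
qed

text \<open>The total number of terms decreases when the last term of one length is split off. A
  length 0 forces \<open>Y\<close> to be empty, and one term in every ordering is the case of
  \<open>len_le_INT_single\<close>.\<close>

theorem len_le_INT:
  fixes r :: "nat \<Rightarrow> 'a rel"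
  assumes n: "n \<ge> 1" and r: "\<And>i. i \<in> {1..n} \<Longrightarrow> wpo_on X (r i)"
    and YX: "Y \<subseteq> X"
    and Q: "\<And>i. i \<in> {1..n} \<Longrightarrow> set_mset (Q i) \<subseteq> E"
      "\<And>i. i \<in> {1..n} \<Longrightarrow> len_le (r i) Y (image_mset t (Q i))"
  shows "len_le (\<Inter>i\<in>{1..n}. r i) Y (image_mset t (mprod Q n))"
  using Q YX
proof (induction "\<Sum>i\<in>{1..n}. size (Q i)" arbitrary: Q Y rule: less_induct)
  case less
  let ?R = "\<Inter>i\<in>{1..n}. r i"
  have wpoR: "wpo_on X ?R" using r n by (intro wpo_INT) auto
  consider (empty) i where "i \<in> {1..n}" "Q i = {#}" | (single) "\<And>i. i \<in> {1..n} \<Longrightarrow> size (Q i) = 1"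
    | (big) i where "i \<in> {1..n}" "size (Q i) > 1"
    by (metis less_one linorder_neqE_nat size_eq_0_iff_empty)
  then show ?case
  proof cases
    case empty
    then have "Y = {}" using len_le_0_empty[OF r[OF empty(1)] less.prems(3)] less.prems(2)[OF empty(1)] by simp
    then show ?thesis by (simp add: len_le_empty)
  next
    case single
    then have "\<forall>i\<in>{1..n}. \<exists>b. Q i = {#b#}" by (simp add: size_1_singleton_mset)
    from bchoice[OF this] obtain b where b: "\<forall>i\<in>{1..n}. Q i = {#b i#}" by blast
    have "mprod Q n = {#bsum b n#}" using mprod_cong[of n Q "\<lambda>i. {#b i#}"] b mprod_single by auto
    moreover have "len_le ?R Y {#t (bsum b n)#}"
    proof (rule len_le_INT_single[OF n r less.prems(3)])
      show "b i \<in> E" if "i \<in> {1..n}" for i using less.prems(1)[OF that] b that by simp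
      show "len_le (r i) Y {#t (b i)#}" if "i \<in> {1..n}" for i using less.prems(2)[OF that] b that by simp
    qed
    ultimately show ?thesis by simp
  next
    case big
    then have "Q i \<noteq> {#}" by auto
    then obtain M c where N: "Q i = add_mset c M" "\<And>e. e \<in># M \<Longrightarrow> c \<le> e" using mset_split_min by metis
    have Msz: "size M \<ge> 1" using big(2) N(1) by simp
    have "len_le (r i) Y (image_mset t M + {#t c#})" using less.prems(2)[OF big(1)] N(1) by simp
    moreover have "t c \<le> e" if "e \<in># image_mset t M" for e using that N(2) by auto
    ultimately obtain A where A: "A \<subseteq> Y" "len_le (r i) A (image_mset t M)" "len_le (r i) (Y - A) {#t c#}"
      using len_le_split[OF r[OF big(1)] less.prems(3)] by blast
    have sub: "len_le ?R Z (image_mset t (mprod (Q(i := P)) n))"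
      if Z: "Z \<subseteq> Y" "len_le (r i) Z (image_mset t P)" and P: "set_mset P \<subseteq> set_mset (Q i)" "size P < size (Q i)" for Z P
    proof (rule less.hyps)
      show "(\<Sum>j\<in>{1..n}. size ((Q(i := P)) j)) < (\<Sum>j\<in>{1..n}. size (Q j))"
        by (rule sum_strict_mono_ex1) (use big(1) P(2) in auto)
      show "Z \<subseteq> X" using Z(1) less.prems(3) by blast
      fix j assume j: "j \<in> {1..n}"
      show "set_mset ((Q(i := P)) j) \<subseteq> E" using less.prems(1)[OF j] P(1) by auto
      show "len_le (r j) Z (image_mset t ((Q(i := P)) j))"
        using Z(2) len_le_subset[OF r[OF j] less.prems(3) Z(1) less.prems(2)[OF j]] by auto
    qed
    have 1: "len_le ?R A (image_mset t (mprod (Q(i := M)) n))"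
      by (rule sub[OF A(1,2)]) (use N in auto)
    have 2: "len_le ?R (Y - A) (image_mset t (mprod (Q(i := {#c#})) n))"
      by (rule sub) (use N A Msz in auto)
    show ?thesis unfolding len_le_def
    proof (intro allI impI)
      fix l assume l: "lin_ext ?R Y l"
      have Wl: "Well_order l" by (rule lin_ext_Well_order[OF wpoR less.prems(3) l])
      have "Restr l A \<le>o below (image_mset t (mprod (Q(i := M)) n))"
        using 1 lin_ext_subset[OF l A(1)] unfolding len_le_def by blast
      moreover have "Restr l (Y - A) \<le>o below (image_mset t (mprod (Q(i := {#c#})) n))"
        using 2 lin_ext_subset[OF l, of "Y - A"] unfolding len_le_def by blast
      ultimately have "l \<le>o below (image_mset t (mprod (Q(i := M)) n) + image_mset t (mprod (Q(i := {#c#})) n))"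
        using lin_ext_Field[OF l] by (intro ordLeq_below_Un[OF Wl, of A "Y - A"]) auto
      moreover have "mprod Q n = mprod (Q(i := M)) n + mprod (Q(i := {#c#})) n"
        by (rule mprod_split[OF big(1)]) (simp add: N(1))
      ultimately show "l \<le>o below (image_mset t (mprod Q n))" by simp
    qed
  qed
qed

end

section \<open>Linear extensions of products\<close>

definition len_ge :: "'a rel \<Rightarrow> 'a set \<Rightarrow> 'o::wellorder \<Rightarrow> bool" where
  "len_ge r Y p \<longleftrightarrow> (\<exists>l. lin_ext r Y l \<and> below p \<le>o l)"

text \<open>Because \<open>f\<close> reflects the orderings, the copy of \<open>l\<close> on the
  image of \<open>f\<close> respects \<open>s\<close>; it is then extended from the image to all of
  \<open>Y'\<close>.\<close>

lemma lin_ext_transport: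
  assumes r: "wpo_on X r" and s: "wpo_on X' s" and Y: "Y \<subseteq> X" "Y' \<subseteq> X'"
    and inj: "inj_on f Y" and fY: "f ` Y \<subseteq> Y'"
    and refl: "\<And>x y. x \<in> Y \<Longrightarrow> y \<in> Y \<Longrightarrow> (f x, f y) \<in> s \<Longrightarrow> (x, y) \<in> r"
    and l: "lin_ext r Y l"
  obtains l' where "lin_ext s Y' l'" "l \<le>o l'"
proof -
  have Wl: "Well_order l" and Fl: "Field l = Y"
    using lin_ext_Well_order[OF r Y(1) l] lin_ext_Field[OF l] .
  have inj': "inj_on f (Field l)" using inj unfolding Fl .
  have Fd: "Field (dir_image l f) = f ` Y" unfolding dir_image_Field Fl ..
  have "linear_order_on (f ` Y) (dir_image l f)"
    using Linear_order_dir_image[OF _ inj'] Wl unfolding well_order_on_def Fd by blast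
  moreover have "(f x, f y) \<in> dir_image l f" if "x \<in> Y" "y \<in> Y" "(f x, f y) \<in> s" for x y
    using that refl[OF that] l unfolding lin_ext_iff dir_image_def by blast
  ultimately have "lin_ext s (f ` Y) (dir_image l f)" unfolding lin_ext_iff by blast
  moreover have "partial_order_on X' s" using s by (simp add: wpo_on_def)
  ultimately obtain l' where l': "lin_ext s Y' l'" "Restr l' (f ` Y) = dir_image l f"
    using lin_ext_extend[OF _ Y(2) fY] by blast
  have "l =o Restr l' (f ` Y)" unfolding l'(2) by (rule dir_image_ordIso[OF Wl inj'])
  also have "Restr l' (f ` Y) \<le>o l'" by (rule Restr_ordLeq[OF lin_ext_Well_order[OF s Y(2) l'(1)]])
  finally show ?thesis using that l'(1) by blast
qed

lemma len_ge_transport: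
  assumes "wpo_on X r" "wpo_on X' s" "Y \<subseteq> X" "Y' \<subseteq> X'" "inj_on f Y" "f ` Y \<subseteq> Y'"
    and "\<And>x y. x \<in> Y \<Longrightarrow> y \<in> Y \<Longrightarrow> (f x, f y) \<in> s \<Longrightarrow> (x, y) \<in> r"
    and "len_ge r Y p"
  shows "len_ge s Y' p"
proof -
  obtain l where l: "lin_ext r Y l" "below p \<le>o l" using assms(8) unfolding len_ge_def by blast
  obtain l' where "lin_ext s Y' l'" "l \<le>o l'" using lin_ext_transport[OF assms(1-7) l(1)] .
  then show ?thesis unfolding len_ge_def using l(2) ordLeq_transitive by blast
qed

text \<open>The blocks are appended in the order of decreasing \<open>c\<close>, and of increasing \<open>w\<close> for equal \<open>c\<close>.\<close>

lemma len_ge_blocks: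
  fixes c :: "'i \<Rightarrow> 'e::wellorder" and w :: "'i \<Rightarrow> nat"
  assumes r: "wpo_on X r" and ZX: "Z \<subseteq> X" and S: "finite S"
    and \<beta>: "\<And>z. z \<in> Z \<Longrightarrow> \<beta> z \<in> S"
    and mono: "\<And>x y. x \<in> Z \<Longrightarrow> y \<in> Z \<Longrightarrow> (x, y) \<in> r \<Longrightarrow>
      \<beta> x = \<beta> y \<or> w (\<beta> x) < w (\<beta> y) \<and> c (\<beta> y) \<le> c (\<beta> x)"
    and block: "\<And>s. s \<in> S \<Longrightarrow> len_ge r {z \<in> Z. \<beta> z = s} {#c s#}"
  shows "len_ge r Z (\<Sum>s\<in>S. {#c s#})"
  using S ZX \<beta> mono block
proof (induction "card S" arbitrary: S Z)
  case 0
  then have "S = {}" by simp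
  moreover obtain l where l: "lin_ext r Z l"
    using lin_ext_exists[of X r Z] r 0(3) by (auto simp: wpo_on_def)
  moreover have "below {#} \<le>o l" unfolding below_ordLeq_iff[OF lin_ext_Well_order[OF r 0(3) l]] by simp
  ultimately show ?case unfolding len_ge_def by auto
next
  case (Suc n)
  \<comment> \<open>The block to be put last has the least exponent and, among those, the largest
    weight. By \<open>mono\<close> no element of another block lies above one of its elements, so
    the other blocks form a down set.\<close>
  define c0 where "c0 = Min (c ` S)"
  define S0 where "S0 = {s \<in> S. c s = c0}"
  define w0 where "w0 = Max (w ` S0)"
  have "S \<noteq> {}" using Suc.hyps(2) by auto
  then have "c0 \<in> c ` S" unfolding c0_def using Suc.prems(1) by (intro Min_in) auto
  then have "S0 \<noteq> {}" "finite S0" using Suc.prems(1) unfolding S0_def by auto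
  then have "w0 \<in> w ` S0" unfolding w0_def by (intro Max_in) auto
  then obtain s where s: "s \<in> S" "c s = c0" "w s = w0" unfolding S0_def by auto
  have min: "c s \<le> c s'" if "s' \<in> S" for s' using that s(2) Suc.prems(1) unfolding c0_def by simp
  have max: "w s' \<le> w s" if "s' \<in> S" "c s' \<le> c s" for s'
  proof -
    have "s' \<in> S0" using that min[OF that(1)] s(2) unfolding S0_def by simp
    then show ?thesis using s(3) \<open>finite S0\<close> unfolding w0_def by simp
  qed
  define Z' where "Z' = {z \<in> Z. \<beta> z \<noteq> s}"
  have Z': "Z' \<subseteq> Z" "Z - Z' = {z \<in> Z. \<beta> z = s}" unfolding Z'_def by blast+
  have down: "down_set r Z Z'" unfolding down_set_def
  proof (intro conjI Z'(1) allI impI, elim conjE)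
    fix x y assume xy: "(x, y) \<in> r" "x \<in> Z" "y \<in> Z'"
    have y: "y \<in> Z" "\<beta> y \<noteq> s" using xy(3) unfolding Z'_def by blast+
    have "\<beta> x \<noteq> s"
    proof
      assume "\<beta> x = s"
      then have "w s < w (\<beta> y)" "c (\<beta> y) \<le> c s" using Suc.prems(4)[OF xy(2) y(1) xy(1)] y(2) by auto
      moreover have "\<beta> y \<in> S" using Suc.prems(3) y(1) .
      ultimately show False using max[of "\<beta> y"] by simp
    qed
    then show "x \<in> Z'" using xy(2) unfolding Z'_def by blast
  qed
  have Z'X: "Z' \<subseteq> X" "Z - Z' \<subseteq> X" using Suc.prems(2) Z'(1) by blast+
  have "len_ge r Z' (\<Sum>s\<in>S - {s}. {#c s#})"
  proof (rule Suc.hyps(1))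
    show "n = card (S - {s})" using Suc.hyps(2) s(1) Suc.prems(1) by simp
    show "finite (S - {s})" using Suc.prems(1) by simp
    show "Z' \<subseteq> X" by (rule Z'X)
    show "\<beta> z \<in> S - {s}" if "z \<in> Z'" for z using that Suc.prems(3) unfolding Z'_def by blast
    show "\<beta> x = \<beta> y \<or> w (\<beta> x) < w (\<beta> y) \<and> c (\<beta> y) \<le> c (\<beta> x)"
      if "x \<in> Z'" "y \<in> Z'" "(x, y) \<in> r" for x y
      using Suc.prems(4)[of x y] that Z'(1) by blast
    show "len_ge r {z \<in> Z'. \<beta> z = s'} {#c s'#}" if "s' \<in> S - {s}" for s'
    proof -
      have "{z \<in> Z'. \<beta> z = s'} = {z \<in> Z. \<beta> z = s'}" using that unfolding Z'_def by blast
      then show ?thesis using Suc.prems(5)[of s'] that by simp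
    qed
  qed
  then obtain l where l: "lin_ext r Z' l" "below (\<Sum>s\<in>S - {s}. {#c s#}) \<le>o l" unfolding len_ge_def by blast
  obtain m where m: "lin_ext r (Z - Z') m" "below {#c s#} \<le>o m"
    using Suc.prems(5)[OF s(1)] unfolding len_ge_def Z'(2)[symmetric] by blast
  let ?c = "rel_concat Z' l (Z - Z') m"
  have ext: "lin_ext r Z ?c" by (rule lin_ext_concat[OF down l(1) m(1)])
  have "below ((\<Sum>s\<in>S - {s}. {#c s#}) + {#c s#}) \<le>o ?c"
  proof (rule concat_ordLeq[OF lin_ext_Well_order[OF r Suc.prems(2) ext] lin_ext_Field[OF l(1)] lin_ext_Field[OF m(1)] _ l(2) m(2)])
    show "Z' \<inter> (Z - Z') = {}" by blast
    fix d e assume "d \<in># {#c s#}" and e: "e \<in># (\<Sum>s\<in>S - {s}. {#c s#})"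
    then have "d = c s" by simp
    obtain s' where "s' \<in> S - {s}" "e = c s'"
      using e Suc.prems(1) by (auto simp: set_mset_sum)
    then show "d \<le> e" using min \<open>d = c s\<close> by simp
  qed
  moreover have "(\<Sum>s\<in>S. {#c s#}) = (\<Sum>s\<in>S - {s}. {#c s#}) + {#c s#}"
    using sum.remove[OF Suc.prems(1) s(1), of "\<lambda>s. {#c s#}"] by (simp add: add.commute)
  ultimately show ?case unfolding len_ge_def using ext by auto
qed

section \<open>Products of two ordinals\<close>

definition prod_le :: "('a::order \<times> 'b::order) rel" where
  "prod_le = {(p, q). fst p \<le> fst q \<and> snd p \<le> snd q}"

lemma wpo_on_well_order:
  assumes l: "well_order_on Y l" shows "wpo_on Y l"
proof (rule wpoI)
  have l1: "refl_on Y l" "total_on Y l" "wf (l - Id)" using l unfolding order_on_defs by blast+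
  show "partial_order_on Y l" using l unfolding well_order_on_def linear_order_on_def by blast
  fix f :: "nat \<Rightarrow> 'a" assume "range f \<subseteq> Y"
  then have fY: "f i \<in> Y" for i by blast
  show "\<exists>i j. i < j \<and> (f i, f j) \<in> l"
  proof (rule ccontr)
    assume n: "\<not> ?thesis"
    have "(f (Suc i), f i) \<in> l - Id" for i
    proof -
      have "(f i, f (Suc i)) \<notin> l" using n lessI by blast
      moreover from this have "f i \<noteq> f (Suc i)" using l1(1) fY[of i] by (auto simp: refl_on_def)
      ultimately show ?thesis using l1(2) fY[of i] fY[of "Suc i"] by (auto simp: total_on_def)
    qed
    then show False using l1(3) unfolding wf_iff_no_infinite_down_chain by blast
  qed
qed

lemma well_order_on_le: "well_order_on UNIV {(x, y). x \<le> (y :: 'a::wellorder)}"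
proof -
  have "{(x, y). x \<le> (y :: 'a)} - Id = {(x, y). x < y}" by auto
  then have "wf ({(x, y). x \<le> (y :: 'a)} - Id)" using wf by simp
  moreover have "linear_order_on UNIV {(x, y). x \<le> (y :: 'a)}"
    unfolding order_on_defs by (auto simp: refl_on_def trans_def antisym_def total_on_def)
  ultimately show ?thesis unfolding well_order_on_def by blast
qed

lemmas wpo_wellorder = wpo_on_well_order[OF well_order_on_le]

lemma wpo_on_product:
  assumes r: "wpo_on A r" and s: "wpo_on B s"
    and f: "\<And>x. x \<in> Z \<Longrightarrow> f x \<in> A" and g: "\<And>x. x \<in> Z \<Longrightarrow> g x \<in> B"
    and inj: "\<And>x y. x \<in> Z \<Longrightarrow> y \<in> Z \<Longrightarrow> f x = f y \<Longrightarrow> g x = g y \<Longrightarrow> x = y"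
  shows "wpo_on Z {(x, y) \<in> Z \<times> Z. (f x, f y) \<in> r \<and> (g x, g y) \<in> s}" (is "wpo_on Z ?R")
proof (rule wpoI)
  have r1: "refl_on A r" "trans r" "antisym r" and s1: "refl_on B s" "trans s" "antisym s"
    using r s by (auto simp: wpo_on_def order_on_defs)
  have "?R \<subseteq> Z \<times> Z" by blast
  moreover have "refl_on Z ?R" using r1(1) s1(1) f g by (auto simp: refl_on_def)
  moreover have "trans ?R"
  proof (rule transI)
    fix x y z assume "(x, y) \<in> ?R" "(y, z) \<in> ?R"
    then show "(x, z) \<in> ?R" using transD[OF r1(2), of "f x" "f y" "f z"] transD[OF s1(2), of "g x" "g y" "g z"]
      by simp
  qed
  moreover have "antisym ?R"
  proof (rule antisymI)
    fix x y assume "(x, y) \<in> ?R" "(y, x) \<in> ?R"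
    then show "x = y" using inj[of x y] antisymD[OF r1(3), of "f x" "f y"] antisymD[OF s1(3), of "g x" "g y"]
      by simp
  qed
  ultimately show "partial_order_on Z ?R" unfolding order_on_defs by blast
  fix h :: "nat \<Rightarrow> 'c" assume h: "range h \<subseteq> Z"
  then have hZ: "h i \<in> Z" for i by blast
  have "range (f \<circ> h) \<subseteq> A" using f hZ by auto
  from wpo_mono_subsequence[OF r this] obtain k :: "nat \<Rightarrow> nat" where k: "strict_mono k"
    "\<And>i j. i < j \<Longrightarrow> ((f \<circ> h) (k i), (f \<circ> h) (k j)) \<in> r" by blast
  have "range (g \<circ> h \<circ> k) \<subseteq> B" using g hZ by auto
  from wpo_good[OF s this] obtain i j where "i < j" "((g \<circ> h \<circ> k) i, (g \<circ> h \<circ> k) j) \<in> s" by blast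
  moreover have "k i < k j" using k(1) \<open>i < j\<close> by (simp add: strict_mono_def)
  ultimately have "k i < k j \<and> (h (k i), h (k j)) \<in> ?R" using k(2)[of i j] hZ by simp
  then show "\<exists>i j. i < j \<and> (h i, h j) \<in> ?R" by blast
qed

lemma wpo_prod_le: "wpo_on UNIV (prod_le :: ('a::wellorder \<times> 'b::wellorder) rel)"
proof -
  have eq: "prod_le = {(p, q) \<in> UNIV \<times> UNIV. (fst p, fst q) \<in> {(x, y). x \<le> (y :: 'a)}
    \<and> (snd p, snd q) \<in> {(x, y). x \<le> (y :: 'b)}}"
    by (auto simp: prod_le_def)
  show ?thesis
    unfolding eq by (rule wpo_on_product[OF wpo_wellorder wpo_wellorder]) (simp_all add: prod_eq_iff)
qed

text \<open>The index of the term of a normal form (a decreasing list of exponents) in which an ordinal lies.\<close>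

definition term_index :: "'e::wellorder list \<Rightarrow> 'e multiset \<Rightarrow> nat" where
  "term_index es x = (LEAST i. x < mset (take (Suc i) es))"

lemma term_index:
  assumes "x < mset es"
  shows "term_index es x < length es" "x < mset (take (Suc (term_index es x)) es)"
    "mset (take (term_index es x) es) \<le> x"
proof -
  have "es \<noteq> []" using assms by auto
  then have last: "x < mset (take (Suc (length es - 1)) es)" using assms by simp
  show "x < mset (take (Suc (term_index es x)) es)"
    unfolding term_index_def by (rule LeastI[of "\<lambda>i. x < mset (take (Suc i) es)", OF last])
  have "term_index es x \<le> length es - 1"
    unfolding term_index_def by (rule Least_le[of "\<lambda>i. x < mset (take (Suc i) es)", OF last])
  also have "\<dots> < length es" using \<open>es \<noteq> []\<close> by simp
  finally show "term_index es x < length es" .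
  show "mset (take (term_index es x) es) \<le> x"
  proof (cases "term_index es x")
    case (Suc i)
    then have "\<not> x < mset (take (Suc i) es)"
      using not_less_Least[of i "\<lambda>i. x < mset (take (Suc i) es)"] unfolding term_index_def by simp
    then show ?thesis using Suc by simp
  qed simp
qed

lemma term_index_mono:
  assumes "x \<le> y" "y < mset es" shows "term_index es x \<le> term_index es y"
  unfolding term_index_def[of es x]
  by (rule Least_le) (rule le_less_trans[OF assms(1) term_index(2)[OF assms(2)]])

lemma mset_take_mono: "i \<le> j \<Longrightarrow> mset (take i es) \<le> mset (take j es)"
  by (intro subset_eq_imp_le_multiset) (metis mset_subset_eq_add_left append_take_drop_id min.absorb1 mset_append take_take)

text \<open>Translates \<omega>^(es ! i) onto the interval that the term with index \<open>i\<close>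
  occupies in the ordinal.\<close>

lemma term_index_add:
  assumes "i < length es" "x < {#es ! i#}"
  shows "mset (take i es) + x < mset es" "term_index es (mset (take i es) + x) = i"
proof -
  have "mset (take i es) + x < mset (take i es) + {#es ! i#}" using assms(2) by (rule add_strict_left_mono)
  then have lt: "mset (take i es) + x < mset (take (Suc i) es)"
    using assms(1) by (simp add: take_Suc_conv_app_nth)
  also have "\<dots> \<le> mset (take (length es) es)" using assms(1) by (intro mset_take_mono) simp
  finally show "mset (take i es) + x < mset es" by simp
  show "term_index es (mset (take i es) + x) = i"
    unfolding term_index_def
  proof (rule Least_equality[where P = "\<lambda>j. mset (take i es) + x < mset (take (Suc j) es)", OF lt], rule ccontr)
    fix j assume j: "mset (take i es) + x < mset (take (Suc j) es)" "\<not> i \<le> j"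
    then have "mset (take (Suc j) es) \<le> mset (take i es)" by (intro mset_take_mono) simp
    also have "\<dots> \<le> mset (take i es) + x" by simp
    finally show False using j(1) by simp
  qed
qed

lemma mset_eq_sum_nth: "mset es = (\<Sum>i<length es. {#es ! i#})"
proof (induction es rule: rev_induct)
  case (snoc e es)
  have "(\<Sum>i<length es. {#(es @ [e]) ! i#}) = (\<Sum>i<length es. {#es ! i#})"
    by (intro sum.cong) (auto simp: nth_append)
  then show ?case using snoc by simp
qed simp

text \<open>Together with strict monotonicity, \<open>esum x y\<close> is hereby the least ordinal
  above all sums with one argument lowered, which determines the Hessenberg sum. Minimality serves
  the lower bound as strict monotonicity serves the upper one.\<close>

locale hessenberg_exponents = exponents +
  assumes esum_sup: "e < esum x y \<Longrightarrow> x \<in> E \<Longrightarrow> y \<in> E \<Longrightarrow>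
    (\<exists>x'<x. e \<le> esum x' y) \<or> (\<exists>y'<y. e \<le> esum x y')"
begin

lemma esum_mono:
  assumes "x \<le> x'" "y \<le> y'" "x' \<in> E" "y' \<in> E"
  shows "esum x y \<le> esum x' y'"
proof -
  have "x \<in> E" using down_E[of x x'] assms by (cases "x = x'") auto
  then have "esum x y \<le> esum x y'"
    using esum_mono2[of y y' x] assms by (cases "y = y'") (auto simp: less_le)
  also have "esum x y' \<le> esum x' y'"
    using esum_mono1[of x x' y'] assms by (cases "x = x'") (auto simp: less_le)
  finally show ?thesis .
qed

lemma mmult_sum:
  "finite I \<Longrightarrow> mmult (\<Sum>i\<in>I. f i) B = (\<Sum>i\<in>I. mmult (f i) B)"
  "finite I \<Longrightarrow> mmult A (\<Sum>i\<in>I. f i) = (\<Sum>i\<in>I. mmult A (f i))"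
  by (induction I rule: finite_induct) (simp_all add: mmult_add)

lemma mmult_mset:
  "mmult (mset as) (mset bs) = (\<Sum>(i, j)\<in>{..<length as} \<times> {..<length bs}. {#esum (as ! i) (bs ! j)#})"
proof -
  have "mmult (mset as) (mset bs) = (\<Sum>i<length as. \<Sum>j<length bs. {#esum (as ! i) (bs ! j)#})"
    unfolding mset_eq_sum_nth[of as] mset_eq_sum_nth[of bs] 
    by (simp add: mmult_sum) (rule sum.swap)
  then show ?thesis by (simp add: sum.cartesian_product)
qed

text \<open>The terms of the two normal forms cut the product into rectangles. Going up in the
  product increases both term indices weakly; so on entering another rectangle its exponent does not
  grow, while the sum of its indices, taken as weight, does.\<close>

lemma len_ge_prod_blocks:
  assumes sorted: "sorted_wrt (\<ge>) as" "sorted_wrt (\<ge>) bs"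
    and E: "set as \<subseteq> E" "set bs \<subseteq> E"
    and block: "\<And>a b. a \<in> set as \<Longrightarrow> b \<in> set bs \<Longrightarrow> len_ge prod_le ({..<{#a#}} \<times> {..<{#b#}}) {#esum a b#}"
  shows "len_ge prod_le ({..<mset as} \<times> {..<mset bs}) (mmult (mset as) (mset bs))"
proof -
  define \<beta> where "\<beta> p = (term_index as (fst p), term_index bs (snd p))" for p
  define c where "c s = esum (as ! fst s) (bs ! snd s)" for s
  define w :: "nat \<times> nat \<Rightarrow> nat" where "w s = fst s + snd s" for s
  let ?Z = "{..<mset as} \<times> {..<mset bs}"
  have desc: "es ! j \<le> es ! i" if "sorted_wrt (\<ge>) es" "i \<le> j" "j < length es" for es :: "'a list" and i j
    using that sorted_wrt_nth_less[OF that(1), of i j] by (cases "i = j") auto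
  have "len_ge prod_le ?Z (\<Sum>s\<in>{..<length as} \<times> {..<length bs}. {#c s#})"
  proof (rule len_ge_blocks[OF wpo_prod_le subset_UNIV, where \<beta> = \<beta> and w = w])
    show "\<beta> z \<in> {..<length as} \<times> {..<length bs}" if "z \<in> ?Z" for z
      using that term_index(1) by (auto simp: \<beta>_def)
  next
    fix p q assume pq: "p \<in> ?Z" "q \<in> ?Z" "(p, q) \<in> prod_le"
    let ?i = "term_index as (fst p)" and ?i' = "term_index as (fst q)"
    let ?j = "term_index bs (snd p)" and ?j' = "term_index bs (snd q)"
    have q: "fst q < mset as" "snd q < mset bs" using pq(2) by auto
    have le: "?i \<le> ?i'" "?j \<le> ?j'"
      using pq(3) term_index_mono[OF _ q(1)] term_index_mono[OF _ q(2)] by (auto simp: prod_le_def)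
    have lt: "?i' < length as" "?j' < length bs" using term_index(1) q by auto
    have "c (\<beta> q) \<le> c (\<beta> p)"
      unfolding c_def \<beta>_def fst_conv snd_conv
      using desc[OF sorted(1) le(1) lt(1)] desc[OF sorted(2) le(2) lt(2)] le lt E
      by (intro esum_mono) auto
    moreover have "\<beta> p = \<beta> q \<or> w (\<beta> p) < w (\<beta> q)"
      using le unfolding \<beta>_def w_def by auto
    ultimately show "\<beta> p = \<beta> q \<or> w (\<beta> p) < w (\<beta> q) \<and> c (\<beta> q) \<le> c (\<beta> p)" by blast
  next
    fix s assume "s \<in> {..<length as} \<times> {..<length bs}"
    then obtain i j where s: "s = (i, j)" "i < length as" "j < length bs" by auto
    define f where "f p = (mset (take i as) + fst p, mset (take j bs) + snd p)" for p
    show "len_ge prod_le {z \<in> ?Z. \<beta> z = s} {#c s#}"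
    proof (rule len_ge_transport[OF wpo_prod_le wpo_prod_le subset_UNIV subset_UNIV, where f = f])
      show "inj_on f ({..<{#as ! i#}} \<times> {..<{#bs ! j#}})"
        unfolding f_def inj_on_def by auto
      show "f ` ({..<{#as ! i#}} \<times> {..<{#bs ! j#}}) \<subseteq> {z \<in> ?Z. \<beta> z = s}"
      proof
        fix z assume "z \<in> f ` ({..<{#as ! i#}} \<times> {..<{#bs ! j#}})"
        then obtain x y where xy: "x < {#as ! i#}" "y < {#bs ! j#}" "z = f (x, y)" by blast
        then show "z \<in> {z \<in> ?Z. \<beta> z = s}"
          using term_index_add[OF s(2) xy(1)] term_index_add[OF s(3) xy(2)] by (simp add: f_def \<beta>_def s(1))
      qed
      show "(p, q) \<in> prod_le" if "(f p, f q) \<in> prod_le" for p q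
        using that unfolding f_def prod_le_def by simp
      show "len_ge prod_le ({..<{#as ! i#}} \<times> {..<{#bs ! j#}}) {#c s#}"
        unfolding c_def s(1) fst_conv snd_conv using s by (intro block) auto
    qed
  qed simp
  then show ?thesis unfolding mmult_mset c_def by (simp add: case_prod_beta)
qed

text \<open>For \<open>e\<close> below the sum, \<open>esum_sup\<close> gives, say,
  \<open>a' < a\<close> with \<open>e\<close> at most \<open>esum a' b\<close>. As \<omega>^a
  exceeds every finite multiple of \<omega>^a', the product contains any number \<open>m\<close> of
  rectangles for \<open>a'\<close> and \<open>b\<close>, and by induction its length is at least
  \<open>m\<close> copies of \<omega>^e.\<close>

lemma len_ge_prod_single:
  assumes "a \<in> E" "b \<in> E"
  shows "len_ge prod_le ({..<{#a#}} \<times> {..<{#b#}}) {#esum a b#}"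
  using assms
proof (induction "esum a b" arbitrary: a b rule: less_induct)
  case less
  let ?Y = "{..<{#a#}} \<times> {..<{#b#}}"
  have wpo: "wpo_on UNIV (prod_le :: ('a multiset \<times> 'a multiset) rel)" by (rule wpo_prod_le)
  obtain l where l: "lin_ext prod_le ?Y l" "\<And>l'. lin_ext prod_le ?Y l' \<Longrightarrow> l' \<le>o l"
    using max_lin_ext[OF wpo subset_UNIV, of ?Y] by blast
  have Wl: "Well_order l" by (rule lin_ext_Well_order[OF wpo subset_UNIV l(1)])
  have sub: "below p \<le>o l" if "len_ge prod_le Z p" "Z \<subseteq> ?Y" for Z and p :: "'a multiset"
  proof -
    have "len_ge prod_le ?Y p"
      by (rule len_ge_transport[OF wpo wpo subset_UNIV subset_UNIV inj_on_id[of Z] _ _ that(1)]) (use that(2) in auto)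
    then obtain l' where "lin_ext prod_le ?Y l'" "below p \<le>o l'" unfolding len_ge_def by blast
    then show ?thesis using l(2) ordLeq_transitive by blast
  qed
  have region: "below (mmult (mset as) (mset bs)) \<le>o l"
    if "sorted_wrt (\<ge>) as" "sorted_wrt (\<ge>) bs" "set as \<subseteq> E" "set bs \<subseteq> E" "mset as \<le> {#a#}" "mset bs \<le> {#b#}"
      "\<And>x y. x \<in> set as \<Longrightarrow> y \<in> set bs \<Longrightarrow> esum x y < esum a b" for as bs
  proof (rule sub)
    show "len_ge prod_le ({..<mset as} \<times> {..<mset bs}) (mmult (mset as) (mset bs))"
      by (rule len_ge_prod_blocks[OF that(1-4)]) (use less.hyps that(3,4,7) in blast)
    show "{..<mset as} \<times> {..<mset bs} \<subseteq> ?Y" using that(5,6) by (intro Sigma_mono) auto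
  qed
  have sorted: "sorted_wrt (\<ge>) (replicate m x)" for m and x :: 'a by (simp add: sorted_wrt_iff_nth_less)
  have repl: "mset (replicate m y) \<le> {#x#}" if "y < x" for m and x y :: 'a
    using that by (intro less_imp_le) (auto split: if_splits)
  have cofinal: "below (mset (replicate m e)) \<le>o l" if e: "e < esum a b" for m e
  proof -
    have mono: "below (mset (replicate m e)) \<le>o l"
      if "e \<le> d" "below (mset (replicate m d)) \<le>o l" for d
    proof -
      have "mset (replicate m e) \<le> mset (replicate m d)"
        using that(1) by (induction m) (auto intro: add_mset_le_le_le)
      then show ?thesis by (intro ordLeq_transitive[OF _ that(2)]) (simp only: below_le_iff)
    qed
    from esum_sup[OF e less.prems] show ?thesis
    proof (elim disjE exE conjE)
      fix a' assume a': "a' < a" "e \<le> esum a' b"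
      have "mmult (mset (replicate m a')) (mset [b]) = mset (replicate m (esum a' b))"
        unfolding mmult_def by (induction m) auto
      moreover have "below (mmult (mset (replicate m a')) (mset [b])) \<le>o l"
        by (rule region[OF sorted _ _ _ repl[OF a'(1)]])
          (use down_E[OF a'(1)] esum_mono1[OF a'(1)] less.prems in auto)
      ultimately show ?thesis using mono[OF a'(2)] by simp
    next
      fix b' assume b': "b' < b" "e \<le> esum a b'"
      have "mmult (mset [a]) (mset (replicate m b')) = mset (replicate m (esum a b'))"
        unfolding mmult_def by (induction m) auto
      moreover have "below (mmult (mset [a]) (mset (replicate m b'))) \<le>o l"
        by (rule region[OF _ sorted _ _ _ repl[OF b'(1)]])
          (use down_E[OF b'(1)] esum_mono2[OF b'(1)] less.prems in auto)
      ultimately show ?thesis using mono[OF b'(2)] by simp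
    qed
  qed
  have "below {#esum a b#} \<le>o l"
  proof (rule ccontr)
    assume "\<not> ?thesis"
    then obtain p where p: "p < {#esum a b#}" "l =o below p" using wellorder_neq_below[OF Wl] by blast
    show False
    proof (cases "p = {#}")
      case True
      have "({#}, {#}) \<in> Field l" using lin_ext_Field[OF l(1)] by simp
      then have "below {#bot_exp :: 'a#} \<le>o l" by (rule below_bot_ordLeq[OF Wl])
      then have "below {#bot_exp :: 'a#} \<le>o below p" using p(2) ordLeq_ordIso_trans by blast
      then show False using True by simp
    next
      case False
      \<comment> \<open>With \<open>e\<close> the largest exponent of \<open>p\<close>, the ordinal
        \<open>p\<close> is at most as many copies of \<omega>^e as it has terms;
        \<open>cofinal\<close> provides one copy more.\<close>
      define e where "e = Max_mset p"
      have "e \<in># p" unfolding e_def using False by (intro Max_in) auto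
      then have "e < esum a b" using p(1) by auto
      then have "below (mset (replicate (Suc (size p)) e)) \<le>o below p"
        using cofinal[of e "Suc (size p)"] p(2) ordLeq_ordIso_trans by blast
      then have "mset (replicate (Suc (size p)) e) \<le> p" by simp
      moreover have "p \<le> image_mset (\<lambda>_. e) p"
      proof -
        have "p \<le> image_mset (\<lambda>x. max x e) p" by (rule image_mset_ge) simp
        also have "image_mset (\<lambda>x. max x e) p = image_mset (\<lambda>_. e) p"
          by (rule image_mset_cong) (simp add: e_def)
        finally show ?thesis .
      qed
      moreover have "image_mset (\<lambda>_. e) p = mset (replicate (size p) e)" by (simp add: image_mset_const_eq)
      ultimately have "mset (replicate (Suc (size p)) e) \<le> mset (replicate (size p) e)" by (metis order_trans)
      then show False by simp
    qed
  qed
  then show ?case unfolding len_ge_def using l(1) by blast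
qed

theorem len_ge_prod:
  assumes "set_mset M \<subseteq> E" "set_mset N \<subseteq> E"
  shows "len_ge prod_le ({..<M} \<times> {..<N}) (mmult M N)"
proof -
  define as where "as = rev (sorted_list_of_multiset M)"
  define bs where "bs = rev (sorted_list_of_multiset N)"
  have m: "mset as = M" "mset bs = N" unfolding as_def bs_def by simp_all
  have "len_ge prod_le ({..<mset as} \<times> {..<mset bs}) (mmult (mset as) (mset bs))"
  proof (rule len_ge_prod_blocks)
    show "sorted_wrt (\<ge>) as" "sorted_wrt (\<ge>) bs"
      unfolding as_def bs_def sorted_wrt_rev by simp_all
    show "set as \<subseteq> E" "set bs \<subseteq> E" using assms m by (metis set_mset_mset)+
    then show "len_ge prod_le ({..<{#a#}} \<times> {..<{#b#}}) {#esum a b#}" if "a \<in> set as" "b \<in> set bs" for a b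
      using len_ge_prod_single that by blast
  qed
  then show ?thesis unfolding m .
qed

end

section \<open>Normal forms over a successor cardinal\<close>

text \<open>The criterion by which \<open>omega_power\<close> compares coefficient
  functions.\<close>

lemma mset_less_iff_max_diff:
  fixes M N :: "'e::linorder multiset"
  shows "M < N \<longleftrightarrow> (\<exists>e. count M e < count N e \<and> (\<forall>d>e. count M d = count N d))"
proof
  assume MN: "M < N"
  define D where "D = {e. count M e \<noteq> count N e}"
  have "D \<subseteq> set_mset M \<union> set_mset N"
  proof
    fix e assume "e \<in> D"
    then have "\<not> (e \<notin># M \<and> e \<notin># N)" unfolding D_def by (auto simp: not_in_iff)
    then show "e \<in> set_mset M \<union> set_mset N" by blast
  qed
  then have fin: "finite D" by (rule finite_subset) simp
  have "M \<noteq> N" using MN by simp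
  then have D: "finite D" "D \<noteq> {}" using fin unfolding D_def by (simp_all add: multiset_eq_iff)
  define e where "e = Max D"
  have e: "e \<in> D" "\<And>d. d \<in> D \<Longrightarrow> d \<le> e" unfolding e_def using D by auto
  have above: "count M d = count N d" if "d > e" for d using e(2)[of d] that unfolding D_def by force
  have "\<not> count N e < count M e"
  proof
    assume "count N e < count M e"
    then obtain x where "x > e" "count M x < count N x" using MN unfolding less_multiset\<^sub>H\<^sub>O by blast
    then show False using above by simp
  qed
  then show "\<exists>e. count M e < count N e \<and> (\<forall>d>e. count M d = count N d)"
    using e(1) above unfolding D_def by (intro exI[of _ e]) auto
next
  assume "\<exists>e. count M e < count N e \<and> (\<forall>d>e. count M d = count N d)"
  then obtain e where e: "count M e < count N e" "\<And>d. d > e \<Longrightarrow> count M d = count N d" by blast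
  have "\<exists>x>y. count M x < count N x" if "count N y < count M y" for y
  proof (intro exI[of _ e] conjI e(1))
    show "y < e" using that e by (metis not_less_iff_gr_or_eq)
  qed
  then show "M < N" using e(1) unfolding less_multiset\<^sub>H\<^sub>O by auto
qed

text \<open>The multiset form of \<open>esum_sup\<close>. At the largest exponent \<open>e\<close>
  where \<open>P\<close> and \<open>A + B\<close> differ, one copy of \<open>e\<close> in a summand
  is replaced by all terms of \<open>P\<close> below \<open>e\<close>.\<close>

lemma mset_sum_less:
  fixes A B P :: "'e::linorder multiset"
  assumes "P < A + B"
  shows "(\<exists>A'<A. P \<le> A' + B) \<or> (\<exists>B'<B. P \<le> A + B')"
proof -
  obtain e where e: "count P e < count (A + B) e" "\<And>d. d > e \<Longrightarrow> count P d = count (A + B) d"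
    using assms unfolding mset_less_iff_max_diff by blast
  have key: "\<exists>A'<A. P \<le> A' + B" if eA: "e \<in># A" and cP: "count P e < count (A + B) e"
    "\<And>d. d > e \<Longrightarrow> count P d = count (A + B) d" for A B :: "'e multiset"
  proof -
    define A' where "A' = (A - {#e#}) + filter_mset (\<lambda>d. d < e) P"
    have "filter_mset (\<lambda>d. d < e) P < {#e#}" by simp
    then have "A' < (A - {#e#}) + {#e#}" unfolding A'_def by (rule add_strict_left_mono)
    then have "A' < A" using eA by simp
    moreover have "P \<subseteq># A' + B"
    proof (rule mset_subset_eqI)
      fix d
      consider "d < e" | "d = e" | "d > e" by fastforce
      then show "count P d \<le> count (A' + B) d"
      proof cases
        case 2
        have "count A e \<ge> 1" using eA by simp
        then show ?thesis using 2 cP(1) by (simp add: A'_def)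
      next
        case 3
        then have "d \<noteq> e" by simp
        then show ?thesis using cP(2)[OF 3] by (simp add: A'_def)
      qed (simp add: A'_def)
    qed
    then have "P \<le> A' + B" by (rule subset_eq_imp_le_multiset)
    ultimately show ?thesis by blast
  qed
  have "e \<in># A \<or> e \<in># B" using e(1) by (metis less_nat_zero_code not_in_iff union_iff)
  then show ?thesis
  proof
    assume "e \<in># A" then show ?thesis using key[OF _ e] by blast
  next
    assume "e \<in># B"
    then have "\<exists>B'<B. P \<le> B' + A" using key[of B A] e by (simp add: add.commute)
    then show ?thesis by (auto simp: add.commute)
  qed
qed

text \<open>An ordinal below \<open>M\<close> is determined by its coefficient at the largest
  exponent of \<open>M\<close>, which is at most \<open>size M\<close>, and by its terms below that
  exponent.\<close>

lemma card_lessThan_mset: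
  fixes M :: "'e::linorder multiset"
  assumes "M \<noteq> {#}"
  shows "|{..<M}| \<le>o |{..size M} \<times> {..<{#Max_mset M#}}|"
proof (rule card_of_ordLeqI)
  let ?m = "Max_mset M"
  define f where "f P = (count P ?m, filter_mset (\<lambda>e. e < ?m) P)" for P
  have mx: "count M d = 0" if "d > ?m" for d
    using that by (metis Max_ge finite_set_mset leD not_in_iff)
  have PM: "(\<forall>d>?m. count P d = 0) \<and> count P ?m \<le> count M ?m" if less: "P < M" for P
  proof -
    obtain e where e: "count P e < count M e" "\<And>d. d > e \<Longrightarrow> count P d = count M d"
      using less unfolding mset_less_iff_max_diff by blast
    then have "e \<le> ?m" using mx[of e] by force
    then show ?thesis using e mx by (cases "e = ?m") auto
  qed
  show "inj_on f {..<M}"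
  proof (rule inj_onI)
    fix P Q assume PQ: "P \<in> {..<M}" "Q \<in> {..<M}" "f P = f Q"
    show "P = Q"
    proof (rule multiset_eqI)
      fix d
      consider "d < ?m" | "d = ?m" | "d > ?m" by fastforce
      then show "count P d = count Q d"
      proof cases
        case 1
        have "filter_mset (\<lambda>e. e < ?m) P = filter_mset (\<lambda>e. e < ?m) Q" using PQ(3) by (simp add: f_def)
        then have "count (filter_mset (\<lambda>e. e < ?m) P) d = count (filter_mset (\<lambda>e. e < ?m) Q) d" by simp
        then show ?thesis using 1 by simp
      next
        case 2 then show ?thesis using PQ(3) by (simp add: f_def)
      next
        case 3 then show ?thesis using PM[of P] PM[of Q] PQ by simp
      qed
    qed
  qed
  show "f P \<in> {..size M} \<times> {..<{#?m#}}" if "P \<in> {..<M}" for P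
    using PM[of P] that count_le_size[of M ?m] unfolding f_def by auto
qed

lemma finite_ordLeq_infinite: "finite A \<Longrightarrow> infinite B \<Longrightarrow> |A| \<le>o |B|"
  using finite_ordLess_infinite[OF card_of_Well_order card_of_Well_order, of A B]
  by (simp add: Field_card_of ordLess_imp_ordLeq)

text \<open>If the cardinal exceeded its leading power of \<omega>, that power would have smaller
  cardinality; but finitely many copies of it bound the cardinality of the whole by
  \<open>card_lessThan_mset\<close>.\<close>

lemma card_order_below_single:
  assumes k: "Cinfinite k" and C: "k =o below (C :: 'e::wellorder multiset)"
  shows "\<exists>e. C = {#e#}"
proof -
  have K: "Card_order k" "infinite (Field k)" using k by (auto simp: cinfinite_def)
  have "|Field k| =o |Field (below C)|" using C by (rule card_of_cong)
  then have FC: "infinite {..<C}" "k \<le>o |{..<C}|"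
    using K card_of_ordIso_finite[of "Field k" "{..<C}"] card_of_Field_ordIso[OF K(1)]
    by (simp, metis Field_below ordIso_iff_ordLeq ordIso_symmetric ordIso_transitive)
  have "{..<{#} :: 'e multiset} = {}" by auto
  then have "C \<noteq> {#}" using FC(1) by auto
  let ?m = "Max_mset C"
  have "?m \<in># C" using \<open>C \<noteq> {#}\<close> by (intro Max_in) auto
  then have "{#?m#} \<subseteq># C" by simp
  then have mC: "{#?m#} \<le> C" by (rule subset_eq_imp_le_multiset)
  note CM = card_lessThan_mset[OF \<open>C \<noteq> {#}\<close>]
  have inf: "infinite {..<{#?m#}}"
    using CM FC(1) card_of_ordLeq_finite by blast
  have "\<not> {#?m#} < C"
  proof
    assume "{#?m#} < C"
    then have "below {#?m#} <o below C" by simp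
    then have lt: "below {#?m#} <o k" using C ordIso_symmetric ordLess_ordIso_trans by blast
    have "well_order_on {..<{#?m#}} (below {#?m#})" using Well_order_below[of "{#?m#}"] by simp
    then have "|{..<{#?m#}}| \<le>o below {#?m#}" by (rule card_of_least)
    then have "|{..<{#?m#}}| <o k" using lt by (rule ordLeq_ordLess_trans)
    moreover have "|{..size C} \<times> {..<{#?m#}}| =o |{..<{#?m#}}|"
    proof (rule card_of_Times_infinite_simps(3)[OF inf])
      show "|{..size C}| \<le>o |{..<{#?m#}}|"
        using inf by (intro finite_ordLeq_infinite) auto
    qed simp
    then have "|{..<C}| \<le>o |{..<{#?m#}}|" using CM ordLeq_ordIso_trans by blast
    then have "k \<le>o |{..<{#?m#}}|" using FC(2) ordLeq_transitive by blast
    ultimately show False using not_ordLess_ordLeq by blast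
  qed
  then have "C = {#?m#}" using mC by simp
  then show ?thesis by blast
qed

section \<open>Multisets of exponents as coefficient functions\<close>

abbreviation suc_order :: "'q set rel" where
  "suc_order \<equiv> cardSuc |UNIV :: 'q set|"

text \<open>Coefficient functions live on the raw type \<open>'q set\<close>, where only the field
  of \<open>suc_order\<close> consists of exponents; the value 0 elsewhere keeps the support inside
  the field.\<close>

definition cnf_of :: "'q suc multiset \<Rightarrow> 'q set \<Rightarrow> nat" where
  "cnf_of M x = (if x \<in> Field suc_order then count M (Abs_suc x) else 0)"

lemma cnf_of_Rep [simp]: "cnf_of M (Rep_suc e) = count M e"
  using Rep_suc[of e] by (simp add: cnf_of_def Rep_suc_inverse)

lemma cnf_of_inject [simp]: "cnf_of M = cnf_of N \<longleftrightarrow> M = N"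
  by (metis cnf_of_Rep multiset_eqI)

lemma cnf_of_support: "{x. cnf_of M x \<noteq> 0} = Rep_suc ` set_mset M"
proof -
  have "x \<in> Rep_suc ` set_mset M" if "cnf_of M x \<noteq> 0" for x
  proof -
    have "x \<in> Field suc_order" "Abs_suc x \<in># M" using that by (auto simp: cnf_of_def split: if_splits)
    then show ?thesis by (metis Abs_suc_inverse image_eqI)
  qed
  then show ?thesis by auto
qed

lemma cnf_of_surj:
  assumes "finite {x. f x \<noteq> 0}" "{x. f x \<noteq> 0} \<subseteq> Field (suc_order :: 'q set rel)"
  obtains M :: "'q suc multiset" where "f = cnf_of M"
proof -
  define g where "g e = f (Rep_suc e)" for e :: "'q suc"
  have "{e. 0 < g e} \<subseteq> Abs_suc ` {x. f x \<noteq> 0}"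
    unfolding g_def by (auto intro!: image_eqI[where x = "Rep_suc _"] simp: Rep_suc_inverse)
  then have "finite {e. 0 < g e}" using assms(1) finite_surj by blast
  then have c: "count (Abs_multiset g) = g" by simp
  have "f x = cnf_of (Abs_multiset g) x" for x
  proof (cases "x \<in> Field (suc_order :: 'q set rel)")
    case True
    then show ?thesis unfolding cnf_of_def c g_def by (simp add: Abs_suc_inverse)
  next
    case False
    then show ?thesis using assms(2) by (auto simp: cnf_of_def)
  qed
  then show ?thesis using that by blast
qed

lemma suc_less_iff: "(x :: 'q suc) < y \<longleftrightarrow> (Rep_suc x, Rep_suc y) \<in> suc_order \<and> Rep_suc x \<noteq> Rep_suc y"
  unfolding less_suc_def less_eq_suc_def by (simp add: Rep_suc_inject)

lemma omega_power_iff: "(cnf_of M, cnf_of N) \<in> omega_power suc_order \<longleftrightarrow> M \<le> N"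
proof -
  have supp: "finite {x. cnf_of M x \<noteq> 0}" "{x. cnf_of M x \<noteq> 0} \<subseteq> Field suc_order" for M :: "'q suc multiset"
    unfolding cnf_of_support using Rep_suc by auto
  have "(\<exists>x\<in>Field suc_order. cnf_of M x < cnf_of N x \<and> (\<forall>y. (x, y) \<in> suc_order \<and> y \<noteq> x \<longrightarrow> cnf_of M y = cnf_of N y))
     \<longleftrightarrow> (\<exists>e. count M e < count N e \<and> (\<forall>d>e. count M d = count N d))" (is "?A \<longleftrightarrow> ?B")
  proof
    assume ?A
    then obtain x where x: "x \<in> Field suc_order" "cnf_of M x < cnf_of N x"
      "\<And>y. (x, y) \<in> suc_order \<Longrightarrow> y \<noteq> x \<Longrightarrow> cnf_of M y = cnf_of N y" by blast
    obtain e where e: "x = Rep_suc e" using x(1) Rep_suc_cases by blast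
    have "count M d = count N d" if "d > e" for d
      using x(3)[of "Rep_suc d"] that unfolding suc_less_iff e by auto
    then show ?B using x(2) unfolding e by auto
  next
    assume ?B
    then obtain e where e: "count M e < count N e" "\<And>d. d > e \<Longrightarrow> count M d = count N d" by blast
    have "cnf_of M y = cnf_of N y" if "(Rep_suc e, y) \<in> suc_order" "y \<noteq> Rep_suc e" for y
    proof -
      have "y \<in> Field suc_order" using that(1) by (rule FieldI2)
      then obtain d where "y = Rep_suc d" using Rep_suc_cases by blast
      then show ?thesis using e(2)[of d] that by (auto simp: suc_less_iff)
    qed
    then show ?A using e(1) Rep_suc[of e] by (intro bexI[of _ "Rep_suc e"]) auto
  qed
  moreover have "(cnf_of M, cnf_of N) \<in> omega_power suc_order \<longleftrightarrow> cnf_of M = cnf_of N \<or> ?A"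
    unfolding omega_power_def by (simp only: mem_Collect_eq case_prod_conv supp simp_thms)
  ultimately show ?thesis unfolding le_less mset_less_iff_max_diff cnf_of_inject by argo
qed

lemma Field_omega_power: "Field (omega_power (suc_order :: 'q set rel)) = range cnf_of"
proof
  show "range cnf_of \<subseteq> Field (omega_power (suc_order :: 'q set rel))"
  proof
    fix f :: "'q set \<Rightarrow> nat" assume "f \<in> range cnf_of"
    then obtain M where "f = cnf_of M" by blast
    then have "(f, f) \<in> omega_power suc_order" using omega_power_iff by blast
    then show "f \<in> Field (omega_power suc_order)" by (rule FieldI1)
  qed
  show "Field (omega_power (suc_order :: 'q set rel)) \<subseteq> range cnf_of"
  proof
    fix f assume "f \<in> Field (omega_power (suc_order :: 'q set rel))"
    then have "finite {x. f x \<noteq> 0}" "{x. f x \<noteq> 0} \<subseteq> Field (suc_order :: 'q set rel)"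
      by (auto simp: Field_def omega_power_def)
    then show "f \<in> range cnf_of" using cnf_of_surj by blast
  qed
qed

text \<open>\<open>cnf_of\<close> is an isomorphism from the multiset order onto
  \<open>omega_power\<close>, so it carries \<open>below M\<close> to the segment below its value at
  \<open>M\<close>.\<close>

lemma ord_below_omega_power: "ord_below (omega_power suc_order) (cnf_of M) =o below M"
proof -
  have sub: "omega_power (suc_order :: 'q set rel) \<subseteq> range cnf_of \<times> range cnf_of"
    unfolding Field_omega_power[symmetric] by (auto simp: Field_def)
  have "ord_below (omega_power suc_order) (cnf_of M) = dir_image (below M) cnf_of"
  proof (intro set_eqI iffI)
    fix u assume u: "u \<in> ord_below (omega_power suc_order) (cnf_of M)"
    then obtain A B where AB: "u = (cnf_of A, cnf_of B)" using sub unfolding ord_below_def by blast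
    then show "u \<in> dir_image (below M) cnf_of"
      using u unfolding ord_below_def underS_def dir_image_def below_def
      by (auto simp: omega_power_iff less_le)
  next
    fix u assume "u \<in> dir_image (below M) cnf_of"
    then obtain A B where AB: "u = (cnf_of A, cnf_of B)" "A \<le> B" "B < M"
      unfolding dir_image_def below_def by blast
    then have "A < M" by simp
    then show "u \<in> ord_below (omega_power suc_order) (cnf_of M)"
      using AB by (auto simp: ord_below_def underS_def omega_power_iff less_le)
  qed
  moreover have "below M =o dir_image (below M) cnf_of"
    by (rule dir_image_ordIso[OF Well_order_below]) (simp add: inj_on_def)
  ultimately show ?thesis using ordIso_symmetric by metis
qed

lemma cnf_eq:
  fixes M :: "'q suc multiset"
  assumes "a =o below M"
  shows "cnf suc_order a = cnf_of M"
  unfolding cnf_def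
proof (rule the_equality)
  show "cnf_of M \<in> Field (omega_power suc_order) \<and> ord_below (omega_power suc_order) (cnf_of M) =o a"
    using ordIso_transitive[OF ord_below_omega_power ordIso_symmetric[OF assms]]
    by (simp add: Field_omega_power)
  fix f :: "'q set \<Rightarrow> nat" assume f: "f \<in> Field (omega_power suc_order) \<and> ord_below (omega_power suc_order) f =o a"
  then obtain N :: "'q suc multiset" where N: "f = cnf_of N" using Field_omega_power by blast
  have "below N =o ord_below (omega_power suc_order) f"
    unfolding N by (rule ordIso_symmetric[OF ord_below_omega_power])
  also have "ord_below (omega_power suc_order) f =o a" using f by blast
  also note assms
  finally show "f = cnf_of M" by (simp add: N)
qed

text \<open>Exponents are ordinals too and have normal forms of their own, in which their Hessenberg
  sum is computed.\<close>

definition nf :: "'q suc \<Rightarrow> 'q suc multiset" where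
  "nf e = (SOME M. below e =o below M)"

lemma nf: "below e =o below (nf e)"
  unfolding nf_def by (rule someI_ex) (rule ordLeq_below_imp_mset[of "below e" e], simp)

lemma nf_le_iff [simp]: "nf x \<le> nf y \<longleftrightarrow> x \<le> y"
proof -
  have "below (nf x) \<le>o below (nf y) \<longleftrightarrow> below x \<le>o below y"
    using nf[of x] nf[of y] by (meson ordIso_ordLeq_trans ordIso_symmetric ordLeq_ordIso_trans)
  then show ?thesis by simp
qed

lemma nf_less_iff [simp]: "nf x < nf y \<longleftrightarrow> x < y"
  by (simp flip: not_le)

lemma nf_eq_iff [simp]: "nf x = nf y \<longleftrightarrow> x = y"
  by (simp add: order_class.order_eq_iff)

lemma nf_initial: assumes "M \<le> nf e" shows "\<exists>d\<le>e. M = nf d"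
proof -
  have "below M \<le>o below (nf e)" using assms by simp
  then have "below M \<le>o below e" using nf ordIso_symmetric ordLeq_ordIso_trans by blast
  then obtain d where d: "d \<le> e" "below M =o below d" using ordLeq_below_imp_ordIso by blast
  have "below M =o below (nf d)" using d(2) nf ordIso_transitive by blast
  then show ?thesis using d(1) by auto
qed

lemma nf_bot [simp]: "nf bot_exp = {#}"
proof -
  have "{#} \<le> nf (bot_exp :: 'a suc)" by simp
  then obtain d :: "'a suc" where "d \<le> bot_exp" "{#} = nf d" using nf_initial by blast
  then show ?thesis using bot_exp_le[of d] by (simp add: antisym)
qed

lemma cnf_ord_below:
  assumes "z \<in> Field suc_order"
  shows "cnf suc_order (ord_below suc_order z) = cnf_of (nf (Abs_suc z))"
  by (rule cnf_eq) (rule ordIso_transitive[OF ord_below_suc[OF assms] nf])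

definition esum :: "'q suc \<Rightarrow> 'q suc \<Rightarrow> 'q suc" where
  "esum x y = (THE z. nf z = nf x + nf y)"

lemma exponent_sum_eq:
  fixes z :: "'q suc"
  assumes "nf z = nf x + nf y"
  shows "exponent_sum suc_order (Rep_suc x) (Rep_suc y) = Rep_suc z"
  unfolding exponent_sum_def cnf_ord_below[OF Rep_suc] Rep_suc_inverse
proof (rule the_equality)
  have add: "(\<lambda>e. cnf_of (nf x) e + cnf_of (nf y) e) = cnf_of (nf x + nf y)"
    by (auto simp: cnf_of_def)
  show "Rep_suc z \<in> Field suc_order \<and>
    cnf suc_order (ord_below suc_order (Rep_suc z)) = (\<lambda>e. cnf_of (nf x) e + cnf_of (nf y) e)"
    using cnf_ord_below[OF Rep_suc, of z] Rep_suc[of z] unfolding add by (simp add: Rep_suc_inverse assms)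
  fix w :: "'q set" assume w: "w \<in> Field suc_order \<and>
    cnf suc_order (ord_below suc_order w) = (\<lambda>e. cnf_of (nf x) e + cnf_of (nf y) e)"
  then have "cnf_of (nf (Abs_suc w)) = cnf_of (nf z)" using cnf_ord_below unfolding add assms by metis
  then have "Abs_suc w = z" by simp
  then show "w = Rep_suc z" using w Abs_suc_inverse by blast
qed

lemma esum_eq: "nf z = nf x + nf y \<Longrightarrow> esum x y = z"
  unfolding esum_def by (rule the_equality) (auto simp flip: nf_eq_iff)

text \<open>Over a finite type, only the exponent 0 occurs, and \<^term>\<open>esum\<close> is meaningless for others.\<close>

definition exps :: "'q suc set" where
  "exps = (if finite (UNIV :: 'q set) then {bot_exp} else UNIV)"

lemma card_lessThan_suc: "|{..<(x :: 'q suc)}| \<le>o |UNIV :: 'q set|"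
proof -
  have C: "Card_order |UNIV :: 'q set|" by (rule card_of_Card_order)
  have W: "Well_order (suc_order :: 'q set rel)" by (rule cardSuc_Well_order[OF C])
  have "well_order_on {..<x} (below x)" using Well_order_below[of x] by simp
  then have "|{..<x}| \<le>o below x" by (rule card_of_least)
  also have "below x =o ord_below suc_order (Rep_suc x)"
    using ord_below_suc[OF Rep_suc, of x] by (simp add: Rep_suc_inverse ordIso_symmetric)
  also have "ord_below suc_order (Rep_suc x) <o (suc_order :: 'q set rel)"
    unfolding ord_below_def by (rule Restr_underS_ordLess[OF W Rep_suc])
  finally show ?thesis unfolding cardSuc_ordLeq_ordLess[OF C card_of_Card_order] .
qed

lemma card_lessThan_nf: "|{..<nf (x :: 'q suc)}| \<le>o |UNIV :: 'q set|"
proof -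
  have "|{..<nf x}| =o |{..<x}|" using card_of_cong[OF ordIso_symmetric[OF nf[of x]]] by simp
  then show ?thesis using card_lessThan_suc ordIso_ordLeq_trans by blast
qed

text \<open>Over an infinite type, the leading power of \<omega> of the sum is at most one of the
  summands, hence has at most as many predecessors as \<open>'q\<close> has elements. Finitely many
  copies do not change this, so the sum stays below the successor cardinal.\<close>

lemma esum_exists:
  fixes x y :: "'q suc"
  assumes "x \<in> exps" "y \<in> exps"
  shows "\<exists>z\<in>exps. nf z = nf x + nf y"
proof (cases "finite (UNIV :: 'q set)")
  case True
  then show ?thesis using assms by (simp add: exps_def)
next
  case inf: False
  let ?C = "nf x + nf y"
  have "\<exists>z. nf z = ?C"
  proof (cases "?C = {#}")
    case True then show ?thesis using nf_bot by metis
  next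
    case False
    let ?m = "Max_mset ?C"
    have "?m \<in># ?C" using False by (intro Max_in) auto
    then have "{#?m#} \<subseteq># nf x \<or> {#?m#} \<subseteq># nf y" by auto
    then have "{#?m#} \<le> nf x \<or> {#?m#} \<le> nf y" using subset_eq_imp_le_multiset by blast
    then have "{..<{#?m#}} \<subseteq> {..<nf x} \<or> {..<{#?m#}} \<subseteq> {..<nf y}" by auto
    then have m: "|{..<{#?m#}}| \<le>o |UNIV :: 'q set|"
      using card_lessThan_nf card_of_mono1 ordLeq_transitive by blast
    have "|{..<?C}| \<le>o |{..size ?C} \<times> {..<{#?m#}}|" by (rule card_lessThan_mset[OF False])
    also have "|{..size ?C} \<times> {..<{#?m#}}| \<le>o |UNIV :: 'q set|"
    proof (rule card_of_Times_ordLeq_infinite_Field)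
      show "infinite (Field |UNIV :: 'q set| )" using inf by (simp add: Field_card_of)
      show "|{..size ?C}| \<le>o |UNIV :: 'q set|"
        using inf by (intro finite_ordLeq_infinite) auto
    qed (rule m, rule card_of_Card_order)
    finally have "|Field (below ?C)| \<le>o |UNIV :: 'q set|" by simp
    from ordIso_below_suc[OF Well_order_below this] obtain z :: "'q suc" where "below ?C =o below z" by blast
    then have "below ?C =o below (nf z)" using nf ordIso_transitive by blast
    then show ?thesis by auto
  qed
  then show ?thesis using inf by (auto simp: exps_def)
qed

lemma nf_esum: "x \<in> exps \<Longrightarrow> y \<in> exps \<Longrightarrow> nf (esum x y) = nf x + nf y"
  using esum_exists esum_eq by metis

lemma esum_exps: "x \<in> exps \<Longrightarrow> y \<in> exps \<Longrightarrow> esum x y \<in> exps"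
  using esum_exists esum_eq by metis

lemma exps_down: "x < y \<Longrightarrow> y \<in> exps \<Longrightarrow> x \<in> exps"
  using bot_exp_le[of x] by (auto simp: exps_def split: if_splits)

interpretation suc: hessenberg_exponents "exps :: 'q suc set" esum
proof
  show "bot_exp \<in> (exps :: 'q suc set)" by (simp add: exps_def)
  show "x < y \<Longrightarrow> y \<in> exps \<Longrightarrow> x \<in> exps" for x y :: "'q suc" by (rule exps_down)
  show "x \<in> exps \<Longrightarrow> y \<in> exps \<Longrightarrow> esum x y \<in> exps" for x y :: "'q suc" by (rule esum_exps)
  show "esum x y < esum x' y" if "x < x'" "x' \<in> exps" "y \<in> exps" for x x' y :: "'q suc"
  proof -
    have "x \<in> exps" using exps_down that by blast
    then have "nf (esum x y) < nf (esum x' y)" using that by (simp only: nf_esum) simp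
    then show ?thesis by simp
  qed
  show "esum x y < esum x y'" if "y < y'" "x \<in> exps" "y' \<in> exps" for x y y' :: "'q suc"
  proof -
    have "y \<in> exps" using exps_down that by blast
    then have "nf (esum x y) < nf (esum x y')" using that by (simp only: nf_esum) simp
    then show ?thesis by simp
  qed
  show "(\<exists>x'<x. e \<le> esum x' y) \<or> (\<exists>y'<y. e \<le> esum x y')"
    if e: "e < esum x y" and E: "x \<in> exps" "y \<in> exps" for e x y :: "'q suc"
  proof -
    \<comment> \<open>Below a multiset sum it suffices to lower one summand, and by
      \<open>nf_initial\<close> the lowered summand is again the normal form of an exponent.\<close>
    have "nf e < nf x + nf y" using e nf_esum[OF E] nf_less_iff by metis
    from mset_sum_less[OF this] show ?thesis
    proof (elim disjE exE conjE)
      fix A assume A: "A < nf x" "nf e \<le> A + nf y"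
      then have "A \<le> nf x" by simp
      then obtain x' where x': "A = nf x'" using nf_initial by blast
      then have "x' < x" using A(1) by simp
      moreover have "x' \<in> exps" using exps_down[OF \<open>x' < x\<close> E(1)] .
      then have "nf e \<le> nf (esum x' y)" using A(2) E(2) by (simp only: x' nf_esum)
      ultimately show ?thesis by auto
    next
      fix B assume B: "B < nf y" "nf e \<le> nf x + B"
      then have "B \<le> nf y" by simp
      then obtain y' where y': "B = nf y'" using nf_initial by blast
      then have "y' < y" using B(1) by simp
      moreover have "y' \<in> exps" using exps_down[OF \<open>y' < y\<close> E(2)] .
      then have "nf e \<le> nf (esum x y')" using B(2) E(1) by (simp only: y' nf_esum)
      ultimately show ?thesis by auto
    qed
  qed
qed

lemma count_sum_mset_sum:
  assumes "finite S" "set_mset A \<subseteq> S"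
  shows "count (\<Sum>x\<in>#A. F x) e = (\<Sum>x\<in>S. count A x * count (F x) e)"
  using assms(2)
proof (induction A)
  case (add y A)
  have "(\<Sum>x\<in>S. count (add_mset y A) x * count (F x) e)
    = (\<Sum>x\<in>S. count A x * count (F x) e) + (\<Sum>x\<in>S. if y = x then count (F x) e else 0)"
    unfolding sum.distrib[symmetric] by (intro sum.cong) auto
  also have "(\<Sum>x\<in>S. if y = x then count (F x) e else 0) = count (F y) e"
    using add.prems assms(1) by simp
  finally show ?case using add by simp
qed simp

text \<open>Brings the multiset product into the convolution form of
  \<open>cnf_mult\<close>.\<close>

lemma count_mmult:
  "count (suc.mmult A B) e = (\<Sum>(x, y) \<in> {(x, y). x \<in># A \<and> y \<in># B \<and> esum x y = e}. count A x * count B y)"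
proof -
  have "count (suc.mmult A B) e = (\<Sum>x\<in>set_mset A. count A x * (\<Sum>y | y \<in># B \<and> e = esum x y. count B y))"
    unfolding suc.mmult_def by (subst count_sum_mset_sum[of "set_mset A"]) (simp_all add: count_image_mset')
  also have "\<dots> = (\<Sum>x\<in>set_mset A. \<Sum>y | y \<in># B \<and> e = esum x y. count A x * count B y)"
    by (simp add: sum_distrib_left)
  also have "\<dots> = (\<Sum>(x, y)\<in>(SIGMA x:set_mset A. {y. y \<in># B \<and> e = esum x y}). count A x * count B y)"
    by (rule sum.Sigma) auto
  also have "(SIGMA x:set_mset A. {y. y \<in># B \<and> e = esum x y}) = {(x, y). x \<in># A \<and> y \<in># B \<and> esum x y = e}"
    by auto
  finally show ?thesis .
qed

lemma cnf_mult_eq: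
  assumes A: "set_mset A \<subseteq> exps" and B: "set_mset B \<subseteq> exps"
  shows "cnf_mult suc_order (cnf_of A) (cnf_of B) = cnf_of (suc.mmult A B)"
proof
  fix z
  let ?S = "{(x, y). cnf_of A x \<noteq> 0 \<and> cnf_of B y \<noteq> 0 \<and> exponent_sum suc_order x y = z}"
  have es: "exponent_sum suc_order (Rep_suc x) (Rep_suc y) = Rep_suc (esum x y)" if "x \<in># A" "y \<in># B" for x y
    by (rule exponent_sum_eq) (rule nf_esum, use that A B in auto)
  have nz: "cnf_of A x \<noteq> 0 \<longleftrightarrow> x \<in> Rep_suc ` set_mset A" for A and x :: "'a set"
    using cnf_of_support[of A] by blast
  let ?T = "{(x, y). x \<in># A \<and> y \<in># B \<and> Rep_suc (esum x y) = z}"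
  have S: "?S = map_prod Rep_suc Rep_suc ` ?T"
  proof (intro set_eqI iffI)
    fix u assume "u \<in> ?S"
    then obtain x y where "u = (Rep_suc x, Rep_suc y)" "x \<in># A" "y \<in># B" "exponent_sum suc_order (Rep_suc x) (Rep_suc y) = z"
      unfolding nz by blast
    then show "u \<in> map_prod Rep_suc Rep_suc ` ?T" using es by (intro image_eqI[of _ _ "(x, y)"]) auto
  next
    fix u assume "u \<in> map_prod Rep_suc Rep_suc ` ?T"
    then obtain x y where "u = (Rep_suc x, Rep_suc y)" "x \<in># A" "y \<in># B" "Rep_suc (esum x y) = z" by auto
    then show "u \<in> ?S" using es unfolding nz by auto
  qed
  have "inj (Rep_suc :: 'a suc \<Rightarrow> 'a set)" by (rule injI) (simp add: Rep_suc_inject)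
  then have "inj (map_prod Rep_suc Rep_suc :: 'a suc \<times> 'a suc \<Rightarrow> 'a set \<times> 'a set)"
    by (intro prod.inj_map)
  then have inj: "inj_on (map_prod Rep_suc Rep_suc) ?T" by (rule inj_on_subset) simp
  have "cnf_mult suc_order (cnf_of A) (cnf_of B) z = (\<Sum>(x, y)\<in>?S. cnf_of A x * cnf_of B y)"
    unfolding cnf_mult_def ..
  also have "\<dots> = (\<Sum>p\<in>?T. (case map_prod Rep_suc Rep_suc p of (x, y) \<Rightarrow> cnf_of A x * cnf_of B y))"
    unfolding S by (subst sum.reindex[OF inj]) simp
  also have "\<dots> = (\<Sum>(x, y)\<in>?T. count A x * count B y)"
    by (intro sum.cong) (auto simp: case_prod_beta)
  also have "\<dots> = cnf_of (suc.mmult A B) z"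
  proof (cases "z \<in> Field suc_order")
    case True
    then obtain e where e: "z = Rep_suc e" using Rep_suc_cases by blast
    show ?thesis unfolding e cnf_of_Rep count_mmult Rep_suc_inject ..
  next
    case False
    then have "?T = {}" using Rep_suc by blast
    moreover have "cnf_of (suc.mmult A B) z = 0" using False by (simp add: cnf_of_def)
    ultimately show ?thesis by (simp del: Collect_empty_eq)
  qed
  finally show "cnf_mult suc_order (cnf_of A) (cnf_of B) z = cnf_of (suc.mmult A B) z" .
qed

lemma cone_ordIso: "cone =o below {#bot_exp :: 'e::wellorder#}"
proof -
  have W: "Well_order cone" "Field cone = {()}"
    by (simp_all add: cone_def card_of_Well_order[unfolded Field_card_of] Field_card_of)
  have "cone \<le>o below {#bot_exp :: 'e#}" unfolding ordLeq_below_iff[OF W(1)] by (rule exI[of _ "\<lambda>_. {#}"]) simp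
  moreover have "below {#bot_exp :: 'e#} \<le>o cone" by (rule below_bot_ordLeq[OF W(1)]) (simp add: W(2))
  ultimately show ?thesis unfolding ordIso_iff_ordLeq by blast
qed

lemma cnf_prod_eq:
  assumes "\<And>i. i \<in> {1..n} \<Longrightarrow> q i =o below (Q i)" "\<And>i. i \<in> {1..n} \<Longrightarrow> set_mset (Q i) \<subseteq> exps"
  shows "cnf_prod suc_order q n = cnf_of (suc.mprod Q n)"
  using assms
proof (induction n)
  case 0
  show ?case using cnf_eq[OF cone_ordIso] by simp
next
  case (Suc n)
  have "set_mset (suc.mprod Q n) \<subseteq> exps" by (rule suc.mprod_E) (use Suc.prems in auto)
  moreover have "cnf_prod suc_order q n = cnf_of (suc.mprod Q n)" by (rule Suc.IH) (use Suc.prems in auto)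
  moreover have "cnf suc_order (q (Suc n)) = cnf_of (Q (Suc n))" by (rule cnf_eq) (use Suc.prems in auto)
  moreover have "set_mset (Q (Suc n)) \<subseteq> exps" using Suc.prems by auto
  ultimately show ?case by (simp add: cnf_mult_eq)
qed

lemma hessenberg_prod_eq:
  fixes q :: "nat \<Rightarrow> 'q rel" and Q :: "nat \<Rightarrow> 'q suc multiset"
  assumes "\<And>i. i \<in> {1..n} \<Longrightarrow> q i =o below (Q i)" "\<And>i. i \<in> {1..n} \<Longrightarrow> set_mset (Q i) \<subseteq> exps"
  shows "hessenberg_prod q n =o below (suc.mprod Q n)"
proof -
  have "cnf_prod suc_order q n = cnf_of (suc.mprod Q n)" by (rule cnf_prod_eq[OF assms])
  then show ?thesis unfolding hessenberg_prod_def Let_def by (simp only: ord_below_omega_power)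
qed

text \<open>Over a finite type \<open>Q\<close> is a finite ordinal, whereas a term with an exponent
  other than the least would have all finite ordinals, the multiples of \<open>{#bot_exp#}\<close>,
  below it.\<close>

lemma exps_of_ordIso:
  fixes q :: "'q rel" and Q :: "'q suc multiset"
  assumes "q =o below Q"
  shows "set_mset Q \<subseteq> exps"
proof (cases "finite (UNIV :: 'q set)")
  case True
  have "|Field q| =o |{..<Q}|" using card_of_cong[OF assms] by simp
  moreover have "finite (Field q)" by (rule finite_subset[OF subset_UNIV True])
  ultimately have fin: "finite {..<Q}" using card_of_ordIso_finite by blast
  have "e = bot_exp" if "e \<in># Q" for e
  proof (rule ccontr)
    assume "e \<noteq> bot_exp"
    then have "bot_exp < e" using bot_exp_le[of e] by simp
    then have "replicate_mset k bot_exp < {#e#}" for k by (auto split: if_splits)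
    moreover have "{#e#} \<le> Q" using that by (intro subset_eq_imp_le_multiset) simp
    ultimately have "replicate_mset k bot_exp < Q" for k by (metis less_le_trans)
    then have "range (\<lambda>k. replicate_mset k bot_exp) \<subseteq> {..<Q}" by blast
    then have "finite (range (\<lambda>k. replicate_mset k (bot_exp :: 'q suc)))" using fin by (rule finite_subset)
    moreover have "inj (\<lambda>k. replicate_mset k (bot_exp :: 'q suc))" by (rule injI) (metis size_replicate_mset)
    ultimately show False using range_inj_infinite by blast
  qed
  then show ?thesis using True by (auto simp: exps_def)
next
  case False then show ?thesis by (simp add: exps_def)
qed

section \<open>Ordinal multiples of a cardinal\<close>

lemma ord_mult_iff:
  "((a, x), (b, y)) \<in> ord_mult k q \<longleftrightarrow> a \<in> Field q \<and> b \<in> Field q \<and> x \<in> Field k \<and> y \<in> Field k \<and>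
     ((a, b) \<in> q \<and> a \<noteq> b \<or> a = b \<and> (x, y) \<in> k)"
  unfolding ord_mult_def by auto

lemma Field_ord_mult:
  assumes k: "Well_order k"
  shows "Field (ord_mult k q) = Field q \<times> Field k"
proof
  show "Field (ord_mult k q) \<subseteq> Field q \<times> Field k" unfolding ord_mult_def Field_def by auto
  show "Field q \<times> Field k \<subseteq> Field (ord_mult k q)"
  proof
    fix u assume "u \<in> Field q \<times> Field k"
    moreover obtain a x where u: "u = (a, x)" by fastforce
    moreover have "refl_on (Field k) k" using k by (simp add: order_on_defs)
    ultimately have "(u, u) \<in> ord_mult k q" by (simp add: ord_mult_iff refl_on_def)
    then show "u \<in> Field (ord_mult k q)" by (rule FieldI1)
  qed
qed

lemma Well_order_ord_mult:
  assumes k: "Well_order k" and q: "Well_order q"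
  shows "Well_order (ord_mult k q)"
proof -
  have k1: "refl_on (Field k) k" "trans k" "antisym k" "total_on (Field k) k" "wf (k - Id)"
    and q1: "trans q" "antisym q" "total_on (Field q) q" "wf (q - Id)"
    using k q unfolding order_on_defs by blast+
  let ?m = "ord_mult k q"
  have "linear_order_on (Field q \<times> Field k) ?m"
    unfolding order_on_defs
  proof (intro conjI)
    show "?m \<subseteq> (Field q \<times> Field k) \<times> (Field q \<times> Field k)" unfolding ord_mult_def by blast
    show "refl_on (Field q \<times> Field k) ?m" using k1(1) by (auto simp: refl_on_def ord_mult_iff)
    show "trans ?m"
    proof (rule transI, clarify)
      fix a x b y c z assume 1: "((a, x), (b, y)) \<in> ?m" and 2: "((b, y), (c, z)) \<in> ?m"
      have "(a, b) \<in> q \<Longrightarrow> (b, c) \<in> q \<Longrightarrow> a \<noteq> b \<Longrightarrow> (a, c) \<in> q \<and> a \<noteq> c"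
        using transD[OF q1(1), of a b c] antisymD[OF q1(2), of a b] by blast
      then show "((a, x), (c, z)) \<in> ?m"
        using 1 2 transD[OF k1(2), of x y z] unfolding ord_mult_iff by blast
    qed
    show "antisym ?m"
    proof (rule antisymI, clarify)
      fix a x b y assume "((a, x), (b, y)) \<in> ?m" "((b, y), (a, x)) \<in> ?m"
      then show "a = b \<and> x = y"
        using antisymD[OF q1(2), of a b] antisymD[OF k1(3), of x y] unfolding ord_mult_iff by blast
    qed
    show "total_on (Field q \<times> Field k) ?m"
      using q1(3) k1(4) k1(1) unfolding total_on_def by (auto simp: ord_mult_iff)
  qed
  moreover have "?m - Id \<subseteq> (q - Id) <*lex*> (k - Id)"
  proof
    fix u assume u: "u \<in> ?m - Id"
    obtain a x b y where "u = ((a, x), (b, y))" by (metis prod.exhaust)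
    then show "u \<in> (q - Id) <*lex*> (k - Id)" using u by (auto simp: ord_mult_iff)
  qed
  then have "wf (?m - Id)" by (rule wf_subset[OF wf_lex_prod[OF q1(4) k1(5)]])
  ultimately show ?thesis unfolding well_order_on_def Field_ord_mult[OF k] by blast
qed

lemma ord_mult_mono:
  assumes k: "Well_order k" and qr: "q \<le>o r"
  shows "ord_mult k q \<le>o ord_mult k r"
proof -
  have W: "Well_order q" "Well_order r" using qr unfolding ordLeq_def by blast+
  obtain f where f: "\<forall>x\<in>Field q. f x \<in> Field r" "\<forall>x y. (x, y) \<in> q \<and> x \<noteq> y \<longrightarrow> (f x, f y) \<in> r \<and> f x \<noteq> f y"
    using qr ordLeq_iff_strict_mono[OF W] by blast
  show ?thesis
  proof (rule ordLeq_strict_mono[OF Well_order_ord_mult[OF k W(1)] Well_order_ord_mult[OF k W(2)],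
        where f = "\<lambda>(a, x). (f a, x)"])
    fix u v assume "(u, v) \<in> ord_mult k q" "u \<noteq> v"
    moreover obtain a x b y where "u = (a, x)" "v = (b, y)" by (metis prod.exhaust)
    ultimately show "((case u of (a, x) \<Rightarrow> (f a, x)), (case v of (a, x) \<Rightarrow> (f a, x))) \<in> ord_mult k r \<and>
        (case u of (a, x) \<Rightarrow> (f a, x)) \<noteq> (case v of (a, x) \<Rightarrow> (f a, x))"
      using f by (auto simp: ord_mult_iff)
  qed (use f in \<open>auto simp: Field_ord_mult[OF k]\<close>)
qed

text \<open>
  If the values of \<open>f\<close> are compared before the elements themselves, and if all fibres of \<open>f\<close> are as
  large as the cardinal \<open>k\<close>, then each fibre is a copy of \<open>k\<close>.
\<close>

definition lex_by :: "('a \<Rightarrow> 'b) \<Rightarrow> 'b rel \<Rightarrow> 'a rel \<Rightarrow> 'a rel" where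
  "lex_by f r k = {(x, y) \<in> Field k \<times> Field k. (f x, f y) \<in> r - Id \<or> f x = f y \<and> (x, y) \<in> k}"

text \<open>Sending \<open>x\<close> to \<open>(f x, x)\<close> makes this a suborder of
  \<open>ord_mult k r\<close>, from which all properties are inherited.\<close>

lemma well_order_on_lex_by:
  assumes k: "Well_order k" and r: "Well_order r" and f: "\<And>x. x \<in> Field k \<Longrightarrow> f x \<in> Field r"
  shows "well_order_on (Field k) (lex_by f r k)"
proof -
  have k1: "refl_on (Field k) k" by (use k in \<open>simp add: order_on_defs\<close>)
  have W: "Well_order (ord_mult k r)" by (rule Well_order_ord_mult[OF k r])
  define h where "h x = (f x, x)" for x
  have m: "(x, y) \<in> lex_by f r k \<longleftrightarrow> x \<in> Field k \<and> y \<in> Field k \<and> (h x, h y) \<in> ord_mult k r" for x y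
    unfolding lex_by_def h_def ord_mult_iff using f by auto
  have F: "h x \<in> Field (ord_mult k r)" if "x \<in> Field k" for x
    using that f unfolding Field_ord_mult[OF k] h_def by simp
  have inj: "x = y" if "h x = h y" for x y using that by (simp add: h_def)
  have m1: "refl_on (Field (ord_mult k r)) (ord_mult k r)" "trans (ord_mult k r)" "antisym (ord_mult k r)"
    "total_on (Field (ord_mult k r)) (ord_mult k r)" "wf (ord_mult k r - Id)"
    using W unfolding order_on_defs by blast+
  have "linear_order_on (Field k) (lex_by f r k)"
    unfolding order_on_defs
  proof (intro conjI)
    show "lex_by f r k \<subseteq> Field k \<times> Field k" unfolding lex_by_def by blast
    show "refl_on (Field k) (lex_by f r k)" using m1(1) F m by (simp add: refl_on_def)
    show "trans (lex_by f r k)"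
    proof (rule transI)
      fix x y z assume "(x, y) \<in> lex_by f r k" "(y, z) \<in> lex_by f r k"
      then show "(x, z) \<in> lex_by f r k" using transD[OF m1(2), of "h x" "h y" "h z"] m by simp
    qed
    show "antisym (lex_by f r k)"
    proof (rule antisymI)
      fix x y assume "(x, y) \<in> lex_by f r k" "(y, x) \<in> lex_by f r k"
      then show "x = y" using antisymD[OF m1(3), of "h x" "h y"] m inj by simp
    qed
    show "total_on (Field k) (lex_by f r k)" unfolding total_on_def
    proof (intro ballI impI)
      fix x y assume xy: "x \<in> Field k" "y \<in> Field k" "x \<noteq> y"
      then have "h x \<noteq> h y" using inj by blast
      then have "(h x, h y) \<in> ord_mult k r \<or> (h y, h x) \<in> ord_mult k r"
        using m1(4) F[OF xy(1)] F[OF xy(2)] unfolding total_on_def by simp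
      then show "(x, y) \<in> lex_by f r k \<or> (y, x) \<in> lex_by f r k" using m xy by simp
    qed
  qed
  moreover have "lex_by f r k - Id \<subseteq> inv_image (ord_mult k r - Id) h"
    using m inj by (auto simp: inv_image_def)
  then have "wf (lex_by f r k - Id)" by (rule wf_subset[OF wf_inv_image[OF m1(5)]])
  ultimately show ?thesis unfolding well_order_on_def by blast
qed

lemma lex_by_ordIso:
  assumes k: "Card_order k" and r: "Well_order r" and f: "\<And>x. x \<in> Field k \<Longrightarrow> f x \<in> Field r"
    and fibre: "\<And>a. a \<in> Field r \<Longrightarrow> k \<le>o |{x \<in> Field k. f x = a}|"
  shows "lex_by f r k =o ord_mult k r"
proof -
  have Wk: "Well_order k" using k card_order_on_well_order_on by blast
  have wo: "well_order_on (Field k) (lex_by f r k)" by (rule well_order_on_lex_by[OF Wk r f])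
  then have Fl: "Field (lex_by f r k) = Field k"
    by (simp add: well_order_on_def Field_linear_order_on)
  then have Wl: "Well_order (lex_by f r k)" using wo by simp
  have Wm: "Well_order (ord_mult k r)" by (rule Well_order_ord_mult[OF Wk r])
  have "lex_by f r k \<le>o ord_mult k r"
  proof (rule ordLeq_strict_mono[OF Wl Wm, where f = "\<lambda>x. (f x, x)"])
    show "((f x, x), (f y, y)) \<in> ord_mult k r \<and> (f x, x) \<noteq> (f y, y)" if "(x, y) \<in> lex_by f r k" "x \<noteq> y" for x y
      using that f unfolding lex_by_def ord_mult_iff by auto
    show "(f x, x) \<in> Field (ord_mult k r)" if "x \<in> Field (lex_by f r k)" for x
      using that f unfolding Fl Field_ord_mult[OF Wk] by simp
  qed
  moreover have "ord_mult k r \<le>o lex_by f r k"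
  proof -
    \<comment> \<open>A fibre has the cardinality of \<open>k\<close>, and a well-order on that many
      elements is at least as long as the cardinal; so \<open>k\<close> embeds increasingly into
      each fibre.\<close>
    have "\<exists>g. (\<forall>x\<in>Field k. g x \<in> Field k \<and> f (g x) = a) \<and>
        (\<forall>x y. (x, y) \<in> k \<and> x \<noteq> y \<longrightarrow> (g x, g y) \<in> k \<and> g x \<noteq> g y)" if a: "a \<in> Field r" for a
    proof -
      let ?S = "{x \<in> Field k. f x = a}"
      have WS: "Well_order (Restr k ?S)" by (rule Well_order_Restr[OF Wk])
      have FS: "Field (Restr k ?S) = ?S" using Well_order_Field_Restr[OF Wk, of ?S] by blast
      have "well_order_on ?S (Restr k ?S)" using WS unfolding FS .
      then have "|?S| \<le>o Restr k ?S" by (rule card_of_least)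
      then have "k \<le>o Restr k ?S" using fibre[OF a] ordLeq_transitive by blast
      then obtain g where g: "\<forall>x\<in>Field k. g x \<in> Field (Restr k ?S)"
        "\<forall>x y. (x, y) \<in> k \<and> x \<noteq> y \<longrightarrow> (g x, g y) \<in> Restr k ?S \<and> g x \<noteq> g y"
        using ordLeq_iff_strict_mono[OF Wk WS] by blast
      show ?thesis by (rule exI[of _ g]) (use g FS in blast)
    qed
    then have "\<forall>a\<in>Field r. \<exists>g. (\<forall>x\<in>Field k. g x \<in> Field k \<and> f (g x) = a) \<and>
        (\<forall>x y. (x, y) \<in> k \<and> x \<noteq> y \<longrightarrow> (g x, g y) \<in> k \<and> g x \<noteq> g y)" by blast
    from bchoice[OF this] obtain G where G: "\<And>a x. a \<in> Field r \<Longrightarrow> x \<in> Field k \<Longrightarrow> G a x \<in> Field k \<and> f (G a x) = a"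
      "\<And>a x y. a \<in> Field r \<Longrightarrow> (x, y) \<in> k \<Longrightarrow> x \<noteq> y \<Longrightarrow> (G a x, G a y) \<in> k \<and> G a x \<noteq> G a y" by metis
    show ?thesis
    proof (rule ordLeq_strict_mono[OF Wm Wl, where f = "\<lambda>(a, x). G a x"])
      fix u v assume uv: "(u, v) \<in> ord_mult k r" "u \<noteq> v"
      obtain a x b y where u: "u = (a, x)" "v = (b, y)" by (metis prod.exhaust)
      have F: "a \<in> Field r" "b \<in> Field r" "x \<in> Field k" "y \<in> Field k" using uv(1) unfolding u ord_mult_iff by blast+
      note Ga = G(1)[OF F(1,3)] and Gb = G(1)[OF F(2,4)]
      have "(G a x, G b y) \<in> lex_by f r k \<and> G a x \<noteq> G b y"
      proof (cases "a = b")
        case True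
        then have "(x, y) \<in> k" "x \<noteq> y" using uv unfolding u ord_mult_iff by blast+
        then show ?thesis using G(2)[OF F(1)] Ga Gb True unfolding lex_by_def by simp
      next
        case False
        then have "(a, b) \<in> r" using uv unfolding u ord_mult_iff by blast
        moreover have "G a x \<noteq> G b y" using Ga Gb False by metis
        ultimately show ?thesis using Ga Gb False unfolding lex_by_def by simp
      qed
      then show "((case u of (a, x) \<Rightarrow> G a x), (case v of (a, x) \<Rightarrow> G a x)) \<in> lex_by f r k \<and>
          (case u of (a, x) \<Rightarrow> G a x) \<noteq> (case v of (a, x) \<Rightarrow> G a x)" unfolding u by simp
    next
      fix u assume "u \<in> Field (ord_mult k r)"
      then show "(case u of (a, x) \<Rightarrow> G a x) \<in> Field (lex_by f r k)"
        using G(1) unfolding Fl Field_ord_mult[OF Wk] by auto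
    qed
  qed
  ultimately show ?thesis unfolding ordIso_iff_ordLeq by blast
qed

section \<open>Division of ordinals by the cardinal\<close>

context scaled_exponents
begin

lemma image_t_strict_mono: "A < B \<Longrightarrow> image_mset t A < image_mset t B"
  by (rule image_mset_strict_mono) (auto intro: t_mono)

lemma image_t_le_iff [simp]: "image_mset t A \<le> image_mset t B \<longleftrightarrow> A \<le> B"
  by (metis image_t_strict_mono leD leI order_less_le)

text \<open>Otherwise \<open>image_mset t B\<close> would be \<open>image_mset t A\<close> plus a
  remainder with exponents below \<open>t bot_exp\<close>. No exponent in the image is that small,
  so the remainder would vanish.\<close>

lemma image_t_add_less:
  assumes "A < B" "H < {#t bot_exp#}"
  shows "image_mset t A + H < image_mset t B"
proof (rule ccontr)
  assume n: "\<not> ?thesis"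
  have "image_mset t A \<le> image_mset t B" using assms(1) by simp
  moreover have "image_mset t A + H < image_mset t A + {#t bot_exp#}" using assms(2) by (rule add_strict_left_mono)
  then have "image_mset t B < image_mset t A + {#t bot_exp#}" using n by (metis leI le_less_trans)
  moreover have "d \<le> e" if "d \<in># {#t bot_exp#}" "e \<in># image_mset t A" for d e
    using that bot_exp_le by auto
  ultimately obtain P' where P': "image_mset t B = image_mset t A + P'" "P' < {#t bot_exp#}"
    using mset_split_interval by blast
  have "P' = {#}"
  proof (rule ccontr)
    assume "P' \<noteq> {#}"
    then obtain e where e: "e \<in># P'" by blast
    then have "e \<in># image_mset t B" unfolding P'(1) by simp
    then have "t bot_exp \<le> e" using bot_exp_le by auto
    moreover have "e < t bot_exp" using P'(2) e by simp
    ultimately show False by simp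
  qed
  then have "image_mset t B \<le> image_mset t A" using P'(1) by simp
  then show False using assms(1) by simp
qed

text \<open>Division with remainder: the exponents of \<open>P\<close> below
  \<open>t bot_exp\<close> make up the remainder, and the others are values of \<open>t\<close> by
  \<open>t_convex\<close>, which gives the quotient.\<close>

lemma image_t_decompose:
  assumes P: "P < image_mset t Q"
  shows "\<exists>A H. P = image_mset t A + H \<and> A < Q \<and> H < {#t bot_exp#}"
proof -
  define H where "H = filter_mset (\<lambda>e. e < t bot_exp) P"
  define B where "B = filter_mset (\<lambda>e. \<not> e < t bot_exp) P"
  have PBH: "P = B + H" unfolding B_def H_def by (metis add.commute multiset_partition)
  have "Q \<noteq> {#}" using P by auto
  have range: "e \<in> range t" if "e \<in># B" for e
  proof -
    have e: "e \<in># P" "t bot_exp \<le> e" using that unfolding B_def by auto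
    have "\<exists>c. e \<le> t c"
    proof (rule ccontr)
      assume n: "\<nexists>c. e \<le> t c"
      then have "\<forall>x\<in>#image_mset t Q. x < e" by (auto simp: not_le)
      then have "image_mset t Q < {#e#}" by simp
      also have "{#e#} \<le> P" using e(1) by (intro subset_eq_imp_le_multiset) simp
      finally show False using P by simp
    qed
    then obtain c where "e < t c \<or> e = t c" by (auto simp: le_less)
    then show ?thesis using t_convex[OF e(2)] by blast
  qed
  define A where "A = image_mset (inv t) B"
  have "image_mset t A = image_mset (\<lambda>e. t (inv t e)) B" unfolding A_def by (simp add: image_mset.compositionality comp_def)
  also have "\<dots> = image_mset (\<lambda>e. e) B" by (rule image_mset_cong) (simp add: f_inv_into_f[OF range])
  finally have A: "image_mset t A = B" by simp
  have H: "H < {#t bot_exp#}" unfolding H_def by simp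
  have "image_mset t A \<le> P" unfolding A PBH by simp
  then have "image_mset t A < image_mset t Q" using P by (rule le_less_trans)
  then have "A < Q" by (metis image_t_le_iff leD leI)
  then show ?thesis using PBH A H by blast
qed

text \<open>Position \<open>x\<close> in copy \<open>a\<close> goes to the ordinal with quotient
  \<open>g a\<close> and remainder \<open>f x\<close>; \<open>below_ordLeq_ord_mult\<close> inverts
  this by division.\<close>

lemma ord_mult_ordLeq_below:
  assumes k: "k \<le>o below {#t bot_exp#}" and q: "q \<le>o below Q"
  shows "ord_mult k q \<le>o below (image_mset t Q)"
proof -
  have Wk: "Well_order k" and Wq: "Well_order q" using k q unfolding ordLeq_def by blast+
  obtain f where f1: "\<forall>x\<in>Field k. f x < {#t bot_exp#}" and f2: "\<forall>x y. (x, y) \<in> k \<and> x \<noteq> y \<longrightarrow> f x < f y"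
    using k unfolding ordLeq_below_iff[OF Wk] by blast
  obtain g where g1: "\<forall>x\<in>Field q. g x < Q" and g2: "\<forall>x y. (x, y) \<in> q \<and> x \<noteq> y \<longrightarrow> g x < g y"
    using q unfolding ordLeq_below_iff[OF Wq] by blast
  define h where "h u = image_mset t (g (fst u)) + f (snd u)" for u
  have h1: "h u < image_mset t Q" if "u \<in> Field q \<times> Field k" for u
    unfolding h_def by (rule image_t_add_less) (use that g1 f1 in auto)
  show ?thesis
    unfolding ordLeq_below_iff[OF Well_order_ord_mult[OF Wk Wq]] Field_ord_mult[OF Wk]
  proof (intro exI[of _ h] conjI ballI allI impI h1)
    fix u v assume uv: "(u, v) \<in> ord_mult k q \<and> u \<noteq> v"
    obtain a x b y where u: "u = (a, x)" "v = (b, y)" by (metis prod.exhaust)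
    have F: "x \<in> Field k" using uv unfolding u ord_mult_iff by blast
    show "h u < h v"
    proof (cases "a = b")
      case True
      then have "f x < f y" using uv f2 unfolding u ord_mult_iff by blast
      then show ?thesis using True by (simp add: h_def u)
    next
      case False
      then have "g a < g b" using uv g2 unfolding u ord_mult_iff by blast
      then have "h u < image_mset t (g b)" using image_t_add_less f1 F unfolding h_def u by simp
      also have "\<dots> \<le> h v" by (simp add: h_def u)
      finally show ?thesis .
    qed
  qed
qed

lemma below_ordLeq_ord_mult:
  assumes k: "below {#t bot_exp#} \<le>o k" and q: "below Q \<le>o q"
  shows "below (image_mset t Q) \<le>o ord_mult k q"
proof -
  have Wk: "Well_order k" and Wq: "Well_order q" using k q unfolding ordLeq_def by blast+
  obtain f where f: "\<forall>x<{#t bot_exp#}. f x \<in> Field k"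
    "\<forall>x y. x < y \<and> y < {#t bot_exp#} \<longrightarrow> (f x, f y) \<in> k \<and> f x \<noteq> f y"
    using k unfolding below_ordLeq_iff[OF Wk] by blast
  obtain g where g: "\<forall>x<Q. g x \<in> Field q" "\<forall>x y. x < y \<and> y < Q \<longrightarrow> (g x, g y) \<in> q \<and> g x \<noteq> g y"
    using q unfolding below_ordLeq_iff[OF Wq] by blast
  have f1: "f H \<in> Field k" if "H < {#t bot_exp#}" for H using f(1) that by blast
  have g1: "g A \<in> Field q" if "A < Q" for A using g(1) that by blast
  have f2: "(f G, f H) \<in> k \<and> f G \<noteq> f H" if "G < H" "H < {#t bot_exp#}" for G H using f(2) that by blast
  have g2: "(g A, g B) \<in> q \<and> g A \<noteq> g B" if "A < B" "B < Q" for A B using g(2) that by blast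
  have "\<forall>P\<in>{..<image_mset t Q}. \<exists>AH. P = image_mset t (fst AH) + snd AH \<and> fst AH < Q \<and> snd AH < {#t bot_exp#}"
    using image_t_decompose by simp
  from bchoice[OF this] obtain D where D: "\<And>P. P < image_mset t Q \<Longrightarrow> P = image_mset t (fst (D P)) + snd (D P)"
    "\<And>P. P < image_mset t Q \<Longrightarrow> fst (D P) < Q" "\<And>P. P < image_mset t Q \<Longrightarrow> snd (D P) < {#t bot_exp#}"
    by (metis lessThan_iff)
  define h where "h P = (g (fst (D P)), f (snd (D P)))" for P
  show ?thesis
    unfolding below_ordLeq_iff[OF Well_order_ord_mult[OF Wk Wq]] Field_ord_mult[OF Wk]
  proof (rule exI[of _ h], rule conjI[rotated], (rule allI)+, rule impI)
    fix P P' assume "P < P' \<and> P' < image_mset t Q"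
    then have PP: "P < P'" "P' < image_mset t Q" "P < image_mset t Q" by auto
    note D1 = D[OF PP(3)] and D2 = D[OF PP(2)]
    have "fst (D P) \<le> fst (D P')"
    proof (rule ccontr)
      assume "\<not> ?thesis"
      then have "fst (D P') < fst (D P)" by simp
      from image_t_add_less[OF this D2(3)] have "P' < image_mset t (fst (D P))" using D2(1) by simp
      also have "\<dots> \<le> image_mset t (fst (D P)) + snd (D P)" by simp
      also have "\<dots> = P" using D1(1) by simp
      finally show False using PP(1) by simp
    qed
    then consider "fst (D P) < fst (D P')" | "fst (D P) = fst (D P')" by (auto simp: le_less)
    then show "(h P, h P') \<in> ord_mult k q \<and> h P \<noteq> h P'"
    proof cases
      case 1
      then show ?thesis unfolding h_def ord_mult_iff
        using g2[OF 1 D2(2)] g1[OF D1(2)] g1[OF D2(2)] f1[OF D1(3)] f1[OF D2(3)] by simp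
    next
      case 2
      have "image_mset t (fst (D P)) + snd (D P) < image_mset t (fst (D P)) + snd (D P')"
        using PP(1) D1(1) D2(1) 2 by metis
      then have "snd (D P) < snd (D P')" by simp
      from f2[OF this D2(3)] show ?thesis unfolding h_def ord_mult_iff
        using 2 g1[OF D1(2)] g1[OF D2(2)] f1[OF D1(3)] f1[OF D2(3)] by simp
    qed
  next
    show "\<forall>P<image_mset t Q. h P \<in> Field q \<times> Field k"
      unfolding h_def using g1 f1 D(2,3) by simp
  qed
qed

end

lemma Restr_underS_le: "Restr {(x, y). x \<le> y} (underS {(x, y). x \<le> y} e) = below (e :: 'e::wellorder)"
proof -
  have eq: "underS {(x, y). x \<le> y} e = {..<e}" by (auto simp: underS_def)
  have "(x, y) \<in> Restr {(x, y). x \<le> y} {..<e} \<longleftrightarrow> (x, y) \<in> below e" for x y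
    unfolding below_def using le_less_trans[of x y e] by simp blast
  then show ?thesis unfolding eq by (intro set_eqI) (simp only: split_paired_all)
qed

lemma Field_le: "Field {(x, y). x \<le> (y :: 'e::wellorder)} = UNIV"
  by (rule Field_linear_order_on[OF well_order_on_le[unfolded well_order_on_def, THEN conjunct1]])

text \<open>Otherwise the whole of \<open>'a suc\<close> would have the type of one of its proper
  initial segments.\<close>

lemma card_UNIV_suc: "\<not> |UNIV :: 'a suc set| \<le>o |UNIV :: 'a set|"
proof
  let ?r = "{(x, y). x \<le> (y :: 'a suc)}"
  note F = Field_le[where 'e = "'a suc"]
  have W: "Well_order ?r" unfolding F by (rule well_order_on_le)
  assume "|UNIV :: 'a suc set| \<le>o |UNIV :: 'a set|"
  then have "|Field ?r| \<le>o |UNIV :: 'a set|" unfolding F .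
  from ordIso_below_suc[OF W this] obtain e :: "'a suc" where e: "?r =o below e" by blast
  have "Restr ?r (underS ?r e) <o ?r" by (rule Restr_underS_ordLess[OF W]) (simp only: F UNIV_I)
  then have "below e <o ?r" unfolding Restr_underS_le .
  with e have "?r <o ?r" by (rule ordIso_ordLess_trans)
  then show False using ordLess_irreflexive by blast
qed

text \<open>The infinite cardinal is a power \<omega>^e0, and \<open>t c\<close> is the ordinal sum
  of e0 and \<open>c\<close>, so that \<omega>^(t c) consists of \<omega>^c copies of the cardinal.
  The type \<open>'k + 'q\<close> gives room for both kinds of exponents.\<close>

lemma scaled_exponents_exist:
  fixes k :: "'k rel"
  assumes k: "Cinfinite k"
  shows "\<exists>t :: 'q suc \<Rightarrow> ('k + 'q) suc. scaled_exponents exps esum t \<and> k =o below {#t bot_exp#}"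
proof -
  let ?U = "UNIV :: ('k + 'q) set"
  have K: "Card_order k" "Well_order k" "infinite (Field k)"
    using k card_order_on_well_order_on by (auto simp: cinfinite_def)
  have kU: "|Field k| \<le>o |?U|" by (rule card_of_ordLeqI[where f = Inl]) (auto simp: inj_on_def)
  then have infU: "infinite ?U" using K(3) card_of_ordLeq_finite by blast
  obtain C :: "('k + 'q) suc multiset" where C: "k =o below C" using ordIso_below_mset[OF K(2) kU] by blast
  then obtain e0 where e0: "C = {#e0#}" using card_order_below_single[OF k] by blast
  let ?r = "{(x, y). x \<le> (y :: 'q suc)}"
  let ?s = "Restr {(x, y). x \<le> (y :: ('k + 'q) suc)} {e0..}"
  note Fr = Field_le[where 'e = "'q suc"]
  have Wr: "Well_order ?r" unfolding Fr by (rule well_order_on_le)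
  have W: "Well_order {(x, y). x \<le> (y :: ('k + 'q) suc)}" unfolding Field_le by (rule well_order_on_le)
  have Ws: "Well_order ?s" by (rule Well_order_Restr[OF W])
  have Fs: "Field ?s = {e0..}" unfolding Well_order_Field_Restr[OF W] Field_le by simp
  \<comment> \<open>Were the exponents from \<open>e0\<close> on shorter than \<open>'q suc\<close>,
    they would number at most as many as \<open>'q\<close> has elements; together with those below
    \<open>e0\<close> the exponent type would be no larger than \<open>'k + 'q\<close>.\<close>
  have "\<not> ?s <o ?r"
  proof
    assume "?s <o ?r"
    then obtain e where e: "?s =o Restr ?r (underS ?r e)" using ordLess_iff_ordIso_Restr[OF Wr Ws] by blast
    have "|{e0..}| =o |{..<e}|" using card_of_cong[OF e] unfolding Fs Restr_underS_le by simp
    also have "|{..<e}| \<le>o |UNIV :: 'q set|" by (rule card_lessThan_suc)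
    also have "|UNIV :: 'q set| \<le>o |?U|" by (rule card_of_ordLeqI[where f = Inr]) (auto simp: inj_on_def)
    finally have "|{e0..}| \<le>o |?U|" .
    moreover have "|{..<e0}| \<le>o |?U|" by (rule card_lessThan_suc)
    moreover have "infinite (Field |?U| )" unfolding Field_card_of by (rule infU)
    ultimately have "|{..<e0} \<union> {e0..}| \<le>o |?U|"
      using card_of_Un_ordLeq_infinite_Field[OF _ _ _ card_of_Card_order] by blast
    moreover have "{..<e0} \<union> {e0..} = UNIV" by auto
    ultimately show False using card_UNIV_suc by metis
  qed
  then have "?r \<le>o ?s" using Wr Ws not_ordLess_iff_ordLeq by blast
  then obtain t where t: "embed ?r ?s t" unfolding ordLeq_def by blast
  have t_inj: "inj t" using embed_inj_on[OF Wr t] unfolding Fr .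
  have t_le: "e0 \<le> t x \<and> t x \<le> t y" if "x \<le> y" for x y
    using embed_compat[OF t] that unfolding compat_def by auto
  have t_less: "t x < t y" if "x < y" for x y
    using t_le[of x y] that injD[OF t_inj, of x y] by (auto simp: less_le)
  interpret s: wo_rel ?s using Ws by (simp add: wo_rel_def)
  have "s.ofilter (t ` Field ?r)" by (rule embed_Field_ofilter[OF Wr Ws t])
  then have under: "\<forall>a\<in>range t. s.under a \<subseteq> range t" unfolding s.ofilter_def Fr by (rule conjunct2)
  have init: "e \<in> range t" if "e0 \<le> e" "e \<le> t c" for e c
  proof -
    have "e0 \<le> t c" using that by (rule order_trans)
    then have "e \<in> s.under (t c)" using that unfolding under_def by simp
    moreover have "s.under (t c) \<subseteq> range t" by (rule bspec[OF under rangeI])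
    ultimately show ?thesis by (rule subsetD[rotated])
  qed
  have "e0 \<in> range t" by (rule init[OF order_refl, of bot_exp]) (use t_le in blast)
  then obtain x where "e0 = t x" by blast
  moreover have "t bot_exp \<le> t x" using t_le bot_exp_le by blast
  ultimately have bot: "t bot_exp = e0" using t_le[of bot_exp bot_exp] by simp
  have kb: "k =o below {#t bot_exp#}" using C unfolding e0 bot .
  have "scaled_exponents exps esum t"
  proof
    show "x < y \<Longrightarrow> t x < t y" for x y by (rule t_less)
    show "e \<in> range t" if "t bot_exp \<le> e" "e < t c" for e c
      by (rule init[OF that(1)[unfolded bot] less_imp_le[OF that(2)]])
    show "Card_order (below {#t bot_exp#})" by (rule Card_order_ordIso2[OF K(1) kb])
  qed
  then show ?thesis using kb by blast
qed

section \<open>The main theorem\<close>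

lemma mset_family:
  fixes q :: "nat \<Rightarrow> 'q rel"
  assumes "\<forall>i\<in>{1..n}. Well_order (q i)"
  obtains Q :: "nat \<Rightarrow> 'q suc multiset"
  where "\<And>i. i \<in> {1..n} \<Longrightarrow> q i =o below (Q i)" "\<And>i. i \<in> {1..n} \<Longrightarrow> set_mset (Q i) \<subseteq> exps"
proof -
  have "\<forall>i\<in>{1..n}. \<exists>M :: 'q suc multiset. q i =o below M"
    using assms ordIso_below_mset[OF _ card_of_mono1[OF subset_UNIV]] by blast
  from bchoice[OF this] obtain Q :: "nat \<Rightarrow> 'q suc multiset" where Q: "\<forall>i\<in>{1..n}. q i =o below (Q i)" by blast
  show ?thesis by (rule that[of Q]) (use Q exps_of_ordIso in blast)+
qed

lemma wpo_length_INT_ordLeq: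
  fixes \<kappa> :: "'k rel" and q :: "nat \<Rightarrow> 'q rel" and le :: "nat \<Rightarrow> 'a rel"
  assumes k: "Cinfinite \<kappa>" and n: "n \<ge> 1" and q: "\<forall>i\<in>{1..n}. Well_order (q i)"
    and le: "\<And>i. i \<in> {1..n} \<Longrightarrow> wpo_on X (le i)"
      "\<And>i. i \<in> {1..n} \<Longrightarrow> wpo_length X (le i) \<le>o ord_mult \<kappa> (q i)"
  shows "wpo_length X (\<Inter>i\<in>{1..n}. le i) \<le>o ord_mult \<kappa> (hessenberg_prod q n)"
proof -
  obtain Q :: "nat \<Rightarrow> 'q suc multiset" where Q: "\<And>i. i \<in> {1..n} \<Longrightarrow> q i =o below (Q i)"
    "\<And>i. i \<in> {1..n} \<Longrightarrow> set_mset (Q i) \<subseteq> exps" using mset_family[OF q] by blast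
  obtain t :: "'q suc \<Rightarrow> ('k + 'q) suc" where t: "scaled_exponents exps esum t" "\<kappa> =o below {#t bot_exp#}"
    using scaled_exponents_exist[OF k] by blast
  interpret t: scaled_exponents exps esum t by (rule t(1))
  let ?R = "\<Inter>i\<in>{1..n}. le i"
  have wpoR: "wpo_on X ?R" using n le(1) by (intro wpo_INT) auto
  have Restr_X: "Restr r X = r" if "wpo_on X r" for r
    using that unfolding wpo_on_def order_on_defs by blast
  have "len_le (le i) X (image_mset t (Q i))" if i: "i \<in> {1..n}" for i
    unfolding len_le_def Restr_X[OF le(1)[OF i]]
  proof (intro allI impI)
    fix l assume "linear_extension_on X (le i) l"
    then have "l \<le>o wpo_length X (le i)" by (rule wpo_length(2)[OF le(1)[OF i]])
    also note le(2)[OF i]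
    also have "ord_mult \<kappa> (q i) \<le>o below (image_mset t (Q i))"
      by (rule t.ord_mult_ordLeq_below[OF ordIso_imp_ordLeq[OF t(2)] ordIso_imp_ordLeq[OF Q(1)[OF i]]])
    finally show "l \<le>o below (image_mset t (Q i))" .
  qed
  then have "len_le ?R X (image_mset t (suc.mprod Q n))"
    by (intro t.len_le_INT[OF n le(1) subset_refl Q(2)])
  then have "wpo_length X ?R \<le>o below (image_mset t (suc.mprod Q n))"
    using wpo_length(1)[OF wpoR] unfolding len_le_def Restr_X[OF wpoR] by blast
  also have "below (image_mset t (suc.mprod Q n)) \<le>o ord_mult \<kappa> (hessenberg_prod q n)"
    by (intro t.below_ordLeq_ord_mult ordIso_imp_ordLeq ordIso_symmetric[OF t(2)]
        ordIso_symmetric[OF hessenberg_prod_eq] Q)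
  finally show ?thesis .
qed

text \<open>A tuple is its restriction together with its last entry. It suffices to extend the
  product of two well-orders, \<open>T\<close> on the restrictions and the last \<open>q\<close>,
  since \<open>T\<close> already extends the product ordering of the earlier factors.\<close>

lemma lin_ext_PiE:
  fixes q :: "nat \<Rightarrow> 'q rel"
  assumes q: "\<And>i. i \<in> {1..n} \<Longrightarrow> Well_order (q i)"
    and Q: "\<And>i. i \<in> {1..n} \<Longrightarrow> q i =o below (Q i)" "\<And>i. i \<in> {1..n} \<Longrightarrow> set_mset (Q i) \<subseteq> exps"
  defines "W \<equiv> \<lambda>m. PiE {1..m} (\<lambda>i. Field (q i))"
  shows "\<exists>T. well_order_on (W n) T \<and>
    (\<forall>u\<in>W n. \<forall>v\<in>W n. (\<forall>i\<in>{1..n}. (u i, v i) \<in> q i) \<longrightarrow> (u, v) \<in> T) \<and>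
    below (suc.mprod Q n) \<le>o T"
  using q Q
proof (induction n)
  case 0
  define w where "w = (\<lambda>_ :: nat. undefined :: 'q)"
  have W0: "W 0 = {w}" unfolding W_def w_def by simp
  have wo: "well_order_on {w} {(w, w)}"
    using linear_order_on_well_order_on[of "{(w, w)}" "{w}"] by simp
  moreover have "below {#bot_exp#} \<le>o {(w, w)}"
  proof (rule below_bot_ordLeq)
    have "Field {(w, w)} = {w}" by (auto simp: Field_def)
    then show "Well_order {(w, w)}" "w \<in> Field {(w, w)}" using wo by simp_all
  qed
  ultimately show ?case unfolding W0 by (intro exI[of _ "{(w, w)}"]) simp
next
  case (Suc n)
  have "\<exists>T. well_order_on (W n) T \<and>
    (\<forall>u\<in>W n. \<forall>v\<in>W n. (\<forall>i\<in>{1..n}. (u i, v i) \<in> q i) \<longrightarrow> (u, v) \<in> T) \<and> below (suc.mprod Q n) \<le>o T"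
    by (rule Suc.IH) (use Suc.prems in auto)
  then obtain T where T: "well_order_on (W n) T"
    "\<And>u v. u \<in> W n \<Longrightarrow> v \<in> W n \<Longrightarrow> (\<And>i. i \<in> {1..n} \<Longrightarrow> (u i, v i) \<in> q i) \<Longrightarrow> (u, v) \<in> T"
    "below (suc.mprod Q n) \<le>o T" by blast
  let ?q = "q (Suc n)"
  have T1: "antisym T" "Field T = W n" "Well_order T"
    using T(1) Field_linear_order_on[of "W n" T] by (auto simp: well_order_on_def linear_order_on_def partial_order_on_def)
  have Wq: "Well_order ?q" "antisym ?q" using Suc.prems(1)[of "Suc n"] by (auto simp: order_on_defs)
  define \<rho> where "\<rho> u = restrict u {1..n}" for u :: "nat \<Rightarrow> 'q"
  define s where "s = {(u, v) \<in> W (Suc n) \<times> W (Suc n). (\<rho> u, \<rho> v) \<in> T \<and> (u (Suc n), v (Suc n)) \<in> ?q}"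
  have \<rho>W: "\<rho> u \<in> W n" if "u \<in> W (Suc n)" for u
    using that unfolding W_def \<rho>_def PiE_def Pi_def by auto
  have lastW: "u (Suc n) \<in> Field ?q" if "u \<in> W (Suc n)" for u
    using that unfolding W_def by (auto dest: PiE_mem)
  have ext: "u = v" if "u \<in> W (Suc n)" "v \<in> W (Suc n)" "\<rho> u = \<rho> v" "u (Suc n) = v (Suc n)" for u v
  proof (rule PiE_ext)
    show "u \<in> PiE {1..Suc n} (\<lambda>i. Field (q i))" "v \<in> PiE {1..Suc n} (\<lambda>i. Field (q i))"
      using that(1,2) unfolding W_def by auto
    fix i assume i: "i \<in> {1..Suc n}"
    show "u i = v i"
    proof (cases "i = Suc n")
      case False
      then have "i \<in> {1..n}" using i by auto
      then show ?thesis using fun_cong[OF that(3), of i] unfolding \<rho>_def by simp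
    qed (use that(4) in simp)
  qed
  have wpo_s: "wpo_on (W (Suc n)) s"
    unfolding s_def using wpo_on_product[OF wpo_on_well_order[OF T(1)] wpo_on_well_order[OF Wq(1)] \<rho>W lastW ext] .
  obtain f where f: "\<forall>x<suc.mprod Q n. f x \<in> Field T"
    "\<forall>x y. x < y \<and> y < suc.mprod Q n \<longrightarrow> (f x, f y) \<in> T \<and> f x \<noteq> f y"
    using T(3) unfolding below_ordLeq_iff[OF T1(3)] by blast
  have "below (Q (Suc n)) \<le>o ?q"
    using Suc.prems(2)[of "Suc n"] ordIso_symmetric ordIso_imp_ordLeq by auto
  then obtain g where g: "\<forall>x<Q (Suc n). g x \<in> Field ?q"
    "\<forall>x y. x < y \<and> y < Q (Suc n) \<longrightarrow> (g x, g y) \<in> ?q \<and> g x \<noteq> g y"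
    unfolding below_ordLeq_iff[OF Wq(1)] by blast
  have fW: "f x \<in> W n" if "x < suc.mprod Q n" for x using f(1) that T1(2) by blast
  have gq: "g y \<in> Field ?q" if "y < Q (Suc n)" for y using g(1) that by blast
  have f_refl: "x \<le> x'" if "(f x, f x') \<in> T" "x < suc.mprod Q n" for x x'
    using f(2) that antisymD[OF T1(1) that(1)] by (metis not_le)
  have g_refl: "y \<le> y'" if "(g y, g y') \<in> ?q" "y < Q (Suc n)" for y y'
    using g(2) that antisymD[OF Wq(2) that(1)] by (metis not_le)
  define h where "h p = (f (fst p))(Suc n := g (snd p))" for p
  let ?D = "{..<suc.mprod Q n} \<times> {..<Q (Suc n)}"
  have hW: "h p \<in> W (Suc n)" "\<rho> (h p) = f (fst p)" "h p (Suc n) = g (snd p)" if "p \<in> ?D" for p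
  proof -
    have "fst p < suc.mprod Q n" "snd p < Q (Suc n)" using that by auto
    then have fp: "f (fst p) \<in> PiE {1..n} (\<lambda>i. Field (q i))" and gp: "g (snd p) \<in> Field ?q"
      using fW gq unfolding W_def by blast+
    show "h p \<in> W (Suc n)"
      unfolding W_def h_def
    proof (rule PiE_I)
      fix i assume "i \<in> {1..Suc n}"
      then show "((f (fst p))(Suc n := g (snd p))) i \<in> Field (q i)"
        using PiE_mem[OF fp, of i] gp by (cases "i = Suc n") auto
    next
      fix i assume "i \<notin> {1..Suc n}"
      then show "((f (fst p))(Suc n := g (snd p))) i = undefined"
        using PiE_arb[OF fp, of i] by auto
    qed
    show "\<rho> (h p) = f (fst p)"
    proof
      fix i show "\<rho> (h p) i = f (fst p) i"
        using PiE_arb[OF fp, of i] unfolding \<rho>_def h_def by (cases "i \<in> {1..n}") auto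
    qed
    show "h p (Suc n) = g (snd p)" by (simp add: h_def)
  qed
  have refl: "(p, p') \<in> prod_le" if p: "p \<in> ?D" "p' \<in> ?D" "(h p, h p') \<in> s" for p p'
  proof -
    have "(f (fst p), f (fst p')) \<in> T" "(g (snd p), g (snd p')) \<in> ?q"
      using p(3) hW[OF p(1)] hW[OF p(2)] unfolding s_def by auto
    then show ?thesis using f_refl g_refl p(1) unfolding prod_le_def by auto
  qed
  have "len_ge prod_le ?D (suc.mmult (suc.mprod Q n) (Q (Suc n)))"
    by (rule suc.len_ge_prod) (use suc.mprod_E[of n Q] Suc.prems(3) in auto)
  then have "len_ge s (W (Suc n)) (suc.mmult (suc.mprod Q n) (Q (Suc n)))"
  proof (rule len_ge_transport[OF wpo_prod_le wpo_s subset_UNIV subset_refl, rotated -1])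
    show "inj_on h ?D"
    proof (rule inj_onI)
      fix p p' assume p: "p \<in> ?D" "p' \<in> ?D" "h p = h p'"
      have "(h p, h p) \<in> s" using wpo_s hW(1)[OF p(1)] by (auto simp: wpo_on_def order_on_defs refl_on_def)
      then have "(p, p') \<in> prod_le" "(p', p) \<in> prod_le" using refl p by auto
      then show "p = p'" by (auto simp: prod_le_def prod_eq_iff)
    qed
    show "h ` ?D \<subseteq> W (Suc n)" using hW(1) by blast
  qed (rule refl)
  then obtain T' where T': "lin_ext s (W (Suc n)) T'" "below (suc.mprod Q (Suc n)) \<le>o T'"
    unfolding len_ge_def by auto
  have "well_order_on (W (Suc n)) T'"
    using lin_ext_Well_order[OF wpo_s subset_refl T'(1)] lin_ext_Field[OF T'(1)] by simp
  moreover have "(u, v) \<in> T'" if u: "u \<in> W (Suc n)" "v \<in> W (Suc n)"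
    and uv: "\<forall>i\<in>{1..Suc n}. (u i, v i) \<in> q i" for u v
  proof -
    have "(\<rho> u, \<rho> v) \<in> T"
    proof (rule T(2)[OF \<rho>W[OF u(1)] \<rho>W[OF u(2)]])
      fix i assume i: "i \<in> {1..n}"
      then have "(u i, v i) \<in> q i" using uv by auto
      then show "(\<rho> u i, \<rho> v i) \<in> q i" using i by (simp add: \<rho>_def)
    qed
    moreover have "(u (Suc n), v (Suc n)) \<in> ?q" using uv by auto
    ultimately have "(u, v) \<in> s" using u unfolding s_def by simp
    then show ?thesis using T'(1) u unfolding lin_ext_iff by blast
  qed
  ultimately show ?case using T'(2) by blast
qed

lemma card_PiE_ordLeq:
  assumes "finite I" and "infinite K" and "\<And>i. i \<in> I \<Longrightarrow> |F i| \<le>o |K|"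
  shows "|PiE I F| \<le>o |K|"
  using assms(1,3)
proof (induction I)
  case empty
  show ?case using assms(2) by (simp add: finite_ordLeq_infinite)
next
  case (insert i I)
  have "|PiE (insert i I) F| \<le>o |F i \<times> PiE I F|" unfolding PiE_insert_eq by (rule card_of_image)
  also have "|F i \<times> PiE I F| \<le>o |K|"
  proof (rule card_of_Times_ordLeq_infinite_Field[OF _ _ _ card_of_Card_order])
    show "infinite (Field |K| )" using assms(2) by (simp add: Field_card_of)
  qed (use insert in auto)
  finally show ?case .
qed

lemma length_attained:
  fixes \<kappa> :: "'k rel" and q :: "nat \<Rightarrow> 'q rel"
  assumes k: "Cinfinite \<kappa>" and n: "n \<ge> 1" and q: "\<forall>i\<in>{1..n}. Well_order (q i)"
    and ne: "\<forall>i\<in>{1..n}. Field (q i) \<noteq> {} \<and> |Field (q i)| \<le>o \<kappa>"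
  shows "\<exists>le :: nat \<Rightarrow> 'k rel.
    (\<forall>i\<in>{1..n}. well_order_on (Field \<kappa>) (le i) \<and> le i =o ord_mult \<kappa> (q i)) \<and>
    (\<exists>l. linear_extension_on (Field \<kappa>) (\<Inter>i\<in>{1..n}. le i) l \<and> ord_mult \<kappa> (hessenberg_prod q n) \<le>o l)"
proof -
  have K: "Card_order \<kappa>" "Well_order \<kappa>" "infinite (Field \<kappa>)"
    using k card_order_on_well_order_on by (auto simp: cinfinite_def)
  have Kiso: "\<kappa> =o |Field \<kappa>|" "|Field \<kappa>| =o \<kappa>"
    using card_of_Field_ordIso[OF K(1)] ordIso_symmetric by blast+
  let ?K = "Field \<kappa>" and ?W = "PiE {1..n} (\<lambda>i. Field (q i))"
  obtain Q :: "nat \<Rightarrow> 'q suc multiset" where Q: "\<And>i. i \<in> {1..n} \<Longrightarrow> q i =o below (Q i)"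
    "\<And>i. i \<in> {1..n} \<Longrightarrow> set_mset (Q i) \<subseteq> exps" using mset_family[OF q] by blast
  have "Well_order (q i)" if "i \<in> {1..n}" for i using q that by blast
  from lin_ext_PiE[of n q Q, OF this Q] obtain T where T: "well_order_on ?W T"
    "\<And>u v. u \<in> ?W \<Longrightarrow> v \<in> ?W \<Longrightarrow> \<forall>i\<in>{1..n}. (u i, v i) \<in> q i \<Longrightarrow> (u, v) \<in> T"
    "below (suc.mprod Q n) \<le>o T" by blast
  have FT: "Field T = ?W" using T(1) Field_linear_order_on unfolding well_order_on_def by blast
  have WT: "Well_order T" using T(1) unfolding FT .
  have W_le: "|?W| \<le>o |?K|"
    by (rule card_PiE_ordLeq[OF finite_atLeastAtMost K(3)]) (use ne Kiso(1) ordLeq_ordIso_trans in blast)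
  have W_ne: "\<exists>w\<in>?W. w i = a" if "i \<in> {1..n}" "a \<in> Field (q i)" for i a
  proof -
    have "\<forall>j\<in>{1..n}. \<exists>b. b \<in> Field (q j)" using ne by blast
    from bchoice[OF this] obtain b where b: "\<forall>j\<in>{1..n}. b j \<in> Field (q j)" by blast
    have "restrict (b(i := a)) {1..n} \<in> ?W" using b that(2) by auto
    moreover have "restrict (b(i := a)) {1..n} i = a" using that(1) by simp
    ultimately show ?thesis by blast
  qed
  have "?W \<noteq> {}" using ne by (simp add: PiE_eq_empty_iff)
  then have "|?W \<times> ?K| =o |?K|" using card_of_Times_infinite[OF K(3) _ W_le] by blast
  \<comment> \<open>The underlying set is \<open>Field \<kappa>\<close> itself. Only the tuple
    \<open>u x\<close> is read off through \<open>\<phi>\<close>; ties are broken by comparing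
    \<open>x\<close> in \<open>\<kappa>\<close> rather than the second coordinate, which works
    because every fibre of \<open>u\<close> has cardinality \<open>\<kappa>\<close>.\<close>
  then obtain \<phi> where \<phi>: "bij_betw \<phi> (?W \<times> ?K) ?K" using card_of_ordIso by blast
  define \<psi> where "\<psi> = inv_into (?W \<times> ?K) \<phi>"
  define u where "u x = fst (\<psi> x)" for x
  have \<psi>: "\<psi> x \<in> ?W \<times> ?K" if "x \<in> ?K" for x
    unfolding \<psi>_def by (rule inv_into_into) (use \<phi> that in \<open>simp add: bij_betw_def\<close>)
  have uW: "u x \<in> ?W" if "x \<in> ?K" for x using \<psi>[OF that] unfolding u_def by auto
  have fibre: "\<kappa> \<le>o |{x \<in> ?K. u x = w}|" if "w \<in> ?W" for w
  proof -
    have "|?K| \<le>o |{x \<in> ?K. u x = w}|"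
    proof (rule card_of_ordLeqI[where f = "\<lambda>y. \<phi> (w, y)"])
      have inj: "inj_on \<phi> (?W \<times> ?K)" using \<phi> by (simp add: bij_betw_def)
      show "inj_on (\<lambda>y. \<phi> (w, y)) ?K"
        by (rule inj_onI) (use inj_onD[OF inj] that in blast)
      show "\<phi> (w, y) \<in> {x \<in> ?K. u x = w}" if "y \<in> ?K" for y
      proof -
        have wy: "(w, y) \<in> ?W \<times> ?K" using that \<open>w \<in> ?W\<close> by simp
        then have "\<phi> (w, y) \<in> ?K" using bij_betw_apply[OF \<phi>] by blast
        moreover have "\<psi> (\<phi> (w, y)) = (w, y)" unfolding \<psi>_def by (rule inv_into_f_f[OF inj wy])
        ultimately show ?thesis by (simp add: u_def)
      qed
    qed
    then show ?thesis using Kiso(1) ordIso_ordLeq_trans by blast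
  qed
  define le where "le i = lex_by (\<lambda>x. u x i) (q i) \<kappa>" for i
  have le: "well_order_on ?K (le i) \<and> le i =o ord_mult \<kappa> (q i)" if i: "i \<in> {1..n}" for i
  proof -
    have Wq: "Well_order (q i)" using q i by blast
    have uq: "u x i \<in> Field (q i)" if "x \<in> ?K" for x using PiE_mem[OF uW[OF that] i] .
    have "\<kappa> \<le>o |{x \<in> ?K. u x i = a}|" if a: "a \<in> Field (q i)" for a
    proof -
      obtain w where w: "w \<in> ?W" "w i = a" using W_ne[OF i a] by blast
      have "|{x \<in> ?K. u x = w}| \<le>o |{x \<in> ?K. u x i = a}|" by (rule card_of_mono1) (use w(2) in auto)
      then show ?thesis using fibre[OF w(1)] ordLeq_transitive by blast
    qed
    then show ?thesis unfolding le_def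
      using well_order_on_lex_by[where f = "\<lambda>x. u x i", OF K(2) Wq uq]
        lex_by_ordIso[where f = "\<lambda>x. u x i", OF K(1) Wq uq] by blast
  qed
  define l where "l = lex_by u T \<kappa>"
  have uT: "u x \<in> Field T" if "x \<in> ?K" for x using uW[OF that] unfolding FT .
  have "l =o ord_mult \<kappa> T" unfolding l_def
    by (rule lex_by_ordIso[where f = u, OF K(1) WT uT]) (use fibre FT in auto)
  have "hessenberg_prod q n \<le>o T"
    by (rule ordIso_ordLeq_trans[OF hessenberg_prod_eq[of n q Q, OF Q] T(3)])
  then have "ord_mult \<kappa> (hessenberg_prod q n) \<le>o ord_mult \<kappa> T" by (rule ord_mult_mono[OF K(2)])
  also have "ord_mult \<kappa> T =o l" by (rule ordIso_symmetric[OF \<open>l =o ord_mult \<kappa> T\<close>])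
  finally have "ord_mult \<kappa> (hessenberg_prod q n) \<le>o l" .
  moreover have "linear_extension_on ?K (\<Inter>i\<in>{1..n}. le i) l"
    unfolding linear_extension_on_def
  proof
    show "linear_order_on ?K l"
      using well_order_on_lex_by[where f = u, OF K(2) WT uT] unfolding l_def well_order_on_def by blast
    show "(\<Inter>i\<in>{1..n}. le i) \<subseteq> l"
    proof
      fix p assume p: "p \<in> (\<Inter>i\<in>{1..n}. le i)"
      obtain x y where xy: "p = (x, y)" by fastforce
      have le_xy: "x \<in> ?K" "y \<in> ?K" "(u x i, u y i) \<in> q i - Id \<or> u x i = u y i \<and> (x, y) \<in> \<kappa>"
        if "i \<in> {1..n}" for i
        using p that unfolding xy le_def lex_by_def by auto
      \<comment> \<open>Since \<open>n\<close> is positive there is a coordinate to consult: for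
        equal tuples it is the first ordering that yields
        \<open>(x, y) \<in> \<kappa>\<close>.\<close>
      have one: "1 \<in> {1..n}" using n by simp
      note xK = le_xy(1,2)[OF one]
      have "(u x i, u y i) \<in> q i" if i: "i \<in> {1..n}" for i
      proof -
        have "refl_on (Field (q i)) (q i)" using q i by (auto simp: order_on_defs)
        then have "(u x i, u x i) \<in> q i" using PiE_mem[OF uW[OF xK(1)] i] by (simp add: refl_on_def)
        then show ?thesis using le_xy(3)[OF i] by auto
      qed
      then have "(u x, u y) \<in> T" using T(2)[OF uW[OF xK(1)] uW[OF xK(2)]] by blast
      moreover have "(x, y) \<in> \<kappa>" if "u x = u y" using le_xy(3)[OF one] that by auto
      ultimately show "p \<in> l" unfolding xy l_def lex_by_def using xK by auto
    qed
  qed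
  ultimately show ?thesis using le by (intro exI[of _ le]) blast
qed

text \<open>A linear order has no linear extension but itself.\<close>

lemma wpo_length_well_order_on:
  assumes l: "well_order_on X l" shows "wpo_length X l = l"
proof -
  have "linear_extension_on X l (wpo_length X l)" by (rule wpo_length(1)[OF wpo_on_well_order[OF l]])
  then show ?thesis
    using l linear_order_on_subset_eq[of X l "wpo_length X l"]
    unfolding linear_extension_on_def well_order_on_def by simp
qed

theorem proposition1p1:
  fixes \<kappa> :: "'k rel" and n :: nat and q :: "nat \<Rightarrow> 'q rel"
  assumes "Cinfinite \<kappa>"
    and "n \<ge> 1"
    and "\<forall>i\<in>{1..n}. Well_order (q i)"
  shows
    "(\<forall>(X :: 'a set) (leq :: 'a rel) (le :: nat \<Rightarrow> 'a rel).
        |X| =o \<kappa> \<and> partial_order_on X leq \<and> leq = (\<Inter>i\<in>{1..n}. le i) \<and>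
        (\<forall>i\<in>{1..n}. wpo_on X (le i) \<and> wpo_length X (le i) \<le>o ord_mult \<kappa> (q i)) \<longrightarrow>
        wpo_on X leq \<and> wpo_length X leq \<le>o ord_mult \<kappa> (hessenberg_prod q n))
     \<and>
     ((\<forall>i\<in>{1..n}. Field (q i) \<noteq> {} \<and> |Field (q i)| \<le>o \<kappa>) \<longrightarrow>
        (\<exists>(X :: 'k set) (le :: nat \<Rightarrow> 'k rel).
           |X| =o \<kappa> \<and>
           (\<forall>i\<in>{1..n}. well_order_on X (le i) \<and> le i =o ord_mult \<kappa> (q i)) \<and>
           wpo_on X (\<Inter>i\<in>{1..n}. le i) \<and>
           wpo_length X (\<Inter>i\<in>{1..n}. le i) =o ord_mult \<kappa> (hessenberg_prod q n)))"
proof (intro conjI allI impI; (elim conjE)?)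
  fix X :: "'a set" and leq :: "'a rel" and le :: "nat \<Rightarrow> 'a rel"
  assume leq: "leq = (\<Inter>i\<in>{1..n}. le i)"
    and le: "\<forall>i\<in>{1..n}. wpo_on X (le i) \<and> wpo_length X (le i) \<le>o ord_mult \<kappa> (q i)"
  have "{1..n} \<noteq> {}" using assms(2) by simp
  then show "wpo_on X leq" unfolding leq using le by (intro wpo_INT) auto
  show "wpo_length X leq \<le>o ord_mult \<kappa> (hessenberg_prod q n)"
    unfolding leq by (rule wpo_length_INT_ordLeq[OF assms]) (use le in auto)
next
  assume ne: "\<forall>i\<in>{1..n}. Field (q i) \<noteq> {} \<and> |Field (q i)| \<le>o \<kappa>"
  obtain le :: "nat \<Rightarrow> 'k rel" and l where le: "\<forall>i\<in>{1..n}. well_order_on (Field \<kappa>) (le i) \<and> le i =o ord_mult \<kappa> (q i)"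
    and l: "linear_extension_on (Field \<kappa>) (\<Inter>i\<in>{1..n}. le i) l" "ord_mult \<kappa> (hessenberg_prod q n) \<le>o l"
    using length_attained[OF assms ne] by blast
  let ?X = "Field \<kappa>" and ?R = "\<Inter>i\<in>{1..n}. le i"
  have wpo: "wpo_on ?X (le i)" if "i \<in> {1..n}" for i using wpo_on_well_order le that by blast
  have wpoR: "wpo_on ?X ?R" using assms(2) wpo by (intro wpo_INT) auto
  have len: "wpo_length ?X (le i) \<le>o ord_mult \<kappa> (q i)" if "i \<in> {1..n}" for i
    using le that wpo_length_well_order_on[of ?X "le i"] ordIso_imp_ordLeq by metis
  \<comment> \<open>The family just built satisfies the hypotheses of the upper bound, and
    \<open>l\<close> witnesses the reverse inequality.\<close>
  have "wpo_length ?X ?R \<le>o ord_mult \<kappa> (hessenberg_prod q n)"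
    by (rule wpo_length_INT_ordLeq[OF assms wpo len])
  moreover have "ord_mult \<kappa> (hessenberg_prod q n) \<le>o wpo_length ?X ?R"
    using l wpo_length(2)[OF wpoR] ordLeq_transitive by blast
  ultimately have "wpo_length ?X ?R =o ord_mult \<kappa> (hessenberg_prod q n)" by (simp add: ordIso_iff_ordLeq)
  moreover have "|?X| =o \<kappa>" using card_of_Field_ordIso assms(1) by blast
  ultimately show "\<exists>(X :: 'k set) (le :: nat \<Rightarrow> 'k rel).
           |X| =o \<kappa> \<and>
           (\<forall>i\<in>{1..n}. well_order_on X (le i) \<and> le i =o ord_mult \<kappa> (q i)) \<and>
           wpo_on X (\<Inter>i\<in>{1..n}. le i) \<and>
           wpo_length X (\<Inter>i\<in>{1..n}. le i) =o ord_mult \<kappa> (hessenberg_prod q n)"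
    using le wpoR by blast
qed

end
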